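(* Let $k$ be a field and let $A$ and $B$ be commutative Noetherian $k$-algebras such that $R = A \otimes_k B$ is also Noetherian. Let $I,K \subseteq A$ and $J,L \subseteq B$ be ideals, and let $u$ be a positive rational number. If the binomial expansion formula holds for $I$ and $J$ at power $u$, i.e. if $$\overline{(I+J)^u} = \sum_{\substack{0 \le w \le u \\ w \in \mathbb Q}} \overline{I^{w}} \cdot \overline{J^{u-w}},$$ then $$\overline{(I+J)^{(u)}_{KL}} = \sum_{\substack{0 \le w \le u \\ w \in \mathbb Q}} \overline{I^{(w)}_K} \cdot \overline{J^{(u-w)}_L}.$$
   Context: Ideals of $A$ or $B$ are identified with their extensions to $R$ where needed: $I+J$ denotes the ideal $IR+JR$ of $R$, $KL$ denotes $(KR)(LR)$, and products such as $\overline{I^w}\cdot\overline{J^{u-w}}$ denote $(\overline{I^w}R)(\overline{J^{u-w}}R)$, where $\overline{I^w}$ is computed in $A$ and $\overline{J^{u-w}}$ in $B$ (and similarly for the saturated powers). For an ideal $\mathfrak a$ of a Noetherian ring $S$ and a positive rational $u=\frac pq$ ($p,q$ positive integers), the $u$-th rational power is $\overline{\mathfrak a^u}=\{f\in S\mid f^q\in\overline{\mathfrak a^p}\}$, where $\overline{\mathfrak a^p}$ is the integral closure of $\mathfrak a^p$; it is independent of the presentation of $u$; for exponent $0$ it is the unit ideal $S$. For ideals $\mathfrak a,\mathfrak b\subseteq S$, the $u$-th saturated power of $\mathfrak a$ with respect to $\mathfrak b$ is $\overline{\mathfrak a^{(u)}_{\mathfrak b}}=\overline{\mathfrak a^u}:_S\mathfrak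 b^\infty=\bigcup_{m\ge1}(\overline{\mathfrak a^u}:_S\mathfrak b^m)$ (the unit ideal for exponent $0$). *)

theory Defs
  imports "HOL-Algebra.Algebra" "HOL-Algebra.Free_Abelian_Groups"
begin

section \<open>The tensor product of two commutative algebras\<close>

text \<open>
  The tensor product of \<open>A\<close> and \<open>B\<close> over \<open>k\<close> is the free abelian group on
  \<open>carrier A \<times> carrier B\<close>, with the multiplication that extends
  \<open>(a, b) (a', b') = (a a', b b')\<close> biadditively, modulo the relations that make the class of
  \<open>(a, b)\<close> biadditive and \<open>k\<close>-balanced.  The relations are stable under multiplication by a
  pair \<open>(a, b)\<close>, so the ideal they generate is the subgroup they generate.
\<close>

definition tensor_free :: "('a, 'm) ring_scheme \<Rightarrow> ('b, 'n) ring_scheme \<Rightarrow> (('a \<times> 'b) \<Rightarrow>\<^sub>0 int) ring"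
  where "tensor_free A B =
    \<lparr>carrier = {x. Poly_Mapping.keys x \<subseteq> carrier A \<times> carrier B},
     monoid.mult = (\<lambda>x y. frag_extend (\<lambda>(a, b).
               frag_extend (\<lambda>(a', b'). frag_of (a \<otimes>\<^bsub>A\<^esub> a', b \<otimes>\<^bsub>B\<^esub> b')) y) x),
     one = frag_of (\<one>\<^bsub>A\<^esub>, \<one>\<^bsub>B\<^esub>),
     ring.zero = 0,
     ring.add = (+)\<rparr>"

inductive_set tensor_rels ::
    "('k, 'l) ring_scheme \<Rightarrow> ('k, 'a, 'm) module_scheme \<Rightarrow> ('k, 'b, 'n) module_scheme
      \<Rightarrow> (('a \<times> 'b) \<Rightarrow>\<^sub>0 int) set"
  for k A B where
    add_left: "\<lbrakk>a \<in> carrier A; a' \<in> carrier A; b \<in> carrier B\<rbrakk> \<Longrightarrow>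
      frag_of (a \<oplus>\<^bsub>A\<^esub> a', b) - frag_of (a, b) - frag_of (a', b) \<in> tensor_rels k A B"
  | add_right: "\<lbrakk>a \<in> carrier A; b \<in> carrier B; b' \<in> carrier B\<rbrakk> \<Longrightarrow>
      frag_of (a, b \<oplus>\<^bsub>B\<^esub> b') - frag_of (a, b) - frag_of (a, b') \<in> tensor_rels k A B"
  | balanced: "\<lbrakk>c \<in> carrier k; a \<in> carrier A; b \<in> carrier B\<rbrakk> \<Longrightarrow>
      frag_of (c \<odot>\<^bsub>A\<^esub> a, b) - frag_of (a, c \<odot>\<^bsub>B\<^esub> b) \<in> tensor_rels k A B"

definition tensor_ideal ::
    "('k, 'l) ring_scheme \<Rightarrow> ('k, 'a, 'm) module_scheme \<Rightarrow> ('k, 'b, 'n) module_scheme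
      \<Rightarrow> (('a \<times> 'b) \<Rightarrow>\<^sub>0 int) set"
  where "tensor_ideal k A B = Idl\<^bsub>tensor_free A B\<^esub> (tensor_rels k A B)"

definition tensor ::
    "('k, 'l) ring_scheme \<Rightarrow> ('k, 'a, 'm) module_scheme \<Rightarrow> ('k, 'b, 'n) module_scheme
      \<Rightarrow> (('a \<times> 'b) \<Rightarrow>\<^sub>0 int) set ring"
  where "tensor k A B = tensor_free A B Quot tensor_ideal k A B"

definition pure_tensor ::
    "('k, 'l) ring_scheme \<Rightarrow> ('k, 'a, 'm) module_scheme \<Rightarrow> ('k, 'b, 'n) module_scheme
      \<Rightarrow> 'a \<Rightarrow> 'b \<Rightarrow> (('a \<times> 'b) \<Rightarrow>\<^sub>0 int) set"
  where "pure_tensor k A B a b = tensor_ideal k A B +>\<^bsub>tensor_free A B\<^esub> frag_of (a, b)"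

lemma frag_extend_fun_diff: "frag_extend (\<lambda>x. f x - g x) c = frag_extend f c - frag_extend g c"
  using subset_UNIV
  by (induction c rule: frag_induction) (simp_all add: frag_extend_diff)

lemma frag_extend_fun_0: "frag_extend (\<lambda>x. 0) c = 0"
  by (simp add: frag_extend_eq_0)

lemma tensor_free_simps [simp]:
  "x \<in> carrier (tensor_free A B) \<longleftrightarrow> Poly_Mapping.keys x \<subseteq> carrier A \<times> carrier B"
  "\<one>\<^bsub>tensor_free A B\<^esub> = frag_of (\<one>\<^bsub>A\<^esub>, \<one>\<^bsub>B\<^esub>)"
  "\<zero>\<^bsub>tensor_free A B\<^esub> = 0"
  "x \<oplus>\<^bsub>tensor_free A B\<^esub> y = x + y"
  by (simp_all add: tensor_free_def)

lemma tensor_free_mult_of [simp]: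
  "frag_of (a, b) \<otimes>\<^bsub>tensor_free A B\<^esub> frag_of (a', b') = frag_of (a \<otimes>\<^bsub>A\<^esub> a', b \<otimes>\<^bsub>B\<^esub> b')"
  by (simp add: tensor_free_def)

lemma tensor_free_mult_simps [simp]:
  "0 \<otimes>\<^bsub>tensor_free A B\<^esub> y = 0" "x \<otimes>\<^bsub>tensor_free A B\<^esub> 0 = 0"
  by (simp_all add: tensor_free_def frag_extend_fun_0 case_prod_unfold)

lemma tensor_free_mult_diff:
  "(x - x') \<otimes>\<^bsub>tensor_free A B\<^esub> y = x \<otimes>\<^bsub>tensor_free A B\<^esub> y - x' \<otimes>\<^bsub>tensor_free A B\<^esub> y"
  "x \<otimes>\<^bsub>tensor_free A B\<^esub> (y - y') = x \<otimes>\<^bsub>tensor_free A B\<^esub> y - x \<otimes>\<^bsub>tensor_free A B\<^esub> y'"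
  by (simp_all add: tensor_free_def frag_extend_diff frag_extend_fun_diff case_prod_unfold)

lemma tensor_free_mult_add:
  "(x + x') \<otimes>\<^bsub>tensor_free A B\<^esub> y = x \<otimes>\<^bsub>tensor_free A B\<^esub> y + x' \<otimes>\<^bsub>tensor_free A B\<^esub> y"
  "x \<otimes>\<^bsub>tensor_free A B\<^esub> (y + y') = x \<otimes>\<^bsub>tensor_free A B\<^esub> y + x \<otimes>\<^bsub>tensor_free A B\<^esub> y'"
  using tensor_free_mult_diff(1)[where x = "x + x'" and x' = x' and A = A and B = B and y = y]
    tensor_free_mult_diff(2)[where x = x and y = "y + y'" and y' = y' and A = A and B = B]
  by (simp_all add: algebra_simps)

lemma cring_tensor_free:
  assumes "cring A" "cring B"
  shows "cring (tensor_free A B)"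
proof -
  interpret A: cring A by fact
  interpret B: cring B by fact
  let ?T = "tensor_free A B" and ?S = "carrier A \<times> carrier B"
  have keys_diff': "Poly_Mapping.keys (x - y) \<subseteq> ?S"
    if "Poly_Mapping.keys x \<subseteq> ?S" "Poly_Mapping.keys y \<subseteq> ?S" for x y :: "_ \<Rightarrow>\<^sub>0 int"
    using keys_diff[of x y] that by blast
  have closed1: "Poly_Mapping.keys (frag_of s \<otimes>\<^bsub>?T\<^esub> y) \<subseteq> ?S"
    if "s \<in> ?S" "Poly_Mapping.keys y \<subseteq> ?S" for s y
    using that(2,1)
    by (induction y rule: frag_induction)
      (auto simp: tensor_free_mult_diff keys_diff' simp del: frag_of_nonzero)
  have closed: "Poly_Mapping.keys (x \<otimes>\<^bsub>?T\<^esub> y) \<subseteq> ?S"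
    if "Poly_Mapping.keys x \<subseteq> ?S" "Poly_Mapping.keys y \<subseteq> ?S" for x y
    using that by (induction x rule: frag_induction) (simp_all add: closed1 tensor_free_mult_diff keys_diff')
  have one: "\<one>\<^bsub>?T\<^esub> \<otimes>\<^bsub>?T\<^esub> x = x" if "Poly_Mapping.keys x \<subseteq> ?S" for x
    using that by (induction x rule: frag_induction) (auto simp: tensor_free_mult_diff)
  have comm1: "frag_of s \<otimes>\<^bsub>?T\<^esub> y = y \<otimes>\<^bsub>?T\<^esub> frag_of s"
    if "s \<in> ?S" "Poly_Mapping.keys y \<subseteq> ?S" for s y
    using that(2,1)
    by (induction y rule: frag_induction)
      (auto simp: tensor_free_mult_diff A.m_comm B.m_comm)
  have comm: "x \<otimes>\<^bsub>?T\<^esub> y = y \<otimes>\<^bsub>?T\<^esub> x"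
    if "Poly_Mapping.keys x \<subseteq> ?S" "Poly_Mapping.keys y \<subseteq> ?S" for x y
    using that by (induction x rule: frag_induction) (simp_all add: comm1 tensor_free_mult_diff)
  have assoc1: "(frag_of s \<otimes>\<^bsub>?T\<^esub> frag_of t) \<otimes>\<^bsub>?T\<^esub> z = frag_of s \<otimes>\<^bsub>?T\<^esub> (frag_of t \<otimes>\<^bsub>?T\<^esub> z)"
    if "s \<in> ?S" "t \<in> ?S" "Poly_Mapping.keys z \<subseteq> ?S" for s t z
    using that(3,1,2)
    by (induction z rule: frag_induction)
      (auto simp: tensor_free_mult_diff A.m_assoc B.m_assoc)
  have assoc2: "(frag_of s \<otimes>\<^bsub>?T\<^esub> y) \<otimes>\<^bsub>?T\<^esub> z = frag_of s \<otimes>\<^bsub>?T\<^esub> (y \<otimes>\<^bsub>?T\<^esub> z)"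
    if "s \<in> ?S" "Poly_Mapping.keys y \<subseteq> ?S" "Poly_Mapping.keys z \<subseteq> ?S" for s y z
    using that(2,1,3)
    by (induction y rule: frag_induction) (simp_all add: assoc1 tensor_free_mult_diff)
  have assoc: "(x \<otimes>\<^bsub>?T\<^esub> y) \<otimes>\<^bsub>?T\<^esub> z = x \<otimes>\<^bsub>?T\<^esub> (y \<otimes>\<^bsub>?T\<^esub> z)"
    if "Poly_Mapping.keys x \<subseteq> ?S" "Poly_Mapping.keys y \<subseteq> ?S" "Poly_Mapping.keys z \<subseteq> ?S" for x y z
    using that by (induction x rule: frag_induction) (simp_all add: assoc2 tensor_free_mult_diff)
  have keys_add': "Poly_Mapping.keys (x + y) \<subseteq> ?S"
    if "Poly_Mapping.keys x \<subseteq> ?S" "Poly_Mapping.keys y \<subseteq> ?S" for x y :: "_ \<Rightarrow>\<^sub>0 int"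
    using keys_add[of x y] that by blast
  have "abelian_group ?T"
  proof (rule abelian_groupI)
    show "\<exists>y\<in>carrier ?T. y \<oplus>\<^bsub>?T\<^esub> x = \<zero>\<^bsub>?T\<^esub>" if "x \<in> carrier ?T" for x
      using that by (intro bexI[of _ "- x"]) simp_all
  qed (simp_all add: keys_add' add_ac)
  moreover have "comm_monoid ?T"
  proof (rule comm_monoidI)
    show "x \<otimes>\<^bsub>?T\<^esub> y = y \<otimes>\<^bsub>?T\<^esub> x" if "x \<in> carrier ?T" "y \<in> carrier ?T" for x y
      using that comm by simp
    show "\<one>\<^bsub>?T\<^esub> \<otimes>\<^bsub>?T\<^esub> x = x" if "x \<in> carrier ?T" for x
      using that one by simp
  qed (simp_all add: closed assoc)
  ultimately show ?thesis
    by (rule cringI) (simp add: tensor_free_mult_add)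
qed

lemma tensor_rels_carrier:
  assumes "algebra k A" "algebra k B"
  shows "tensor_rels k A B \<subseteq> carrier (tensor_free A B)"
proof -
  interpret A: algebra k A by fact
  interpret B: algebra k B by fact
  let ?S = "carrier A \<times> carrier B"
  have keys_diff': "Poly_Mapping.keys (x - y) \<subseteq> ?S"
    if "Poly_Mapping.keys x \<subseteq> ?S" "Poly_Mapping.keys y \<subseteq> ?S" for x y :: "_ \<Rightarrow>\<^sub>0 int"
    using keys_diff[of x y] that by blast
  have "Poly_Mapping.keys x \<subseteq> ?S" if "x \<in> tensor_rels k A B" for x
    using that by cases (simp_all add: keys_diff')
  thus ?thesis by auto
qed

lemma ideal_tensor_ideal:
  assumes "algebra k A" "algebra k B"
  shows "ideal (tensor_ideal k A B) (tensor_free A B)"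
proof -
  interpret T: cring "tensor_free A B"
    using assms by (intro cring_tensor_free algebra.M_cring)
  show ?thesis
    unfolding tensor_ideal_def by (intro T.genideal_ideal tensor_rels_carrier assms)
qed

lemma cring_tensor:
  assumes "algebra k A" "algebra k B"
  shows "cring (tensor k A B)"
  unfolding tensor_def
  using assms by (intro ideal.quotient_is_cring ideal_tensor_ideal cring_tensor_free algebra.M_cring)

lemma tensor_carrierE:
  assumes "V \<in> carrier (tensor k A B)"
  obtains x where "x \<in> carrier (tensor_free A B)"
    "V = tensor_ideal k A B +>\<^bsub>tensor_free A B\<^esub> x"
proof -
  have "carrier (tensor k A B) = a_rcosets\<^bsub>tensor_free A B\<^esub> tensor_ideal k A B"
    unfolding tensor_def FactRing_def by (rule partial_object.select_convs)
  thus thesis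
    using assms that unfolding A_RCOSETS_def'[of "tensor_free A B" "tensor_ideal k A B"] by blast
qed

lemma pure_tensor_closed:
  assumes "algebra k A" "algebra k B" "a \<in> carrier A" "b \<in> carrier B"
  shows "pure_tensor k A B a b \<in> carrier (tensor k A B)"
  using ring_hom_closed[OF ideal.rcos_ring_hom[OF ideal_tensor_ideal[OF assms(1,2)]]] assms(3,4)
  by (simp add: pure_tensor_def tensor_def)

lemma pure_tensor_mult:
  assumes "algebra k A" "algebra k B"
    and "a \<in> carrier A" "b \<in> carrier B" "a' \<in> carrier A" "b' \<in> carrier B"
  shows "pure_tensor k A B a b \<otimes>\<^bsub>tensor k A B\<^esub> pure_tensor k A B a' b'
           = pure_tensor k A B (a \<otimes>\<^bsub>A\<^esub> a') (b \<otimes>\<^bsub>B\<^esub> b')"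
  using ring_hom_mult[OF ideal.rcos_ring_hom[OF ideal_tensor_ideal[OF assms(1,2)]],
      of "frag_of (a, b)" "frag_of (a', b')"] assms(3-)
  by (simp add: pure_tensor_def tensor_def)

lemma pure_tensor_one:
  assumes "algebra k A" "algebra k B"
  shows "pure_tensor k A B \<one>\<^bsub>A\<^esub> \<one>\<^bsub>B\<^esub> = \<one>\<^bsub>tensor k A B\<^esub>"
  using ring_hom_one[OF ideal.rcos_ring_hom[OF ideal_tensor_ideal[OF assms(1,2)]]]
  by (simp add: pure_tensor_def tensor_def)

lemma tensor_coset_eqI:
  assumes "algebra k A" "algebra k B"
    and "x \<in> carrier (tensor_free A B)" "y \<in> carrier (tensor_free A B)"
    and "x - y \<in> tensor_rels k A B"
  shows "tensor_ideal k A B +>\<^bsub>tensor_free A B\<^esub> x = tensor_ideal k A B +>\<^bsub>tensor_free A B\<^esub> y"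
proof -
  let ?T = "tensor_free A B"
  interpret T: cring ?T
    using assms by (intro cring_tensor_free algebra.M_cring)
  interpret N: ideal "tensor_ideal k A B" ?T
    by (rule ideal_tensor_ideal) fact+
  have "x \<ominus>\<^bsub>?T\<^esub> y = x - y"
    using assms(3,4) T.minus_eq T.minus_equality[of "- y" y] by simp
  moreover have "x - y \<in> tensor_ideal k A B"
    unfolding tensor_ideal_def
    using assms T.genideal_self[OF tensor_rels_carrier[OF assms(1,2)]] by blast
  ultimately show ?thesis
    using T.quotient_eq_iff_same_a_r_cos[OF ideal_tensor_ideal[OF assms(1,2)] assms(3,4)] by simp
qed

lemma pure_tensor_add_left:
  assumes "algebra k A" "algebra k B" "a \<in> carrier A" "a' \<in> carrier A" "b \<in> carrier B"
  shows "pure_tensor k A B (a \<oplus>\<^bsub>A\<^esub> a') b = pure_tensor k A B a b \<oplus>\<^bsub>tensor k A B\<^esub> pure_tensor k A B a' b"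
proof -
  interpret A: algebra k A by fact
  have "pure_tensor k A B (a \<oplus>\<^bsub>A\<^esub> a') b
      = tensor_ideal k A B +>\<^bsub>tensor_free A B\<^esub> (frag_of (a, b) + frag_of (a', b))"
    unfolding pure_tensor_def
  proof (rule tensor_coset_eqI[OF assms(1,2)])
    show "frag_of (a, b) + frag_of (a', b) \<in> carrier (tensor_free A B)"
      using keys_add[of "frag_of (a, b)" "frag_of (a', b)"] assms(3-5) by auto
  qed (use tensor_rels.add_left[OF assms(3-5), of k] assms(3-5) in \<open>simp_all add: diff_diff_eq\<close>)
  also have "\<dots> = pure_tensor k A B a b \<oplus>\<^bsub>tensor k A B\<^esub> pure_tensor k A B a' b"
    using ring_hom_add[OF ideal.rcos_ring_hom[OF ideal_tensor_ideal[OF assms(1,2)]],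
        of "frag_of (a, b)" "frag_of (a', b)"] assms(3-)
    by (simp add: pure_tensor_def tensor_def)
  finally show ?thesis .
qed

lemma pure_tensor_add_right:
  assumes "algebra k A" "algebra k B" "a \<in> carrier A" "b \<in> carrier B" "b' \<in> carrier B"
  shows "pure_tensor k A B a (b \<oplus>\<^bsub>B\<^esub> b') = pure_tensor k A B a b \<oplus>\<^bsub>tensor k A B\<^esub> pure_tensor k A B a b'"
proof -
  interpret B: algebra k B by fact
  have "pure_tensor k A B a (b \<oplus>\<^bsub>B\<^esub> b')
      = tensor_ideal k A B +>\<^bsub>tensor_free A B\<^esub> (frag_of (a, b) + frag_of (a, b'))"
    unfolding pure_tensor_def
  proof (rule tensor_coset_eqI[OF assms(1,2)])
    show "frag_of (a, b) + frag_of (a, b') \<in> carrier (tensor_free A B)"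
      using keys_add[of "frag_of (a, b)" "frag_of (a, b')"] assms(3-5) by auto
  qed (use tensor_rels.add_right[OF assms(3-5), of k] assms(3-5) in \<open>simp_all add: diff_diff_eq\<close>)
  also have "\<dots> = pure_tensor k A B a b \<oplus>\<^bsub>tensor k A B\<^esub> pure_tensor k A B a b'"
    using ring_hom_add[OF ideal.rcos_ring_hom[OF ideal_tensor_ideal[OF assms(1,2)]],
        of "frag_of (a, b)" "frag_of (a, b')"] assms(3-)
    by (simp add: pure_tensor_def tensor_def)
  finally show ?thesis .
qed

lemma pure_tensor_balanced:
  assumes "algebra k A" "algebra k B" "c \<in> carrier k" "a \<in> carrier A" "b \<in> carrier B"
  shows "pure_tensor k A B (c \<odot>\<^bsub>A\<^esub> a) b = pure_tensor k A B a (c \<odot>\<^bsub>B\<^esub> b)"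
proof -
  interpret A: algebra k A by fact
  interpret B: algebra k B by fact
  show ?thesis
    unfolding pure_tensor_def
    by (intro tensor_coset_eqI) (use assms in \<open>auto intro: tensor_rels.balanced\<close>)
qed

text \<open>The existence part of the universal property of the coproduct of commutative \<open>k\<close>-algebras.\<close>

theorem tensor_universal:
  assumes "algebra k A" "algebra k B" "cring C"
    and f: "f \<in> ring_hom A C" and g: "g \<in> ring_hom B C"
    and fg: "\<And>c. c \<in> carrier k \<Longrightarrow> f (c \<odot>\<^bsub>A\<^esub> \<one>\<^bsub>A\<^esub>) = g (c \<odot>\<^bsub>B\<^esub> \<one>\<^bsub>B\<^esub>)"
  obtains h where "h \<in> ring_hom (tensor k A B) C"
    "\<And>a b. a \<in> carrier A \<Longrightarrow> b \<in> carrier B \<Longrightarrow> h (pure_tensor k A B a b) = f a \<otimes>\<^bsub>C\<^esub> g b"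
proof -
  interpret A: algebra k A by fact
  interpret B: algebra k B by fact
  interpret C: cring C by fact
  let ?T = "tensor_free A B" and ?S = "carrier A \<times> carrier B"
  interpret T: cring ?T
    using assms by (intro cring_tensor_free algebra.M_cring)
  note fc = ring_hom_closed[OF f] and gc = ring_hom_closed[OF g]
  obtain h where h: "h \<in> hom (free_Abelian_group ?S) (add_monoid C)"
    and h_of: "\<And>s. s \<in> ?S \<Longrightarrow> h (frag_of s) = (case s of (a, b) \<Rightarrow> f a \<otimes>\<^bsub>C\<^esub> g b)"
    by (rule comm_group.free_Abelian_group_universal[OF C.a_comm_group,
          of "\<lambda>s. case s of (a, b) \<Rightarrow> f a \<otimes>\<^bsub>C\<^esub> g b" ?S]) (auto intro!: fc gc)
  have hc: "h x \<in> carrier C" if "Poly_Mapping.keys x \<subseteq> ?S" for x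
    using h that by (auto simp: hom_def Pi_def)
  have h_add: "h (x + y) = h x \<oplus>\<^bsub>C\<^esub> h y"
    if "Poly_Mapping.keys x \<subseteq> ?S" "Poly_Mapping.keys y \<subseteq> ?S" for x y
    using h that by (auto simp: hom_def)
  have keys_diff': "Poly_Mapping.keys (x - y) \<subseteq> ?S"
    if "Poly_Mapping.keys x \<subseteq> ?S" "Poly_Mapping.keys y \<subseteq> ?S" for x y :: "_ \<Rightarrow>\<^sub>0 int"
    using keys_diff[of x y] that by blast
  have h_diff: "h (x - y) = h x \<ominus>\<^bsub>C\<^esub> h y"
    if "Poly_Mapping.keys x \<subseteq> ?S" "Poly_Mapping.keys y \<subseteq> ?S" for x y
    using h_add[OF keys_diff'[OF that] that(2)] hc[OF that(1)] hc[OF that(2)] hc[OF keys_diff'[OF that]]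
    by (simp add: C.minus_eq C.a_assoc C.r_neg)
  have h_0: "h 0 = \<zero>\<^bsub>C\<^esub>"
    using h_diff[of 0 0] hc[of 0] by (simp add: C.minus_eq C.r_neg)
  have keys_mult: "Poly_Mapping.keys (x \<otimes>\<^bsub>?T\<^esub> y) \<subseteq> ?S"
    if "Poly_Mapping.keys x \<subseteq> ?S" "Poly_Mapping.keys y \<subseteq> ?S" for x y
    using T.m_closed that by simp
  have h_mult1: "h (frag_of s \<otimes>\<^bsub>?T\<^esub> y) = h (frag_of s) \<otimes>\<^bsub>C\<^esub> h y"
    if "s \<in> ?S" "Poly_Mapping.keys y \<subseteq> ?S" for s y
  proof -
    have "Poly_Mapping.keys y \<subseteq> ?S \<and> ?thesis"
      using that(2,1)
    proof (induction y rule: frag_induction)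
      case zero
      then show ?case using hc[of "frag_of s"] by (simp add: h_0)
    next
      case (one t)
      then show ?case
        using fc gc
        by (auto simp: h_of ring_hom_mult[OF f] ring_hom_mult[OF g] C.m_ac)
    next
      case (diff x y)
      then show ?case
        using hc[of "frag_of s"] hc[of x] hc[of y] keys_diff'[of x y]
        by (simp add: tensor_free_mult_diff h_diff keys_mult C.minus_eq C.r_distr C.r_minus)
    qed
    thus ?thesis by simp
  qed
  have h_mult: "h (x \<otimes>\<^bsub>?T\<^esub> y) = h x \<otimes>\<^bsub>C\<^esub> h y"
    if "Poly_Mapping.keys x \<subseteq> ?S" "Poly_Mapping.keys y \<subseteq> ?S" for x y
  proof -
    have "Poly_Mapping.keys x \<subseteq> ?S \<and> ?thesis"
      using that
    proof (induction x rule: frag_induction)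
      case zero
      then show ?case using hc[of y] by (simp add: h_0)
    next
      case (one t)
      then show ?case using h_mult1 by simp
    next
      case (diff x x')
      then show ?case
        using hc[of y] hc[of x] hc[of x'] keys_diff'[of x x']
        by (simp add: tensor_free_mult_diff h_diff keys_mult C.minus_eq C.l_distr C.l_minus)
    qed
    thus ?thesis by simp
  qed
  interpret h: ring_hom_ring ?T C h
    by (intro ring_hom_ringI2 T.ring_axioms C.ring_axioms ring_hom_memI)
      (auto simp: hc h_add h_mult h_of ring_hom_one[OF f] ring_hom_one[OF g])
  have fs: "f (c \<odot>\<^bsub>A\<^esub> a) = f (c \<odot>\<^bsub>A\<^esub> \<one>\<^bsub>A\<^esub>) \<otimes>\<^bsub>C\<^esub> f a" if "c \<in> carrier k" "a \<in> carrier A" for c a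
    using that ring_hom_mult[OF f, of "c \<odot>\<^bsub>A\<^esub> \<one>\<^bsub>A\<^esub>" a] by (simp add: A.smult_assoc2)
  have gs: "g (c \<odot>\<^bsub>B\<^esub> b) = g (c \<odot>\<^bsub>B\<^esub> \<one>\<^bsub>B\<^esub>) \<otimes>\<^bsub>C\<^esub> g b" if "c \<in> carrier k" "b \<in> carrier B" for c b
    using that ring_hom_mult[OF g, of "c \<odot>\<^bsub>B\<^esub> \<one>\<^bsub>B\<^esub>" b] by (simp add: B.smult_assoc2)
  have rel0: "h x = \<zero>\<^bsub>C\<^esub>" if "x \<in> tensor_rels k A B" for x
    using that
  proof cases
    case (add_left a a' b)
    have "h x = f (a \<oplus>\<^bsub>A\<^esub> a') \<otimes>\<^bsub>C\<^esub> g b \<ominus>\<^bsub>C\<^esub> f a \<otimes>\<^bsub>C\<^esub> g b \<ominus>\<^bsub>C\<^esub> f a' \<otimes>\<^bsub>C\<^esub> g b"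
      unfolding add_left(1) using add_left(2-) by (subst h_diff h_of | simp add: keys_diff')+
    also have "\<dots> = \<zero>\<^bsub>C\<^esub>"
      using add_left(2-) by (simp add: ring_hom_add[OF f] fc gc) (use fc gc add_left(2-) in algebra)
    finally show ?thesis .
  next
    case (add_right a b b')
    have "h x = f a \<otimes>\<^bsub>C\<^esub> g (b \<oplus>\<^bsub>B\<^esub> b') \<ominus>\<^bsub>C\<^esub> f a \<otimes>\<^bsub>C\<^esub> g b \<ominus>\<^bsub>C\<^esub> f a \<otimes>\<^bsub>C\<^esub> g b'"
      unfolding add_right(1) using add_right(2-) by (subst h_diff h_of | simp add: keys_diff')+
    also have "\<dots> = \<zero>\<^bsub>C\<^esub>"
      using add_right(2-) by (simp add: ring_hom_add[OF g] fc gc) (use fc gc add_right(2-) in algebra)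
    finally show ?thesis .
  next
    case (balanced c a b)
    have "h x = f (c \<odot>\<^bsub>A\<^esub> a) \<otimes>\<^bsub>C\<^esub> g b \<ominus>\<^bsub>C\<^esub> f a \<otimes>\<^bsub>C\<^esub> g (c \<odot>\<^bsub>B\<^esub> b)"
      unfolding balanced(1) using balanced(2-) by (subst h_diff h_of | simp)+
    also have "\<dots> = \<zero>\<^bsub>C\<^esub>"
      using balanced(2-) fg[of c] fc[of a] gc[of b] gc[of "c \<odot>\<^bsub>B\<^esub> \<one>\<^bsub>B\<^esub>"]
      by (simp add: fs[of c a] gs[of c b] C.minus_eq C.m_ac C.r_neg)
    finally show ?thesis .
  qed
  have sub: "tensor_ideal k A B \<subseteq> a_kernel ?T C h"
    unfolding tensor_ideal_def
  proof (rule T.genideal_minimal[OF h.kernel_is_ideal])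
    show "tensor_rels k A B \<subseteq> a_kernel ?T C h"
      unfolding a_kernel_def' using tensor_rels_carrier[OF assms(1,2)] rel0 by blast
  qed
  show thesis
  proof
    let ?N = "tensor_ideal k A B"
    have val: "the_elem (h ` (?N +>\<^bsub>?T\<^esub> x)) = h x" if x: "x \<in> carrier ?T" for x
    proof -
      have "h y = h x" if y: "y \<in> ?N +>\<^bsub>?T\<^esub> x" for y
      proof -
        obtain n where n: "n \<in> ?N" "y = n \<oplus>\<^bsub>?T\<^esub> x"
          using y unfolding a_r_coset_def' by blast
        have "n \<in> carrier ?T" "h n = \<zero>\<^bsub>C\<^esub>"
          using sub n(1) unfolding a_kernel_def' by blast+
        thus ?thesis using n(2) x h.hom_add h.hom_closed[OF x] by (simp only: C.l_zero)
      qed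
      moreover have "x \<in> ?N +>\<^bsub>?T\<^esub> x"
        using x ideal_tensor_ideal[OF assms(1,2)]
        by (intro abelian_subgroup.a_rcos_self abelian_subgroupI3 ideal.axioms(1) T.is_abelian_group)
      ultimately have "h ` (?N +>\<^bsub>?T\<^esub> x) = {h x}" by blast
      thus ?thesis by (simp only: the_elem_eq)
    qed
    note q = ideal.rcos_ring_hom[OF ideal_tensor_ideal[OF assms(1,2)], folded tensor_def]
    show "(\<lambda>V. the_elem (h ` V)) \<in> ring_hom (tensor k A B) C"
    proof (rule ring_hom_memI)
      show "the_elem (h ` V) \<in> carrier C" if "V \<in> carrier (tensor k A B)" for V
        by (rule tensor_carrierE[OF that]) (simp only: val h.hom_closed)
      show "the_elem (h ` (V \<otimes>\<^bsub>tensor k A B\<^esub> W)) = the_elem (h ` V) \<otimes>\<^bsub>C\<^esub> the_elem (h ` W)"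
        if V: "V \<in> carrier (tensor k A B)" and W: "W \<in> carrier (tensor k A B)" for V W
      proof -
        obtain x y where xy: "x \<in> carrier ?T" "y \<in> carrier ?T"
          "V = ?N +>\<^bsub>?T\<^esub> x" "W = ?N +>\<^bsub>?T\<^esub> y"
          using tensor_carrierE[OF V] tensor_carrierE[OF W] by metis
        show ?thesis
          unfolding xy(3,4) ring_hom_mult[OF q xy(1,2), symmetric]
            val[OF xy(1)] val[OF xy(2)] val[OF T.m_closed[OF xy(1,2)]] by (rule h.hom_mult[OF xy(1,2)])
      qed
      show "the_elem (h ` (V \<oplus>\<^bsub>tensor k A B\<^esub> W)) = the_elem (h ` V) \<oplus>\<^bsub>C\<^esub> the_elem (h ` W)"
        if V: "V \<in> carrier (tensor k A B)" and W: "W \<in> carrier (tensor k A B)" for V W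
      proof -
        obtain x y where xy: "x \<in> carrier ?T" "y \<in> carrier ?T"
          "V = ?N +>\<^bsub>?T\<^esub> x" "W = ?N +>\<^bsub>?T\<^esub> y"
          using tensor_carrierE[OF V] tensor_carrierE[OF W] by metis
        show ?thesis
          unfolding xy(3,4) ring_hom_add[OF q xy(1,2), symmetric]
            val[OF xy(1)] val[OF xy(2)] val[OF T.a_closed[OF xy(1,2)]] by (rule h.hom_add[OF xy(1,2)])
      qed
      show "the_elem (h ` \<one>\<^bsub>tensor k A B\<^esub>) = \<one>\<^bsub>C\<^esub>"
        unfolding ring_hom_one[OF q, symmetric] val[OF T.one_closed] by (rule h.hom_one)
    qed
    show "the_elem (h ` pure_tensor k A B a b) = f a \<otimes>\<^bsub>C\<^esub> g b"
      if "a \<in> carrier A" "b \<in> carrier B" for a b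
    proof -
      have "frag_of (a, b) \<in> carrier ?T" using that by simp
      thus ?thesis unfolding pure_tensor_def using val h_of[of "(a, b)"] that by simp
    qed
  qed
qed


section \<open>Extension of ideals to the tensor product\<close>

definition extend_left ::
    "('k, 'l) ring_scheme \<Rightarrow> ('k, 'a, 'm) module_scheme \<Rightarrow> ('k, 'b, 'n) module_scheme
      \<Rightarrow> 'a set \<Rightarrow> (('a \<times> 'b) \<Rightarrow>\<^sub>0 int) set set"
  where "extend_left k A B I = Idl\<^bsub>tensor k A B\<^esub> ((\<lambda>a. pure_tensor k A B a \<one>\<^bsub>B\<^esub>) ` I)"

definition extend_right ::
    "('k, 'l) ring_scheme \<Rightarrow> ('k, 'a, 'm) module_scheme \<Rightarrow> ('k, 'b, 'n) module_scheme
      \<Rightarrow> 'b set \<Rightarrow> (('a \<times> 'b) \<Rightarrow>\<^sub>0 int) set set"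
  where "extend_right k A B J = Idl\<^bsub>tensor k A B\<^esub> ((\<lambda>b. pure_tensor k A B \<one>\<^bsub>A\<^esub> b) ` J)"


section \<open>Rational powers and saturated powers of ideals\<close>

abbreviation ideal_power :: "('a, 'm) ring_scheme \<Rightarrow> 'a set \<Rightarrow> nat \<Rightarrow> 'a set"
  where "ideal_power S I n \<equiv> I [^]\<^bsub>ideals_set S\<^esub> n"

definition integral_closure :: "('a, 'm) ring_scheme \<Rightarrow> 'a set \<Rightarrow> 'a set"
  where "integral_closure S I =
    {f \<in> carrier S. \<exists>n c. 0 < n \<and> (\<forall>i\<in>{1..n}. c i \<in> ideal_power S I i) \<and>
       f [^]\<^bsub>S\<^esub> n \<oplus>\<^bsub>S\<^esub> (\<Oplus>\<^bsub>S\<^esub>i\<in>{1..n}. c i \<otimes>\<^bsub>S\<^esub> f [^]\<^bsub>S\<^esub> (n - i)) = \<zero>\<^bsub>S\<^esub>}"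

text \<open>
  The rational power does not depend on the presentation of the exponent as a quotient of positive
  integers, and the definition uses the presentation in lowest terms.  Negative exponents are
  meaningless.
\<close>

definition rational_power :: "('a, 'm) ring_scheme \<Rightarrow> 'a set \<Rightarrow> rat \<Rightarrow> 'a set"
  where "rational_power S I u =
    (if u = 0 then carrier S
     else (let (p, q) = quotient_of u in
       {f \<in> carrier S. f [^]\<^bsub>S\<^esub> nat q \<in> integral_closure S (ideal_power S I (nat p))}))"

definition colon_ideal :: "('a, 'm) ring_scheme \<Rightarrow> 'a set \<Rightarrow> 'a set \<Rightarrow> 'a set"
  where "colon_ideal S I J = {f \<in> carrier S. \<forall>g\<in>J. f \<otimes>\<^bsub>S\<^esub> g \<in> I}"

text \<open>For exponent \<open>0\<close> and an ideal \<open>J\<close>, the saturated power is \<open>carrier S\<close>.\<close>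

definition saturated_power :: "('a, 'm) ring_scheme \<Rightarrow> 'a set \<Rightarrow> 'a set \<Rightarrow> rat \<Rightarrow> 'a set"
  where "saturated_power S I J u =
    (\<Union>m\<in>{1..}. colon_ideal S (rational_power S I u) (ideal_power S J m))"

end

theory Submission
  imports Defs
begin

text \<open>
  Write \<open>X w\<close> for the rational powers of \<open>I\<close> and \<open>Y v\<close> for those of \<open>J\<close>.  The hypothesis says that
  the rational power of \<open>I + J\<close> is \<open>Q = \<Sum> X w \<cdot> Y (u - w)\<close>, and the claim is that saturating \<open>Q\<close> by
  \<open>KL\<close> amounts to saturating each \<open>X w\<close> by \<open>K\<close> and each \<open>Y v\<close> by \<open>L\<close>.  Only two properties of the
  rational powers enter: they are ideals, and they decrease in the exponent from the unit ideal on.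

  That the saturated products lie in the saturation of \<open>Q\<close> is a computation with pure tensors, because
  \<open>(KL)\<^sup>m\<close> is generated by the pure tensors of \<open>K\<^sup>m\<close> and \<open>L\<^sup>m\<close> (\<open>pure_ideal_power\<close>).  For the converse,
  \<open>R\<close> is Noetherian, so finitely many exponents \<open>w\<close> already give \<open>Q\<close>.  The claim then becomes: if
  \<open>(x \<otimes> y) z \<in> Q\<close> for all \<open>x \<in> K\<^sup>m\<close> and \<open>y \<in> L\<^sup>m\<close>, then \<open>z \<in> \<Sum> (X w : K\<^sup>m) \<cdot> (Y (u - w) : L\<^sup>m)\<close>.
  This is linear algebra over the field \<open>k\<close>, one factor at a time.  Let \<open>Y\<^sub>0 = 0 \<subseteq> Y\<^sub>1 \<subseteq> \<dots>\<close> be the chain of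
  the finitely many ideals \<open>Y (u - w)\<close> that occur, in the order of increasing \<open>w\<close>, and \<open>X\<^sub>i\<close> the partner
  of \<open>Y\<^sub>i\<^sub>+\<^sub>1\<close>; the exponents \<open>0\<close> and \<open>u\<close> may be assumed to occur, so the chain ends with \<open>B\<close>.  The partners
  decrease.  An element \<open>z\<close> lies in \<open>\<Sum> X\<^sub>i \<cdot> Y\<^sub>i\<^sub>+\<^sub>1\<close> exactly if, for every \<open>i\<close>, every slice \<open>id \<otimes> f\<close> along a linear
  functional \<open>f\<close> of \<open>B\<close> that vanishes on \<open>Y\<^sub>i\<close> sends \<open>z\<close> into \<open>X\<^sub>i\<close>.  The harder half of this criterion is
  \<open>mem_filtered_span_if_slices\<close>, which rests on the existence of functionals that vanish on a given
  subspace but not at a given vector (\<open>separating_functional\<close>).  Slices commute with multiplication by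
  elements of \<open>A\<close>, so the criterion turns divisibility of \<open>z\<close> into divisibility of its slices, that is,
  it replaces \<open>X w\<close> by a colon ideal (\<open>divide_left\<close>).

  That rational powers are ideals rests on the theory of integral closure of ideals.  An element \<open>h\<close> is
  integral over \<open>I\<close> as soon as \<open>h E \<subseteq> I E\<close> for a finitely generated ideal \<open>E\<close> that contains a power of \<open>h\<close>
  (\<open>integral_closure_criterion\<close>); this version of the Cayley-Hamilton argument is proved by eliminating
  the generators of \<open>E\<close> one after the other.  Products of such ideals \<open>E\<close> show that sums and products of
  integral elements are integral.
\<close>

section \<open>Products and powers of ideals\<close>

lemma (in ring) ideal_prod_subsetI:
  assumes "ideal U R" "\<And>i j. i \<in> I \<Longrightarrow> j \<in> J \<Longrightarrow> i \<otimes> j \<in> U"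
  shows "I \<cdot> J \<subseteq> U"
proof
  fix s assume "s \<in> I \<cdot> J"
  then show "s \<in> U"
    by induction (auto intro: assms(2) additive_subgroup.a_closed[OF ideal.axioms(1)[OF assms(1)]])
qed

lemma ideal_prod_mono:
  assumes "I \<subseteq> I'" "J \<subseteq> J'"
  shows "I \<cdot>\<^bsub>R\<^esub> J \<subseteq> I' \<cdot>\<^bsub>R\<^esub> J'"
proof
  fix s assume "s \<in> I \<cdot>\<^bsub>R\<^esub> J"
  then show "s \<in> I' \<cdot>\<^bsub>R\<^esub> J'"
    by induction (use assms in \<open>auto intro: ideal_prod.intros\<close>)
qed

lemma (in ring) ideal_a_minus_closed:
  assumes "ideal I R" "x \<in> I" "y \<in> I"
  shows "x \<ominus> y \<in> I"
proof -
  interpret ideal I R by fact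
  show ?thesis using assms(2,3) by (simp add: minus_eq)
qed

lemma ideals_set_sel [simp]:
  "carrier (ideals_set R) = {I. ideal I R}" "I \<otimes>\<^bsub>ideals_set R\<^esub> J = I \<cdot>\<^bsub>R\<^esub> J"
  "\<one>\<^bsub>ideals_set R\<^esub> = carrier R"
  by (simp_all add: ideals_set_def)

context cring
begin

lemma idealI_closed:
  assumes "A \<subseteq> carrier R" "\<zero> \<in> A" "\<And>x y. x \<in> A \<Longrightarrow> y \<in> A \<Longrightarrow> x \<oplus> y \<in> A"
    and mult: "\<And>x r. x \<in> A \<Longrightarrow> r \<in> carrier R \<Longrightarrow> r \<otimes> x \<in> A"
  shows "ideal A R"
proof (rule idealI[OF ring_axioms])
  show "subgroup A (add_monoid R)"
  proof (rule add.subgroupI)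
    show "\<ominus> a \<in> A" if "a \<in> A" for a
      using mult[OF that, of "\<ominus> \<one>"] subsetD[OF assms(1) that] by (simp add: l_minus)
  qed (use assms(1-3) in auto)
  show "x \<otimes> a \<in> A" if "a \<in> A" "x \<in> carrier R" for a x
    using mult that by blast
  then show "a \<otimes> x \<in> A" if "a \<in> A" "x \<in> carrier R" for a x
    using that m_comm[OF subsetD[OF assms(1) that(1)] that(2)] by metis
qed

lemma ideal_power_simps:
  "ideal_power R I 0 = carrier R" "ideal_power R I (Suc n) = ideal_power R I n \<cdot> I"
  by (simp_all add: monoid.nat_pow_0 monoid.nat_pow_Suc comm_monoid.axioms(1)[OF ideals_set_is_comm_monoid])

lemma ideal_power_is_ideal: "ideal I R \<Longrightarrow> ideal (ideal_power R I n) R"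
  using monoid.nat_pow_closed[OF comm_monoid.axioms(1)[OF ideals_set_is_comm_monoid], of I n] by simp

lemma ideal_power_add:
  "ideal I R \<Longrightarrow> ideal_power R I m \<cdot> ideal_power R I n = ideal_power R I (m + n)"
  using monoid.nat_pow_mult[OF comm_monoid.axioms(1)[OF ideals_set_is_comm_monoid], of I m n] by simp

lemma ideal_power_power:
  "ideal I R \<Longrightarrow> ideal_power R (ideal_power R I m) n = ideal_power R I (m * n)"
  using monoid.nat_pow_pow[OF comm_monoid.axioms(1)[OF ideals_set_is_comm_monoid], of I m n] by simp

lemma ideal_power_mono: "I \<subseteq> J \<Longrightarrow> ideal_power R I n \<subseteq> ideal_power R J n"
  by (induction n) (simp_all add: ideal_power_simps ideal_prod_mono)

lemma ideal_power_antimono: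
  assumes "ideal I R" "m \<le> n"
  shows "ideal_power R I n \<subseteq> ideal_power R I m"
proof -
  have "ideal_power R I n = ideal_power R I m \<cdot> ideal_power R I (n - m)"
    using assms by (simp add: ideal_power_add)
  also have "\<dots> \<subseteq> ideal_power R I m"
    using ideal_prod_inter[OF ideal_power_is_ideal ideal_power_is_ideal] assms(1) by blast
  finally show ?thesis .
qed

lemma ideal_power_1: "ideal I R \<Longrightarrow> ideal_power R I (Suc 0) = I"
  by (simp add: ideal_power_simps ideal_prod_commute[OF oneideal] ideal_prod_one)

lemma pow_mem_ideal_power:
  assumes "ideal I R" "x \<in> I"
  shows "x [^] n \<in> ideal_power R I n"
proof (induction n)
  case (Suc n)
  then show ?case using assms(2) by (simp add: ideal_power_simps ideal_prod.prod)
qed (simp add: ideal_power_simps)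

lemma ideal_finsum_closed:
  assumes "ideal I R" "finite S" "\<And>i. i \<in> S \<Longrightarrow> f i \<in> I"
  shows "(\<Oplus>i\<in>S. f i) \<in> I"
  using assms(2,3)
proof (induction S rule: finite_induct)
  case empty
  then show ?case using assms(1) by (simp add: additive_subgroup.zero_closed ideal.axioms(1))
next
  case (insert i S)
  then show ?case
    using assms(1) by (subst finsum_insert) (auto intro: additive_subgroup.a_closed[OF ideal.axioms(1)] ideal.Icarr)
qed

lemma set_addE:
  assumes "x \<in> I <+>\<^bsub>R\<^esub> J"
  obtains i j where "i \<in> I" "j \<in> J" "x = i \<oplus> j"
  using assms unfolding set_add_def' by blast

lemma subset_set_add:
  assumes "ideal I R" "ideal J R"
  shows "I \<subseteq> I <+>\<^bsub>R\<^esub> J" "J \<subseteq> I <+>\<^bsub>R\<^esub> J"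
proof -
  interpret I: ideal I R by fact
  interpret J: ideal J R by fact
  have "x \<oplus> \<zero> \<in> I <+>\<^bsub>R\<^esub> J" if "x \<in> I" for x
    using that J.zero_closed unfolding set_add_def' by blast
  then show "I \<subseteq> I <+>\<^bsub>R\<^esub> J" using I.Icarr by fastforce
  have "\<zero> \<oplus> x \<in> I <+>\<^bsub>R\<^esub> J" if "x \<in> J" for x
    using that I.zero_closed unfolding set_add_def' by blast
  then show "J \<subseteq> I <+>\<^bsub>R\<^esub> J" using J.Icarr by fastforce
qed

section \<open>Integral closure of ideals\<close>

lemma adjoin_ideal:
  assumes "ideal I R" "f \<in> carrier R"
  shows "ideal (I <+>\<^bsub>R\<^esub> PIdl f) R" "I \<subseteq> I <+>\<^bsub>R\<^esub> PIdl f" "f \<in> I <+>\<^bsub>R\<^esub> PIdl f"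
  using add_ideals[OF assms(1) cgenideal_ideal[OF assms(2)]]
    subset_set_add[OF assms(1) cgenideal_ideal[OF assms(2)]] cgenideal_self[OF assms(2)]
  by blast+

text \<open>
  In the binomial expansion of \<open>I (I + (f))\<^sup>n\<^sup>+\<^sup>1\<close> the term free of \<open>f\<close> is \<open>I\<^sup>n\<^sup>+\<^sup>2\<close>, and every other term has a
  factor \<open>f\<close> that can be split off.
\<close>

lemma adjoin_power_decomp:
  assumes I: "ideal I R" and f: "f \<in> carrier R"
    and y: "y \<in> I \<cdot> ideal_power R (I <+>\<^bsub>R\<^esub> PIdl f) (Suc n)"
  shows "\<exists>c\<in>ideal_power R I (Suc (Suc n)). \<exists>y'\<in>I \<cdot> ideal_power R (I <+>\<^bsub>R\<^esub> PIdl f) n. y = c \<oplus> f \<otimes> y'"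
proof -
  define J where "J = I <+>\<^bsub>R\<^esub> PIdl f"
  define T where "T n = I \<cdot> ideal_power R J n" for n
  have J: "ideal J R" using adjoin_ideal[OF I f] by (simp add: J_def)
  have IJ: "I \<subseteq> J" using adjoin_ideal[OF I f] by (simp add: J_def)
  have Tid: "ideal (T n) R" for n
    unfolding T_def by (intro ideal_prod_is_ideal I J ideal_power_is_ideal)
  note Iid = ideal_power_is_ideal[OF I]
  have T_Suc: "T (Suc n) = T n \<cdot> J" for n
    unfolding T_def using I J by (simp add: ideal_power_simps ideal_prod_assoc ideal_power_is_ideal)
  have T_0: "T 0 = I" by (simp add: T_def ideal_power_simps ideal_prod_one I)
  have step: "\<exists>c\<in>ideal_power R I (Suc (Suc n)). \<exists>y'\<in>T n. y = c \<oplus> f \<otimes> y'"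
    if base: "\<And>y i. y \<in> T n \<Longrightarrow> i \<in> I \<Longrightarrow>
        \<exists>c\<in>ideal_power R I (Suc (Suc n)). \<exists>y'\<in>T n. y \<otimes> i = c \<oplus> f \<otimes> y'"
      and y: "y \<in> T (Suc n)" for n y
    using y unfolding T_Suc
  proof induction
    case (prod y x)
    obtain i z where i: "i \<in> I" and z: "z \<in> PIdl f" and x: "x = i \<oplus> z"
      using prod(2) unfolding J_def by (rule set_addE)
    obtain r where r: "r \<in> carrier R" "z = r \<otimes> f"
      using z unfolding cgenideal_def by blast
    obtain c y' where c: "c \<in> ideal_power R I (Suc (Suc n))" and y': "y' \<in> T n"
      and eq: "y \<otimes> i = c \<oplus> f \<otimes> y'"
      using base[OF prod(1) i] by blast
    have car: "y \<in> carrier R" "i \<in> carrier R" "c \<in> carrier R" "y' \<in> carrier R"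
      using prod(1) i c y' ideal.Icarr[OF Tid] ideal.Icarr[OF I] ideal.Icarr[OF Iid] by blast+
    have "y \<otimes> x = y \<otimes> i \<oplus> f \<otimes> (r \<otimes> y)"
      unfolding x r(2) using car r(1) f by (simp add: r_distr m_ac)
    also have "\<dots> = c \<oplus> f \<otimes> (y' \<oplus> r \<otimes> y)"
      unfolding eq using car r(1) f by (simp add: r_distr a_ac)
    finally show ?case
      using c y' prod(1) r(1) Tid
      by (meson additive_subgroup.a_closed ideal.I_l_closed ideal.axioms(1))
  next
    case (sum y1 y2)
    obtain c1 z1 c2 z2 where 12: "c1 \<in> ideal_power R I (Suc (Suc n))" "z1 \<in> T n" "y1 = c1 \<oplus> f \<otimes> z1"
      "c2 \<in> ideal_power R I (Suc (Suc n))" "z2 \<in> T n" "y2 = c2 \<oplus> f \<otimes> z2"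
      using sum.IH by blast
    have car: "c1 \<in> carrier R" "c2 \<in> carrier R" "z1 \<in> carrier R" "z2 \<in> carrier R"
      using 12 ideal.Icarr[OF Tid] ideal.Icarr[OF Iid] by blast+
    have "y1 \<oplus> y2 = (c1 \<oplus> c2) \<oplus> f \<otimes> (z1 \<oplus> z2)"
      unfolding 12 using car f by (simp add: r_distr a_ac)
    then show ?case
      using 12 Tid Iid by (meson additive_subgroup.a_closed ideal.axioms(1))
  qed
  have "\<exists>c\<in>ideal_power R I (Suc (Suc n)). \<exists>y'\<in>T n. y = c \<oplus> f \<otimes> y'" if "y \<in> T (Suc n)" for n y
    using that
  proof (induction n arbitrary: y)
    case 0
    have "\<exists>c\<in>ideal_power R I (Suc (Suc 0)). \<exists>y'\<in>T 0. y \<otimes> i = c \<oplus> f \<otimes> y'"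
      if "y \<in> T 0" "i \<in> I" for y i
    proof (intro bexI)
      show "y \<otimes> i \<in> ideal_power R I (Suc (Suc 0))"
        using that unfolding T_0 ideal_power_simps(2)[of I "Suc 0"] ideal_power_1[OF I] by (rule ideal_prod.prod)
      show "\<zero> \<in> T 0" using Tid by (simp add: additive_subgroup.zero_closed ideal.axioms(1))
      show "y \<otimes> i = y \<otimes> i \<oplus> f \<otimes> \<zero>"
        using that f ideal.Icarr[OF Tid] ideal.Icarr[OF I] by simp
    qed
    then show ?case using step[of 0 y] 0 by blast
  next
    case (Suc n)
    have "\<exists>c\<in>ideal_power R I (Suc (Suc (Suc n))). \<exists>y'\<in>T (Suc n). y \<otimes> i = c \<oplus> f \<otimes> y'"
      if y: "y \<in> T (Suc n)" and i: "i \<in> I" for y i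
    proof -
      obtain c y' where c: "c \<in> ideal_power R I (Suc (Suc n))" and y': "y' \<in> T n" and eq: "y = c \<oplus> f \<otimes> y'"
        using Suc.IH[OF y] by blast
      have car: "i \<in> carrier R" "c \<in> carrier R" "y' \<in> carrier R"
        using i c y' ideal.Icarr[OF Tid] ideal.Icarr[OF I] ideal.Icarr[OF Iid] by blast+
      have "y \<otimes> i = c \<otimes> i \<oplus> f \<otimes> (y' \<otimes> i)"
        unfolding eq using car f by (simp add: l_distr m_assoc)
      moreover have "c \<otimes> i \<in> ideal_power R I (Suc (Suc (Suc n)))"
        unfolding ideal_power_simps(2)[of I "Suc (Suc n)"] using c i by (rule ideal_prod.prod)
      moreover have "y' \<otimes> i \<in> T (Suc n)"
        unfolding T_Suc using y' i IJ by (blast intro: ideal_prod.prod)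
      ultimately show ?thesis by blast
    qed
    then show ?case using step[of "Suc n" y] Suc.prems by blast
  qed
  then show ?thesis using y unfolding T_def J_def by blast
qed

text \<open>
  Splitting off \<open>f\<close> repeatedly, as in Horner's scheme, writes an element of \<open>I (I + (f))\<^sup>n\<close> in the form
  of the lower terms of an integral equation of degree \<open>n + 1\<close>.
\<close>

lemma adjoin_power_expansion:
  assumes I: "ideal I R" and f: "f \<in> carrier R"
    and y: "y \<in> I \<cdot> ideal_power R (I <+>\<^bsub>R\<^esub> PIdl f) n"
  shows "\<exists>c. (\<forall>i\<in>{1..Suc n}. c i \<in> ideal_power R I i) \<and>
    y = (\<Oplus>i\<in>{1..Suc n}. c i \<otimes> f [^] (Suc n - i))"
  using y
proof (induction n arbitrary: y)
  case 0
  then have "y \<in> ideal_power R I (Suc 0)" "y \<in> carrier R"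
    unfolding ideal_power_1[OF I] using I by (auto simp: ideal_power_simps(1) ideal_prod_one ideal.Icarr)
  then show ?case by (intro exI[of _ "\<lambda>_. y"]) simp
next
  case (Suc n)
  obtain c' y' where c': "c' \<in> ideal_power R I (Suc (Suc n))"
    and y': "y' \<in> I \<cdot> ideal_power R (I <+>\<^bsub>R\<^esub> PIdl f) n" and eq: "y = c' \<oplus> f \<otimes> y'"
    using adjoin_power_decomp[OF I f Suc.prems] by blast
  obtain c where c: "\<And>i. i \<in> {1..Suc n} \<Longrightarrow> c i \<in> ideal_power R I i"
    and y'_eq: "y' = (\<Oplus>i\<in>{1..Suc n}. c i \<otimes> f [^] (Suc n - i))"
    using Suc.IH[OF y'] by blast
  note Iid = ideal_power_is_ideal[OF I]
  have c_car: "c i \<in> carrier R" if "i \<in> {1..Suc n}" for i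
    using c[OF that] ideal.Icarr[OF Iid] by blast
  have c'_car: "c' \<in> carrier R" using c' ideal.Icarr[OF Iid] by blast
  define d where "d = c(Suc (Suc n) := c')"
  have d_car: "d i \<in> carrier R" if "i \<in> {1..Suc (Suc n)}" for i
    using c_car[of i] c'_car that by (simp add: d_def)
  have ivl: "{1..Suc (Suc n)} = insert (Suc (Suc n)) {1..Suc n}"
    by auto
  have "(\<Oplus>i\<in>{1..Suc (Suc n)}. d i \<otimes> f [^] (Suc (Suc n) - i))
      = d (Suc (Suc n)) \<otimes> f [^] (0::nat) \<oplus> (\<Oplus>i\<in>{1..Suc n}. d i \<otimes> f [^] (Suc (Suc n) - i))"
    unfolding ivl using d_car f by (subst finsum_insert) (simp_all add: Pi_iff)
  also have "(\<Oplus>i\<in>{1..Suc n}. d i \<otimes> f [^] (Suc (Suc n) - i))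
      = (\<Oplus>i\<in>{1..Suc n}. f \<otimes> (c i \<otimes> f [^] (Suc n - i)))"
  proof (rule finsum_cong'[OF refl])
    show "d i \<otimes> f [^] (Suc (Suc n) - i) = f \<otimes> (c i \<otimes> f [^] (Suc n - i))" if "i \<in> {1..Suc n}" for i
      using c_car[OF that] f that by (simp add: d_def Suc_diff_le m_assoc m_comm[of f])
  qed (use c_car f in \<open>simp add: Pi_iff\<close>)
  also have "\<dots> = f \<otimes> y'"
    unfolding y'_eq using c_car f by (intro finsum_rdistr[symmetric]) (simp_all add: Pi_iff)
  finally have "y = (\<Oplus>i\<in>{1..Suc (Suc n)}. d i \<otimes> f [^] (Suc (Suc n) - i))"
    using c'_car by (simp add: eq d_def)
  moreover have "\<forall>i\<in>{1..Suc (Suc n)}. d i \<in> ideal_power R I i"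
    using c c' by (auto simp: d_def le_Suc_eq)
  ultimately show ?case by blast
qed

text \<open>
  The lower terms of an integral equation of degree \<open>n + 1\<close> make up the ideal \<open>I (I + (f))\<^sup>n\<close>.  The integral
  equation thus becomes a membership, which is easier to handle than a family of coefficients.
\<close>

theorem mem_integral_closure_iff:
  assumes I: "ideal I R" and f: "f \<in> carrier R"
  shows "f \<in> integral_closure R I \<longleftrightarrow> (\<exists>n. f [^] Suc n \<in> I \<cdot> ideal_power R (I <+>\<^bsub>R\<^esub> PIdl f) n)"
proof
  let ?X = "I <+>\<^bsub>R\<^esub> PIdl f"
  note X = adjoin_ideal[OF I f]
  have Tid: "ideal (I \<cdot> ideal_power R ?X n) R" for n
    by (intro ideal_prod_is_ideal I X ideal_power_is_ideal)
  {
    assume "f \<in> integral_closure R I"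
    then obtain m c where m: "0 < m" and c: "\<And>i. i \<in> {1..m} \<Longrightarrow> c i \<in> ideal_power R I i"
      and eq: "f [^] m \<oplus> (\<Oplus>i\<in>{1..m}. c i \<otimes> f [^] (m - i)) = \<zero>"
      unfolding integral_closure_def by blast
    obtain n where n: "m = Suc n" using m by (cases m) auto
    have "c i \<otimes> f [^] (m - i) \<in> I \<cdot> ideal_power R ?X n" if i: "i \<in> {1..m}" for i
    proof -
      obtain j where j: "i = Suc j" "n = j + (m - i)" using i n by (cases i) auto
      have "c i \<in> I \<cdot> ideal_power R I j"
        using c[OF i] I by (simp add: j(1) ideal_power_simps ideal_prod_commute ideal_power_is_ideal)
      then have "c i \<in> I \<cdot> ideal_power R ?X j"
        using ideal_prod_mono[OF order_refl ideal_power_mono[OF X(2)]] by blast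
      then have "c i \<otimes> f [^] (m - i) \<in> (I \<cdot> ideal_power R ?X j) \<cdot> ideal_power R ?X (m - i)"
        using pow_mem_ideal_power[OF X(1,3)] by (rule ideal_prod.prod)
      also have "\<dots> = I \<cdot> ideal_power R ?X n"
        using I X(1) j(2) by (simp add: ideal_prod_assoc ideal_power_is_ideal ideal_power_add)
      finally show ?thesis .
    qed
    then have S: "(\<Oplus>i\<in>{1..m}. c i \<otimes> f [^] (m - i)) \<in> I \<cdot> ideal_power R ?X n" (is "?S \<in> _")
      by (intro ideal_finsum_closed Tid) auto
    then have "f [^] m = \<ominus> ?S"
      using minus_equality[OF eq ideal.Icarr[OF Tid S] nat_pow_closed[OF f]] by simp
    also have "\<dots> \<in> I \<cdot> ideal_power R ?X n"
      using S Tid by (meson additive_subgroup.a_inv_closed ideal.axioms(1))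
    finally show "\<exists>n. f [^] Suc n \<in> I \<cdot> ideal_power R ?X n" using n by blast
  next
    assume "\<exists>n. f [^] Suc n \<in> I \<cdot> ideal_power R ?X n"
    then obtain n where n: "f [^] Suc n \<in> I \<cdot> ideal_power R ?X n" by blast
    then have "\<ominus> (f [^] Suc n) \<in> I \<cdot> ideal_power R ?X n"
      using Tid by (meson additive_subgroup.a_inv_closed ideal.axioms(1))
    then obtain c where c: "\<forall>i\<in>{1..Suc n}. c i \<in> ideal_power R I i"
      and eq: "\<ominus> (f [^] Suc n) = (\<Oplus>i\<in>{1..Suc n}. c i \<otimes> f [^] (Suc n - i))"
      using adjoin_power_expansion[OF I f] by blast
    have "f [^] Suc n \<oplus> (\<Oplus>i\<in>{1..Suc n}. c i \<otimes> f [^] (Suc n - i)) = \<zero>"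
      unfolding eq[symmetric] using f by (intro r_neg nat_pow_closed)
    then show "f \<in> integral_closure R I"
      unfolding integral_closure_def using c f by blast
  }
qed

lemma genideal_insert_cases:
  assumes "e \<in> carrier R" "T \<subseteq> carrier R" "x \<in> Idl (insert e T)"
  shows "\<exists>r\<in>carrier R. \<exists>t\<in>Idl T. x = r \<otimes> e \<oplus> t"
proof -
  note ids = cgenideal_ideal[OF assms(1)] genideal_ideal[OF assms(2)]
  have "insert e T \<subseteq> PIdl e <+>\<^bsub>R\<^esub> Idl T"
    using subset_set_add[OF ids] cgenideal_self[OF assms(1)] genideal_self[OF assms(2)] by blast
  then have "x \<in> PIdl e <+>\<^bsub>R\<^esub> Idl T"
    using genideal_minimal[OF add_ideals[OF ids]] assms(3) by blast
  then show ?thesis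
    by (elim set_addE) (auto simp: cgenideal_def)
qed

lemma ideal_prod_genideal_insert_cases:
  assumes N: "ideal N R" and e: "e \<in> carrier R" and T: "T \<subseteq> carrier R"
    and x: "x \<in> N \<cdot> (Idl (insert e T))"
  shows "\<exists>\<nu>\<in>N. \<exists>z\<in>N \<cdot> (Idl T). x = \<nu> \<otimes> e \<oplus> z"
  using x
proof induction
  case (prod n j)
  obtain r t where r: "r \<in> carrier R" and t: "t \<in> Idl T" and j: "j = r \<otimes> e \<oplus> t"
    using genideal_insert_cases[OF e T prod(2)] by blast
  have car: "n \<in> carrier R" "t \<in> carrier R"
    using prod(1) t ideal.Icarr[OF N] ideal.Icarr[OF genideal_ideal[OF T]] by blast+
  have "n \<otimes> j = (n \<otimes> r) \<otimes> e \<oplus> n \<otimes> t"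
    unfolding j using car r e by (simp add: r_distr m_assoc)
  then show ?case
    using ideal.I_r_closed[OF N prod(1) r] ideal_prod.prod[OF prod(1) t] by blast
next
  case (sum x1 x2)
  obtain n1 z1 n2 z2 where 1: "n1 \<in> N" "z1 \<in> N \<cdot> (Idl T)" "x1 = n1 \<otimes> e \<oplus> z1"
    and 2: "n2 \<in> N" "z2 \<in> N \<cdot> (Idl T)" "x2 = n2 \<otimes> e \<oplus> z2"
    using sum.IH by blast
  have NT: "ideal (N \<cdot> (Idl T)) R" by (intro ideal_prod_is_ideal N genideal_ideal T)
  have car: "n1 \<in> carrier R" "n2 \<in> carrier R" "z1 \<in> carrier R" "z2 \<in> carrier R"
    using 1 2 ideal.Icarr[OF N] ideal.Icarr[OF NT] by blast+
  have "x1 \<oplus> x2 = (n1 \<oplus> n2) \<otimes> e \<oplus> (z1 \<oplus> z2)"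
    unfolding 1(3) 2(3) using car e by (simp add: l_distr a_ac)
  then show ?case
    using additive_subgroup.a_closed[OF ideal.axioms(1)[OF N] 1(1) 2(1)] ideal_prod.sum[OF 1(2) 2(2)]
    by blast
qed

lemma mult_ideal_prod_mem:
  assumes "ideal N R" "ideal E R" "a \<in> carrier R" "\<And>x. x \<in> N \<Longrightarrow> a \<otimes> x \<in> N'" "w \<in> N \<cdot> E"
  shows "a \<otimes> w \<in> N' \<cdot> E"
  using assms(5)
proof induction
  case (prod n j)
  then have "a \<otimes> (n \<otimes> j) = (a \<otimes> n) \<otimes> j"
    using assms(1-3) by (simp add: m_assoc ideal.Icarr)
  then show ?case using ideal_prod.prod[OF assms(4)[OF prod(1)] prod(2), of R] by simp
next
  case (sum x y)
  have "x \<in> carrier R" "y \<in> carrier R"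
    using sum(1,2) ideal_prod_in_carrier[OF assms(1,2)] by blast+
  then show ?case using ideal_prod.sum[OF sum.IH] assms(3) by (simp add: r_distr)
qed

lemma annihilator_ideal:
  assumes "d \<in> carrier R"
  shows "ideal {x \<in> carrier R. d \<otimes> x = \<zero>} R"
  by (rule idealI_closed) (use assms in \<open>auto simp: r_distr m_lcomm[of d]\<close>)

text \<open>
  The Cayley-Hamilton theorem without determinants.  Think of \<open>N s\<close> as the lower terms of monic
  polynomials of degree \<open>s\<close> in \<open>h\<close>, so that the conclusion gives a monic polynomial in \<open>h\<close> that kills all of
  \<open>S\<close>.  The relations are solved by elimination: the relation of a generator \<open>e\<close> reads \<open>d e = y\<close> with
  \<open>d\<close> monic and \<open>y\<close> a combination of the other generators, and multiplying the other relations by \<open>d\<close> removes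
  \<open>e\<close> from them, at the price of doubling their degree.
\<close>

lemma monic_annihilator:
  assumes N: "\<And>s. ideal (N s) R"
    and NN: "\<And>s t x y. x \<in> N s \<Longrightarrow> y \<in> N t \<Longrightarrow> x \<otimes> y \<in> N (s + t)"
    and hN: "\<And>s t x. x \<in> N t \<Longrightarrow> h [^] s \<otimes> x \<in> N (s + t)"
    and h: "h \<in> carrier R" and S: "finite S" "S \<subseteq> carrier R" and s: "0 < s"
    and rel: "\<And>x. x \<in> S \<Longrightarrow> h [^] (s::nat) \<otimes> x \<in> N s \<cdot> (Idl S)"
  shows "\<exists>t>0. \<exists>\<nu>\<in>N t. \<forall>x\<in>S. (h [^] t \<ominus> \<nu>) \<otimes> x = \<zero>"
  using S s rel
proof (induction S arbitrary: s rule: finite_induct)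
  case empty
  then show ?case
    using additive_subgroup.zero_closed[OF ideal.axioms(1)[OF N]] by (intro exI[of _ 1]) auto
next
  case (insert e T)
  have e: "e \<in> carrier R" and T: "T \<subseteq> carrier R" using insert.prems(1) by auto
  note idT = genideal_ideal[OF T]
  note Nprod = ideal_prod_is_ideal[OF N idT]
  have Ncar: "x \<in> carrier R" if "x \<in> N t" for x t using that N ideal.Icarr by metis
  have Pcar: "x \<in> carrier R" if "x \<in> N t \<cdot> (Idl T)" for x t using that Nprod ideal.Icarr by metis
  have hs: "h [^] i \<in> carrier R" for i :: nat using h by simp
  obtain \<nu> y where \<nu>: "\<nu> \<in> N s" and y: "y \<in> N s \<cdot> (Idl T)" and he: "h [^] s \<otimes> e = \<nu> \<otimes> e \<oplus> y"
    using ideal_prod_genideal_insert_cases[OF N e T insert.prems(3)] by blast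
  note \<nu>c = Ncar[OF \<nu>] and yc = Pcar[OF y]
  define d where "d = h [^] s \<ominus> \<nu>"
  have d: "d \<in> carrier R" using hs \<nu>c by (simp add: d_def)
  have de: "d \<otimes> e = y"
  proof -
    have "d \<otimes> e = h [^] s \<otimes> e \<ominus> \<nu> \<otimes> e"
      unfolding d_def using hs[of s] \<nu>c e by (simp add: minus_eq l_distr l_minus)
    then show ?thesis unfolding he using \<nu>c e yc by (simp add: minus_eq a_ac r_neg1 r_neg2 r_neg)
  qed
  have step: "h [^] (s + s) \<otimes> x \<in> N (s + s) \<cdot> (Idl T)" if x: "x \<in> T" for x
  proof -
    have xc: "x \<in> carrier R" using x T by blast
    obtain \<mu> z where \<mu>: "\<mu> \<in> N s" and z: "z \<in> N s \<cdot> (Idl T)" and hx: "h [^] s \<otimes> x = \<mu> \<otimes> e \<oplus> z"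
      using ideal_prod_genideal_insert_cases[OF N e T insert.prems(3)] x by blast
    note \<mu>c = Ncar[OF \<mu>] and zc = Pcar[OF z]
    have dsum: "h [^] s = d \<oplus> \<nu>"
      unfolding d_def using hs[of s] \<nu>c by (simp add: minus_eq a_assoc l_neg)
    have "h [^] (s + s) \<otimes> x = (d \<oplus> \<nu>) \<otimes> (h [^] s \<otimes> x)"
      using hs[of s] h xc by (simp add: m_assoc flip: dsum nat_pow_mult)
    also have "\<dots> = d \<otimes> (\<mu> \<otimes> e \<oplus> z) \<oplus> \<nu> \<otimes> (h [^] s \<otimes> x)"
      using d \<nu>c hs[of s] xc by (simp add: l_distr flip: hx)
    also have "\<dots> = \<mu> \<otimes> y \<oplus> d \<otimes> z \<oplus> (h [^] s \<otimes> \<nu>) \<otimes> x"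
      using d \<nu>c \<mu>c e zc hs[of s] xc by (simp add: r_distr m_ac flip: de)
    finally have eq: "h [^] (s + s) \<otimes> x = \<mu> \<otimes> y \<oplus> d \<otimes> z \<oplus> (h [^] s \<otimes> \<nu>) \<otimes> x" .
    have "\<mu> \<otimes> y \<in> N (s + s) \<cdot> (Idl T)"
      by (rule mult_ideal_prod_mem[OF N idT \<mu>c NN[OF \<mu>] y])
    moreover have "d \<otimes> z \<in> N (s + s) \<cdot> (Idl T)"
    proof (rule mult_ideal_prod_mem[OF N idT d _ z])
      fix n assume n: "n \<in> N s"
      have "d \<otimes> n = h [^] s \<otimes> n \<ominus> \<nu> \<otimes> n"
        unfolding d_def using hs[of s] \<nu>c Ncar[OF n] by (simp add: minus_eq l_distr l_minus)
      then show "d \<otimes> n \<in> N (s + s)"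
        using ideal_a_minus_closed[OF N hN[OF n] NN[OF \<nu> n]] by simp
    qed
    moreover have "(h [^] s \<otimes> \<nu>) \<otimes> x \<in> N (s + s) \<cdot> (Idl T)"
      using hN[OF \<nu>] genideal_self[OF T] x by (blast intro: ideal_prod.prod)
    ultimately show ?thesis unfolding eq by (intro ideal_prod.sum)
  qed
  obtain t \<kappa> where t: "t > 0" and \<kappa>: "\<kappa> \<in> N t" and kill: "\<And>x. x \<in> T \<Longrightarrow> (h [^] t \<ominus> \<kappa>) \<otimes> x = \<zero>"
    using insert.IH[OF T _ step] insert.prems(2) by auto
  note \<kappa>c = Ncar[OF \<kappa>]
  define d' where "d' = h [^] t \<ominus> \<kappa>"
  have d': "d' \<in> carrier R" using hs \<kappa>c by (simp add: d'_def)
  have "Idl T \<subseteq> {x \<in> carrier R. d' \<otimes> x = \<zero>}"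
    using kill T by (intro genideal_minimal annihilator_ideal d') (auto simp: d'_def)
  moreover have "y \<in> Idl T" using y ideal_prod_inter[OF N idT] by blast
  ultimately have d'y: "d' \<otimes> y = \<zero>" by blast
  define \<rho> where "\<rho> = (h [^] t \<otimes> \<nu> \<oplus> h [^] s \<otimes> \<kappa>) \<ominus> \<kappa> \<otimes> \<nu>"
  have "h [^] s \<otimes> \<kappa> \<in> N (t + s)" using hN[OF \<kappa>, of s] by (simp add: add.commute)
  then have \<rho>: "\<rho> \<in> N (t + s)"
    unfolding \<rho>_def using hN[OF \<nu>, of t] NN[OF \<kappa> \<nu>]
    by (intro ideal_a_minus_closed[OF N] additive_subgroup.a_closed[OF ideal.axioms(1)[OF N]])
  have dd: "h [^] (t + s) \<ominus> \<rho> = d' \<otimes> d"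
    unfolding d_def d'_def \<rho>_def nat_pow_mult[OF h, symmetric]
    using hs[of s] hs[of t] \<nu>c \<kappa>c by algebra
  have "(h [^] (t + s) \<ominus> \<rho>) \<otimes> x = \<zero>" if "x \<in> insert e T" for x
  proof (cases "x = e")
    case True
    then show ?thesis unfolding dd using d d' e de d'y by (simp add: m_assoc)
  next
    case False
    then have "x \<in> T" "x \<in> carrier R" using that T by auto
    then show ?thesis unfolding dd using d d' kill[of x]
      by (simp add: m_comm[of d' d] m_assoc flip: d'_def)
  qed
  then show ?case using \<rho> t by (intro exI[of _ "t + s"]) auto
qed

text \<open>
  The monic polynomial in \<open>h\<close> that kills the generators of \<open>E\<close> kills the power of \<open>h\<close> in \<open>E\<close> as well, and
  this is an integral equation.
\<close>

lemma integral_closure_criterion: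
  assumes "noetherian_ring R" and I: "ideal I R" and E: "ideal E R" and h: "h \<in> carrier R"
    and hE: "\<And>x. x \<in> E \<Longrightarrow> h \<otimes> x \<in> I \<cdot> E" and M: "h [^] (M::nat) \<in> E"
  shows "h \<in> integral_closure R I"
proof -
  define J where "J = I <+>\<^bsub>R\<^esub> PIdl h"
  note J = adjoin_ideal[OF I h, folded J_def]
  note Jn = ideal_power_is_ideal[OF J(1)]
  \<comment> \<open>By \<open>mem_integral_closure_iff\<close> these are the lower terms in degree \<open>s\<close>.  The truncated difference makes
    \<open>N 0\<close> equal to \<open>N 1\<close>, which keeps the rules for products valid in degree \<open>0\<close>.\<close>
  define N where "N s = I \<cdot> ideal_power R J (s - 1)" for s
  have N: "ideal (N s) R" for s unfolding N_def by (intro ideal_prod_is_ideal I Jn)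
  have mult: "x \<otimes> y \<in> I \<cdot> ideal_power R J k"
    if "x \<in> I \<cdot> ideal_power R J a" "y \<in> ideal_power R J b" "k \<le> a + b" for x y a b k
  proof -
    have "x \<otimes> y \<in> (I \<cdot> ideal_power R J a) \<cdot> ideal_power R J b"
      using that by (intro ideal_prod.prod)
    also have "\<dots> = I \<cdot> ideal_power R J (a + b)"
      using I J(1) Jn by (simp add: ideal_prod_assoc ideal_power_add)
    also have "\<dots> \<subseteq> I \<cdot> ideal_power R J k"
      by (intro ideal_prod_mono order_refl ideal_power_antimono J that(3))
    finally show ?thesis .
  qed
  have NN: "x \<otimes> y \<in> N (s + t)" if "x \<in> N s" "y \<in> N t" for x y s t
  proof -
    have "N t \<subseteq> J \<cdot> ideal_power R J (t - 1)"
      unfolding N_def by (intro ideal_prod_mono J order_refl)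
    also have "\<dots> = ideal_power R J (Suc (t - 1))"
      using J Jn by (simp add: ideal_power_simps ideal_prod_commute)
    finally show ?thesis
      using that unfolding N_def[of s] N_def[of "s + t"] by (intro mult[of x "s - 1" y "Suc (t - 1)"]) auto
  qed
  have hN: "h [^] s \<otimes> x \<in> N (s + t)" if "x \<in> N t" for x s t
  proof -
    have "x \<otimes> h [^] s \<in> N (s + t)"
      using that unfolding N_def by (intro mult[OF _ pow_mem_ideal_power[OF J(1,3)]]) auto
    then show ?thesis using h ideal.Icarr[OF N that] by (simp add: m_comm)
  qed
  obtain S where S: "S \<subseteq> carrier R" "finite S" "E = Idl S"
    using noetherian_ring.finetely_gen[OF assms(1) E] by blast
  have "h [^] (1::nat) \<otimes> x \<in> N 1 \<cdot> (Idl S)" if "x \<in> S" for x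
    using hE[of x] that genideal_self[OF S(1)] h I
    by (auto simp: N_def ideal_power_simps ideal_prod_one S(3))
  then obtain t \<nu> where t: "t > 0" and \<nu>: "\<nu> \<in> N t" and kill: "\<And>x. x \<in> S \<Longrightarrow> (h [^] t \<ominus> \<nu>) \<otimes> x = \<zero>"
    using monic_annihilator[of N h S 1, OF N NN hN h S(2,1)] by auto
  have \<nu>c: "\<nu> \<in> carrier R" using \<nu> N ideal.Icarr by metis
  have "E \<subseteq> {x \<in> carrier R. (h [^] t \<ominus> \<nu>) \<otimes> x = \<zero>}"
    unfolding S(3) using kill S(1) h \<nu>c by (intro genideal_minimal annihilator_ideal) auto
  then have "(h [^] t \<ominus> \<nu>) \<otimes> h [^] M = \<zero>" using M by blast
  then have "h [^] t \<otimes> h [^] M = \<nu> \<otimes> h [^] M"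
    using h \<nu>c by (simp add: minus_eq l_distr l_minus) (metis m_closed minus_equality minus_minus nat_pow_closed a_inv_closed)
  also have "\<dots> = h [^] M \<otimes> \<nu>" using h \<nu>c by (simp add: m_comm)
  also have "\<dots> \<in> N (M + t)" using \<nu> by (rule hN)
  finally have "h [^] Suc (M + t - 1) \<in> I \<cdot> ideal_power R J (M + t - 1)"
    using h t by (simp add: nat_pow_mult N_def add.commute)
  then show ?thesis using mem_integral_closure_iff[OF I h] by (auto simp: J_def)
qed

text \<open>
  Every term in the expansion of \<open>(I + (f))\<^sup>n\<^sup>+\<^sup>1\<close> except for the multiples of \<open>f\<^sup>n\<^sup>+\<^sup>1\<close> has a factor in \<open>I\<close>.  For
  integral \<open>f\<close> this yields \<open>(I + (f))\<^sup>n\<^sup>+\<^sup>1 = I (I + (f))\<^sup>n\<close> for some \<open>n\<close>.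
\<close>

lemma adjoin_power_reduction:
  assumes I: "ideal I R" and f: "f \<in> carrier R"
    and z: "z \<in> ideal_power R (I <+>\<^bsub>R\<^esub> PIdl f) (Suc n)"
  shows "\<exists>i\<in>I \<cdot> ideal_power R (I <+>\<^bsub>R\<^esub> PIdl f) n. \<exists>r\<in>carrier R. z = i \<oplus> r \<otimes> f [^] Suc n"
  using z
proof (induction n arbitrary: z)
  case 0
  then have "z \<in> I <+>\<^bsub>R\<^esub> PIdl f"
    using ideal_power_1[OF adjoin_ideal(1)[OF I f]] by simp
  then obtain i y where "i \<in> I" "y \<in> PIdl f" "z = i \<oplus> y" by (rule set_addE)
  then show ?case using f I by (auto simp: cgenideal_def ideal_power_simps(1) ideal_prod_one)
next
  case (Suc n)
  define J where "J = I <+>\<^bsub>R\<^esub> PIdl f"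
  note J = adjoin_ideal[OF I f, folded J_def]
  note Jn = ideal_power_is_ideal[OF J(1)]
  note IJ = ideal_prod_is_ideal[OF I Jn]
  have "z \<in> ideal_power R J (Suc n) \<cdot> J"
    using Suc.prems ideal_power_simps(2)[of _ "Suc n"] by (simp add: J_def)
  then have "\<exists>i\<in>I \<cdot> ideal_power R J (Suc n). \<exists>r\<in>carrier R. z = i \<oplus> r \<otimes> f [^] Suc (Suc n)"
  proof induction
    case (prod z x)
    obtain i' r where i': "i' \<in> I \<cdot> ideal_power R J n" and r: "r \<in> carrier R"
      and zeq: "z = i' \<oplus> r \<otimes> f [^] Suc n"
      using Suc.IH[of z] prod(1) by (auto simp: J_def)
    obtain i y where i: "i \<in> I" and "y \<in> PIdl f" and x: "x = i \<oplus> y"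
      using prod(2) unfolding J_def by (rule set_addE)
    then obtain s where s: "s \<in> carrier R" and y: "y = s \<otimes> f" by (auto simp: cgenideal_def)
    have car: "i \<in> carrier R" "i' \<in> carrier R" "z \<in> carrier R"
      using i i' prod(1) ideal.Icarr[OF I] ideal.Icarr[OF IJ] ideal.Icarr[OF Jn] by blast+
    have "z \<otimes> x = i \<otimes> z \<oplus> z \<otimes> (s \<otimes> f)"
      unfolding x y using car s f by (simp add: r_distr m_comm)
    also have "z \<otimes> (s \<otimes> f) = i' \<otimes> (s \<otimes> f) \<oplus> (r \<otimes> s) \<otimes> f [^] Suc (Suc n)"
      unfolding zeq using car s r f by (simp add: l_distr r_distr m_ac)
    finally have "z \<otimes> x = (i \<otimes> z \<oplus> i' \<otimes> (s \<otimes> f)) \<oplus> (r \<otimes> s) \<otimes> f [^] Suc (Suc n)"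
      using car s r f by (simp add: a_assoc)
    moreover have "i \<otimes> z \<in> I \<cdot> ideal_power R J (Suc n)"
      using i prod(1) by (rule ideal_prod.prod)
    moreover have "i' \<otimes> (s \<otimes> f) \<in> I \<cdot> ideal_power R J (Suc n)"
    proof -
      have "i' \<otimes> (s \<otimes> f) \<in> (I \<cdot> ideal_power R J n) \<cdot> J"
        using i' ideal.I_l_closed[OF J(1,3) s] by (rule ideal_prod.prod)
      then show ?thesis using I J(1) Jn by (simp add: ideal_prod_assoc ideal_power_simps)
    qed
    ultimately show ?case
      using r s ideal_prod.sum by (metis m_closed)
  next
    case (sum z1 z2)
    obtain i1 r1 i2 r2 where 1: "i1 \<in> I \<cdot> ideal_power R J (Suc n)" "r1 \<in> carrier R"
        "z1 = i1 \<oplus> r1 \<otimes> f [^] Suc (Suc n)"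
      and 2: "i2 \<in> I \<cdot> ideal_power R J (Suc n)" "r2 \<in> carrier R" "z2 = i2 \<oplus> r2 \<otimes> f [^] Suc (Suc n)"
      using sum.IH by blast
    have car: "i1 \<in> carrier R" "i2 \<in> carrier R" "f [^] Suc (Suc n) \<in> carrier R"
      using 1(1) 2(1) f ideal.Icarr[OF IJ] by (blast, blast, simp)
    have "z1 \<oplus> z2 = (i1 \<oplus> i2) \<oplus> (r1 \<oplus> r2) \<otimes> f [^] Suc (Suc n)"
      unfolding 1(3) 2(3) using car 1(2) 2(2) by (simp only: l_distr a_ac a_closed m_closed)
    then show ?case
      using ideal_prod.sum[OF 1(1) 2(1)] 1(2) 2(2) by blast
  qed
  then show ?case by (simp only: J_def)
qed

text \<open>
  The converse of the criterion, with \<open>E\<close> a power of \<open>I + (f)\<close>.  That \<open>E\<close> contains a power of \<open>I\<close> as well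
  makes it possible to combine the ideals that belong to two integral elements.
\<close>

lemma integral_closure_reductionE:
  assumes I: "ideal I R" and fI: "f \<in> integral_closure R I"
  obtains E n where "ideal E R" "\<And>x. x \<in> E \<Longrightarrow> f \<otimes> x \<in> I \<cdot> E"
    "f [^] (n::nat) \<in> E" "ideal_power R I n \<subseteq> E"
proof -
  have f: "f \<in> carrier R" using fI by (simp add: integral_closure_def)
  define J where "J = I <+>\<^bsub>R\<^esub> PIdl f"
  note J = adjoin_ideal[OF I f, folded J_def]
  note Jn = ideal_power_is_ideal[OF J(1)]
  note IJ = ideal_prod_is_ideal[OF I Jn]
  obtain n where n: "f [^] Suc n \<in> I \<cdot> ideal_power R J n"
    using mem_integral_closure_iff[OF I f] fI unfolding J_def by blast
  show thesis
  proof
    show "ideal (ideal_power R J n) R" by (rule Jn)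
    show "f [^] n \<in> ideal_power R J n" by (rule pow_mem_ideal_power[OF J(1,3)])
    show "ideal_power R I n \<subseteq> ideal_power R J n" by (rule ideal_power_mono[OF J(2)])
    show "f \<otimes> x \<in> I \<cdot> ideal_power R J n" if x: "x \<in> ideal_power R J n" for x
    proof -
      have "f \<otimes> x = x \<otimes> f" using f ideal.Icarr[OF Jn x] by (rule m_comm)
      also have "\<dots> \<in> ideal_power R J (Suc n)"
        unfolding ideal_power_simps using x J(3) by (rule ideal_prod.prod)
      finally obtain i r where i: "i \<in> I \<cdot> ideal_power R J n" and r: "r \<in> carrier R"
        and eq: "f \<otimes> x = i \<oplus> r \<otimes> f [^] Suc n"
        using adjoin_power_reduction[OF I f, of "f \<otimes> x" n] unfolding J_def by blast
      show ?thesis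
        unfolding eq by (rule ideal_prod.sum[OF i ideal.I_l_closed[OF IJ n r]])
    qed
  qed
qed

text \<open>
  The binomial theorem for memberships in an ideal, where the coefficients do not matter.
\<close>

lemma sum_pow_mem_ideal:
  assumes E: "ideal E R" and fg: "f \<in> carrier R" "g \<in> carrier R"
    and mem: "\<And>i j. i + j = k \<Longrightarrow> f [^] i \<otimes> g [^] j \<in> E"
  shows "(f \<oplus> g) [^] (k::nat) \<in> E"
proof -
  have "(f \<oplus> g) [^] n \<otimes> (f [^] i \<otimes> g [^] j) \<in> E" if "n + i + j = k" for n i j
    using that
  proof (induction n arbitrary: i j)
    case 0
    then show ?case using mem[of i j] fg by simp
  next
    case (Suc n)
    have "(f \<oplus> g) [^] Suc n \<otimes> (f [^] i \<otimes> g [^] j)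
        = (f \<oplus> g) [^] n \<otimes> (f [^] Suc i \<otimes> g [^] j) \<oplus> (f \<oplus> g) [^] n \<otimes> (f [^] i \<otimes> g [^] Suc j)"
    proof -
      have "p \<otimes> (f \<oplus> g) \<otimes> (a \<otimes> b) = p \<otimes> ((a \<otimes> f) \<otimes> b) \<oplus> p \<otimes> (a \<otimes> (b \<otimes> g))"
        if "p \<in> carrier R" "a \<in> carrier R" "b \<in> carrier R" for p a b
        using that fg by algebra
      from this[of "(f \<oplus> g) [^] n" "f [^] i" "g [^] j"] show ?thesis using fg by simp
    qed
    also have "\<dots> \<in> E"
      by (intro additive_subgroup.a_closed[OF ideal.axioms(1)[OF E]] Suc.IH) (use Suc.prems in auto)
    finally show ?case .
  qed
  from this[of k 0 0] show ?thesis using fg by simp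
qed

lemma pow_mult_mem_ideal_prod:
  assumes I: "ideal I R" and E: "ideal E R" and f: "f \<in> carrier R"
    and fE: "\<And>x. x \<in> E \<Longrightarrow> f \<otimes> x \<in> I \<cdot> E" and x: "x \<in> E"
  shows "f [^] n \<otimes> x \<in> ideal_power R I n \<cdot> E"
proof (induction n)
  case 0
  show ?case using ideal_prod.prod[OF one_closed x, of R] ideal.Icarr[OF E x]
    by (simp add: ideal_power_simps)
next
  case (Suc n)
  note In = ideal_power_is_ideal[OF I]
  have "f \<otimes> w \<in> ideal_power R I (Suc n) \<cdot> E" if "w \<in> ideal_power R I n \<cdot> E" for w
  proof -
    have w: "w \<in> E \<cdot> ideal_power R I n" using that ideal_prod_commute[OF E In] by simp
    have "f \<otimes> w \<in> (I \<cdot> E) \<cdot> ideal_power R I n"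
      by (rule mult_ideal_prod_mem[OF E In f fE w])
    also have "\<dots> = ideal_power R I (Suc n) \<cdot> E"
      using I E In by (metis ideal_power_simps(2) ideal_prod_assoc ideal_prod_commute)
    finally show ?thesis .
  qed
  from this[OF Suc] show ?case
    using f ideal.Icarr[OF E x] by (simp add: m_ac)
qed

text \<open>
  If \<open>E\<close> and \<open>F\<close> witness that \<open>f\<close> and \<open>g\<close> are integral, then \<open>f\<close> and \<open>g\<close> both send \<open>E F\<close> into \<open>I E F\<close>, and so does
  their sum.  A high power of \<open>f\<close> lies in \<open>I\<^sup>m E\<close> for a large \<open>m\<close>, hence in \<open>E F\<close>, because \<open>F\<close> contains a power
  of \<open>I\<close>.  The same holds for \<open>g\<close> and then for \<open>f + g\<close>.
\<close>

lemma integral_closure_is_ideal: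
  assumes noeth: "noetherian_ring R" and I: "ideal I R"
  shows "ideal (integral_closure R I) R"
proof -
  have mult: "r \<otimes> f \<in> integral_closure R I" if f: "f \<in> integral_closure R I" and r: "r \<in> carrier R" for r f
  proof -
    have fc: "f \<in> carrier R" using f by (simp add: integral_closure_def)
    obtain E n where E: "ideal E R" and fE: "\<And>x. x \<in> E \<Longrightarrow> f \<otimes> x \<in> I \<cdot> E" and n: "f [^] (n::nat) \<in> E"
      using integral_closure_reductionE[OF I f] by metis
    show ?thesis
    proof (rule integral_closure_criterion[OF noeth I E])
      show "r \<otimes> f \<otimes> x \<in> I \<cdot> E" if "x \<in> E" for x
        using ideal.I_l_closed[OF ideal_prod_is_ideal[OF I E] fE[OF that] r] fc r ideal.Icarr[OF E that]
        by (simp add: m_assoc)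
      show "(r \<otimes> f) [^] n \<in> E"
        using ideal.I_l_closed[OF E n] r fc by (simp add: nat_pow_distrib)
    qed (use r fc in simp)
  qed
  have add: "f \<oplus> g \<in> integral_closure R I"
    if f: "f \<in> integral_closure R I" and g: "g \<in> integral_closure R I" for f g
  proof -
    have fc: "f \<in> carrier R" and gc: "g \<in> carrier R" using f g by (simp_all add: integral_closure_def)
    obtain E n where E: "ideal E R" and fE: "\<And>x. x \<in> E \<Longrightarrow> f \<otimes> x \<in> I \<cdot> E"
      and n: "f [^] (n::nat) \<in> E" "ideal_power R I n \<subseteq> E"
      using integral_closure_reductionE[OF I f] by metis
    obtain F m where F: "ideal F R" and gF: "\<And>x. x \<in> F \<Longrightarrow> g \<otimes> x \<in> I \<cdot> F"
      and m: "g [^] (m::nat) \<in> F" "ideal_power R I m \<subseteq> F"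
      using integral_closure_reductionE[OF I g] by metis
    note EF = ideal_prod_is_ideal[OF E F]
    note IEF = ideal_prod_is_ideal[OF I EF]
    have f_pow: "f [^] m \<otimes> f [^] n \<in> E \<cdot> F"
      using pow_mult_mem_ideal_prod[OF I E fc fE n(1), of m] ideal_prod_mono[OF m(2) order_refl, of R E]
        ideal_prod_commute[OF E F] by auto
    have g_pow: "g [^] n \<otimes> g [^] m \<in> E \<cdot> F"
      using pow_mult_mem_ideal_prod[OF I F gc gF m(1), of n] ideal_prod_mono[OF n(2) order_refl, of R F] by auto
    show ?thesis
    proof (rule integral_closure_criterion[OF noeth I EF])
      show "(f \<oplus> g) \<otimes> x \<in> I \<cdot> (E \<cdot> F)" if x: "x \<in> E \<cdot> F" for x
      proof -
        have "f \<otimes> x \<in> (I \<cdot> E) \<cdot> F" by (rule mult_ideal_prod_mem[OF E F fc fE x])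
        then have 1: "f \<otimes> x \<in> I \<cdot> (E \<cdot> F)" using I E F by (simp add: ideal_prod_assoc)
        have x': "x \<in> F \<cdot> E" using x ideal_prod_commute[OF E F] by simp
        have "g \<otimes> x \<in> (I \<cdot> F) \<cdot> E" by (rule mult_ideal_prod_mem[OF F E gc gF x'])
        then have 2: "g \<otimes> x \<in> I \<cdot> (E \<cdot> F)"
          using I E F by (simp add: ideal_prod_assoc ideal_prod_commute[of F E])
        show ?thesis
          using ideal_prod.sum[OF 1 2] fc gc ideal.Icarr[OF EF x] by (simp add: l_distr)
      qed
      \<comment> \<open>One of the two exponents in each binomial term is at least \<open>m + n\<close>.\<close>
      show "(f \<oplus> g) [^] (2 * (m + n)) \<in> E \<cdot> F"
      proof (rule sum_pow_mem_ideal[OF EF fc gc])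
        fix i j assume ij: "i + j = 2 * (m + n)"
        show "f [^] i \<otimes> g [^] j \<in> E \<cdot> F"
        proof (cases "m + n \<le> i")
          case True
          then have "f [^] i = f [^] (i - (m + n)) \<otimes> (f [^] m \<otimes> f [^] n)"
            using fc by (simp add: nat_pow_mult)
          then have "f [^] i \<in> E \<cdot> F" using ideal.I_l_closed[OF EF f_pow] fc by simp
          then show ?thesis using ideal.I_r_closed[OF EF] gc by simp
        next
          case False
          then have "g [^] j = g [^] (j - (m + n)) \<otimes> (g [^] n \<otimes> g [^] m)"
            using gc ij by (simp add: nat_pow_mult)
          then have "g [^] j \<in> E \<cdot> F" using ideal.I_l_closed[OF EF g_pow] gc by simp
          then show ?thesis using ideal.I_l_closed[OF EF] fc by simp
        qed
      qed
    qed (use fc gc in simp)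
  qed
  have car: "integral_closure R I \<subseteq> carrier R" by (auto simp: integral_closure_def)
  have zero: "\<zero> \<in> integral_closure R I"
    using mem_integral_closure_iff[OF I zero_closed] I
    by (auto intro!: exI[of _ 0] simp: ideal_power_simps ideal_prod_one additive_subgroup.zero_closed ideal.axioms(1))
  show ?thesis
    by (rule idealI_closed[OF car zero add mult])
qed

text \<open>
  With \<open>f E \<subseteq> I E\<close> and \<open>g F \<subseteq> J F\<close> the product satisfies \<open>f g (E F) \<subseteq> (I J) (E F)\<close>.
\<close>

lemma integral_closure_prod:
  assumes noeth: "noetherian_ring R" and I: "ideal I R" and J: "ideal J R"
    and f: "f \<in> integral_closure R I" and g: "g \<in> integral_closure R J"
  shows "f \<otimes> g \<in> integral_closure R (I \<cdot> J)"
proof -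
  have fc: "f \<in> carrier R" and gc: "g \<in> carrier R" using f g by (simp_all add: integral_closure_def)
  obtain E n where E: "ideal E R" and fE: "\<And>x. x \<in> E \<Longrightarrow> f \<otimes> x \<in> I \<cdot> E" and n: "f [^] (n::nat) \<in> E"
    using integral_closure_reductionE[OF I f] by metis
  obtain F m where F: "ideal F R" and gF: "\<And>x. x \<in> F \<Longrightarrow> g \<otimes> x \<in> J \<cdot> F" and m: "g [^] (m::nat) \<in> F"
    using integral_closure_reductionE[OF J g] by metis
  note EF = ideal_prod_is_ideal[OF E F]
  show ?thesis
  proof (rule integral_closure_criterion[OF noeth ideal_prod_is_ideal[OF I J] EF])
    show "f \<otimes> g \<otimes> x \<in> (I \<cdot> J) \<cdot> (E \<cdot> F)" if x: "x \<in> E \<cdot> F" for x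
    proof -
      have xc: "x \<in> carrier R" using ideal.Icarr[OF EF x] .
      have x': "x \<in> F \<cdot> E" using x ideal_prod_commute[OF E F] by simp
      have "g \<otimes> x \<in> (J \<cdot> F) \<cdot> E" by (rule mult_ideal_prod_mem[OF F E gc gF x'])
      then have gx: "g \<otimes> x \<in> E \<cdot> (J \<cdot> F)"
        using ideal_prod_commute[OF E ideal_prod_is_ideal[OF J F]] by simp
      have "f \<otimes> (g \<otimes> x) \<in> (I \<cdot> E) \<cdot> (J \<cdot> F)"
        by (rule mult_ideal_prod_mem[OF E ideal_prod_is_ideal[OF J F] fc fE gx])
      also have "\<dots> = (I \<cdot> J) \<cdot> (E \<cdot> F)"
      proof -
        have "(I \<cdot> E) \<cdot> (J \<cdot> F) = I \<cdot> ((E \<cdot> J) \<cdot> F)"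
          using I J E F by (simp add: ideal_prod_assoc ideal_prod_is_ideal)
        also have "E \<cdot> J = J \<cdot> E" by (rule ideal_prod_commute[OF E J])
        finally show ?thesis using I J E F by (simp add: ideal_prod_assoc ideal_prod_is_ideal)
      qed
      finally show ?thesis using fc gc xc by (simp add: m_assoc)
    qed
    have "(f \<otimes> g) [^] (n + m) = (f [^] m \<otimes> g [^] n) \<otimes> (f [^] n \<otimes> g [^] m)"
      using fc gc by (simp add: nat_pow_distrib m_ac flip: nat_pow_mult)
    also have "\<dots> \<in> E \<cdot> F"
      using ideal.I_l_closed[OF EF ideal_prod.prod[OF n m]] fc gc by simp
    finally show "(f \<otimes> g) [^] (n + m) \<in> E \<cdot> F" .
  qed (use fc gc in simp)
qed

lemma integral_closure_mono:
  assumes "I \<subseteq> J"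
  shows "integral_closure R I \<subseteq> integral_closure R J"
  unfolding integral_closure_def using ideal_power_mono[OF assms] by blast

lemma integral_closure_carrier: "integral_closure R (carrier R) = carrier R"
proof -
  have "f \<in> integral_closure R (carrier R)" if "f \<in> carrier R" for f
    using mem_integral_closure_iff[OF oneideal that] that
    by (auto intro!: exI[of _ 0] simp: ideal_power_simps ideal_prod_one oneideal)
  then show ?thesis by (auto simp: integral_closure_def)
qed

lemma integral_closure_pow:
  assumes noeth: "noetherian_ring R" and I: "ideal I R" and f: "f \<in> integral_closure R I"
  shows "f [^] n \<in> integral_closure R (ideal_power R I n)"
proof (induction n)
  case 0
  then show ?case by (simp add: ideal_power_simps integral_closure_carrier)
next
  case (Suc n)
  show ?case
    using integral_closure_prod[OF noeth ideal_power_is_ideal[OF I] I Suc f]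
    by (simp add: ideal_power_simps)
qed

text \<open>
  An integral equation of \<open>x\<^sup>q\<close> over \<open>I\<^sup>q\<close> is an integral equation of \<open>x\<close> over \<open>I\<close>: all its terms have the right
  degree in \<open>x\<close> and \<open>I\<close> together.
\<close>

lemma integral_closure_root:
  assumes I: "ideal I R" and x: "x \<in> carrier R" and q: "0 < q"
    and xq: "x [^] (q::nat) \<in> integral_closure R (ideal_power R I q)"
  shows "x \<in> integral_closure R I"
proof -
  define J where "J = I <+>\<^bsub>R\<^esub> PIdl x"
  note J = adjoin_ideal[OF I x, folded J_def]
  note Jn = ideal_power_is_ideal[OF J(1)] and In = ideal_power_is_ideal[OF I]
  obtain n where n: "(x [^] q) [^] Suc n \<in>
      ideal_power R I q \<cdot> ideal_power R (ideal_power R I q <+>\<^bsub>R\<^esub> PIdl (x [^] q)) n"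
    using xq mem_integral_closure_iff[OF In] x by blast
  have "ideal_power R I q <+>\<^bsub>R\<^esub> PIdl (x [^] q) \<subseteq> ideal_power R J q"
  proof
    fix z assume "z \<in> ideal_power R I q <+>\<^bsub>R\<^esub> PIdl (x [^] q)"
    then obtain i r where "i \<in> ideal_power R I q" "r \<in> carrier R" "z = i \<oplus> r \<otimes> x [^] q"
      by (elim set_addE) (auto simp: cgenideal_def)
    then show "z \<in> ideal_power R J q"
      using ideal_power_mono[OF J(2)] ideal.I_l_closed[OF Jn pow_mem_ideal_power[OF J(1,3)]]
        additive_subgroup.a_closed[OF ideal.axioms(1)[OF Jn]] by blast
  qed
  then have "ideal_power R (ideal_power R I q <+>\<^bsub>R\<^esub> PIdl (x [^] q)) n \<subseteq> ideal_power R J (q * n)"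
    using ideal_power_mono ideal_power_power[OF J(1)] by metis
  then have "(x [^] q) [^] Suc n \<in> ideal_power R I q \<cdot> ideal_power R J (q * n)"
    using n ideal_prod_mono[OF order_refl] by blast
  also have "ideal_power R I q \<cdot> ideal_power R J (q * n)
      = I \<cdot> (ideal_power R I (q - 1) \<cdot> ideal_power R J (q * n))"
  proof -
    obtain q' where q': "q = Suc q'" using q by (cases q) auto
    show ?thesis
      using I In Jn by (simp add: q' ideal_power_simps(2)[of I q'] ideal_prod_commute[of _ I] ideal_prod_assoc)
  qed
  also have "\<dots> \<subseteq> I \<cdot> (ideal_power R J (q - 1) \<cdot> ideal_power R J (q * n))"
    by (intro ideal_prod_mono order_refl ideal_power_mono J)
  also have "\<dots> = I \<cdot> ideal_power R J (q - 1 + q * n)"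
    using J(1) by (simp add: ideal_power_add)
  also have "(x [^] q) [^] Suc n = x [^] Suc (q - 1 + q * n)"
    using x q unfolding nat_pow_pow[OF x] by (intro arg_cong[of _ _ "\<lambda>k. x [^] k"]) simp
  finally show ?thesis using mem_integral_closure_iff[OF I x] unfolding J_def by blast
qed

section \<open>Rational powers\<close>

lemma rational_power_0: "rational_power R I 0 = carrier R"
  by (simp add: rational_power_def)

lemma rational_power_posE:
  assumes "0 < w"
  obtains p q :: nat where "0 < p" "0 < q" "w = of_nat p / of_nat q"
    "rational_power R I w = {f \<in> carrier R. f [^] q \<in> integral_closure R (ideal_power R I p)}"
proof -
  obtain a b where ab: "quotient_of w = (a, b)" by fastforce
  have b: "0 < b" using ab by (rule quotient_of_denom_pos)
  have w: "w = of_int a / of_int b" using ab by (rule quotient_of_div)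
  have a: "0 < a" using assms b unfolding w by (simp add: zero_less_divide_iff)
  show thesis
  proof (rule that)
    show "0 < nat a" "0 < nat b" using a b by simp_all
    show "w = of_nat (nat a) / of_nat (nat b)" using a b by (simp add: w)
    show "rational_power R I w
        = {f \<in> carrier R. f [^] nat b \<in> integral_closure R (ideal_power R I (nat a))}"
      unfolding rational_power_def ab using assms by simp
  qed
qed

text \<open>
  Closure under sums is the point.  If \<open>f\<^sup>q\<close> and \<open>g\<^sup>q\<close> are integral over \<open>I\<^sup>p\<close>, then for \<open>i + j = q\<close> the \<open>q\<close>-th
  power of \<open>f\<^sup>i g\<^sup>j\<close> is integral over \<open>(I\<^sup>p)\<^sup>q\<close>, so \<open>f\<^sup>i g\<^sup>j\<close> itself is integral over \<open>I\<^sup>p\<close>.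
\<close>

lemma rational_power_is_ideal:
  assumes noeth: "noetherian_ring R" and I: "ideal I R" and w: "0 \<le> w"
  shows "ideal (rational_power R I w) R"
proof (cases "w = 0")
  case True
  then show ?thesis by (simp add: rational_power_0 oneideal)
next
  case False
  obtain p q :: nat where q: "0 < q"
    and A: "rational_power R I w = {f \<in> carrier R. f [^] q \<in> integral_closure R (ideal_power R I p)}"
    using rational_power_posE[of w I] order.not_eq_order_implies_strict[of 0 w] w False by metis
  note Ip = ideal_power_is_ideal[OF I, of p]
  note cl = integral_closure_is_ideal[OF noeth Ip]
  let ?A = "{f \<in> carrier R. f [^] q \<in> integral_closure R (ideal_power R I p)}"
  have mult: "r \<otimes> f \<in> ?A" if "f \<in> ?A" "r \<in> carrier R" for r f
    using that ideal.I_l_closed[OF cl, of "f [^] q" "r [^] q"] by (simp add: nat_pow_distrib)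
  have add: "f \<oplus> g \<in> ?A" if f: "f \<in> ?A" and g: "g \<in> ?A" for f g
  proof -
    have fc: "f \<in> carrier R" and gc: "g \<in> carrier R" using f g by auto
    have "(f \<oplus> g) [^] q \<in> integral_closure R (ideal_power R I p)"
    proof (rule sum_pow_mem_ideal[OF cl fc gc])
      fix i j assume ij: "i + j = q"
      show "f [^] i \<otimes> g [^] j \<in> integral_closure R (ideal_power R I p)"
      proof (rule integral_closure_root[OF Ip _ q])
        have "(f [^] q) [^] i \<otimes> (g [^] q) [^] j
            \<in> integral_closure R (ideal_power R (ideal_power R I p) i \<cdot> ideal_power R (ideal_power R I p) j)"
          using f g by (intro integral_closure_prod[OF noeth ideal_power_is_ideal[OF Ip] ideal_power_is_ideal[OF Ip]]
            integral_closure_pow[OF noeth Ip]) blast+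
        also have "ideal_power R (ideal_power R I p) i \<cdot> ideal_power R (ideal_power R I p) j
            = ideal_power R (ideal_power R I p) q"
          using ideal_power_add[OF Ip] ij by simp
        also have "(f [^] q) [^] i \<otimes> (g [^] q) [^] j = (f [^] i \<otimes> g [^] j) [^] q"
          using fc gc by (simp add: nat_pow_distrib nat_pow_pow mult.commute)
        finally show "(f [^] i \<otimes> g [^] j) [^] q
            \<in> integral_closure R (ideal_power R (ideal_power R I p) q)" .
      qed (use fc gc in simp)
    qed
    then show ?thesis using fc gc by simp
  qed
  have zero: "\<zero> \<in> ?A"
    using q additive_subgroup.zero_closed[OF ideal.axioms(1)[OF cl]] by (simp add: nat_pow_zero)
  show ?thesis unfolding A
    by (rule idealI_closed[OF _ zero add mult]) blast
qed

text \<open>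
  Two exponents are compared over a common denominator, by taking powers and roots of integral elements.
\<close>

lemma rational_power_antimono:
  assumes noeth: "noetherian_ring R" and I: "ideal I R" and v: "0 \<le> v" and vw: "v \<le> w"
  shows "rational_power R I w \<subseteq> rational_power R I v"
proof (cases "v = 0")
  case True
  then show ?thesis
    using ideal.Icarr[OF rational_power_is_ideal[OF noeth I]] v vw by (auto simp: rational_power_0)
next
  case False
  then have v0: "0 < v" and w0: "0 < w" using v vw by auto
  obtain p q :: nat where "0 < p" and q: "0 < q" and v_eq: "v = of_nat p / of_nat q"
    and V: "rational_power R I v = {f \<in> carrier R. f [^] q \<in> integral_closure R (ideal_power R I p)}"
    by (rule rational_power_posE[OF v0])
  obtain p' q' :: nat where "0 < p'" and q': "0 < q'" and w_eq: "w = of_nat p' / of_nat q'"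
    and W: "rational_power R I w = {f \<in> carrier R. f [^] q' \<in> integral_closure R (ideal_power R I p')}"
    by (rule rational_power_posE[OF w0])
  have "(of_nat (p * q') :: rat) \<le> of_nat (p' * q)"
    using vw q q' unfolding v_eq w_eq by (simp add: divide_simps mult.commute)
  then have le: "p * q' \<le> p' * q" by (simp only: of_nat_le_iff)
  show ?thesis
  proof
    fix f assume "f \<in> rational_power R I w"
    then have fc: "f \<in> carrier R" and f: "f [^] q' \<in> integral_closure R (ideal_power R I p')"
      unfolding W by auto
    have "(f [^] q') [^] q \<in> integral_closure R (ideal_power R (ideal_power R I p') q)"
      using f by (rule integral_closure_pow[OF noeth ideal_power_is_ideal[OF I]])
    also have "\<dots> \<subseteq> integral_closure R (ideal_power R (ideal_power R I p) q')"
      unfolding ideal_power_power[OF I] by (intro integral_closure_mono ideal_power_antimono I le)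
    also have "(f [^] q') [^] q = (f [^] q) [^] q'"
      using fc by (simp add: nat_pow_pow mult.commute)
    finally have "f [^] q \<in> integral_closure R (ideal_power R I p)"
      using fc by (intro integral_closure_root[OF ideal_power_is_ideal[OF I] _ q']) simp_all
    then show "f \<in> rational_power R I v" unfolding V using fc by simp
  qed
qed

end

section \<open>Linear functionals\<close>

definition linear_functional :: "('k, 'l) ring_scheme \<Rightarrow> ('k, 'b, 'n) module_scheme \<Rightarrow> ('b \<Rightarrow> 'k) \<Rightarrow> bool"
  where "linear_functional k M f \<longleftrightarrow> f \<in> carrier M \<rightarrow> carrier k \<and>
    (\<forall>x\<in>carrier M. \<forall>y\<in>carrier M. f (x \<oplus>\<^bsub>M\<^esub> y) = f x \<oplus>\<^bsub>k\<^esub> f y) \<and>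
    (\<forall>c\<in>carrier k. \<forall>x\<in>carrier M. f (c \<odot>\<^bsub>M\<^esub> x) = c \<otimes>\<^bsub>k\<^esub> f x)"

lemma linear_functionalD:
  assumes "linear_functional k M f"
  shows "x \<in> carrier M \<Longrightarrow> f x \<in> carrier k"
    and "x \<in> carrier M \<Longrightarrow> y \<in> carrier M \<Longrightarrow> f (x \<oplus>\<^bsub>M\<^esub> y) = f x \<oplus>\<^bsub>k\<^esub> f y"
    and "c \<in> carrier k \<Longrightarrow> x \<in> carrier M \<Longrightarrow> f (c \<odot>\<^bsub>M\<^esub> x) = c \<otimes>\<^bsub>k\<^esub> f x"
  using assms by (auto simp: linear_functional_def)

context module
begin

lemma submoduleI_closed:
  assumes "H \<subseteq> carrier M" "\<zero>\<^bsub>M\<^esub> \<in> H" "\<And>x y. x \<in> H \<Longrightarrow> y \<in> H \<Longrightarrow> x \<oplus>\<^bsub>M\<^esub> y \<in> H"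
    and smult: "\<And>c x. c \<in> carrier R \<Longrightarrow> x \<in> H \<Longrightarrow> c \<odot>\<^bsub>M\<^esub> x \<in> H"
  shows "submodule H R M"
proof (rule submoduleI)
  show "\<ominus>\<^bsub>M\<^esub> a \<in> H" if "a \<in> H" for a
    using smult[OF _ that, of "\<ominus> \<one>"] subsetD[OF assms(1) that] by (simp add: smult_l_minus)
qed (use assms in auto)

lemma submodule_zero_closed: "submodule H R M \<Longrightarrow> \<zero>\<^bsub>M\<^esub> \<in> H"
  using subgroup.one_closed[OF submodule.axioms(1)] by force

lemma submodule_adjoin:
  assumes W: "submodule W R M" and b: "b \<in> carrier M"
  shows "submodule {t \<odot>\<^bsub>M\<^esub> b \<oplus>\<^bsub>M\<^esub> s | t s. t \<in> carrier R \<and> s \<in> W} R M" (is "submodule ?V R M")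
    and "W \<subseteq> {t \<odot>\<^bsub>M\<^esub> b \<oplus>\<^bsub>M\<^esub> s | t s. t \<in> carrier R \<and> s \<in> W}"
    and "b \<in> {t \<odot>\<^bsub>M\<^esub> b \<oplus>\<^bsub>M\<^esub> s | t s. t \<in> carrier R \<and> s \<in> W}"
proof -
  note E = submoduleE[OF W]
  have W0: "\<zero>\<^bsub>M\<^esub> \<in> W" by (rule submodule_zero_closed[OF W])
  have memI: "t \<odot>\<^bsub>M\<^esub> b \<oplus>\<^bsub>M\<^esub> s \<in> ?V" if "t \<in> carrier R" "s \<in> W" for t s
    using that by blast
  show sub: "W \<subseteq> ?V"
  proof
    fix x assume x: "x \<in> W"
    have "\<zero> \<odot>\<^bsub>M\<^esub> b \<oplus>\<^bsub>M\<^esub> x = x" using E(1) x b by auto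
    then show "x \<in> ?V" using memI[OF R.zero_closed x] by simp
  qed
  show "b \<in> ?V" using memI[OF R.one_closed W0] b by simp
  show "submodule ?V R M"
  proof (rule submoduleI_closed)
    show "?V \<subseteq> carrier M" using E(1) b by auto
    show "\<zero>\<^bsub>M\<^esub> \<in> ?V" using sub W0 by blast
    show "x \<oplus>\<^bsub>M\<^esub> y \<in> ?V" if xy: "x \<in> ?V" "y \<in> ?V" for x y
    proof -
      obtain t s t' s' where 1: "t \<in> carrier R" "s \<in> W" "x = t \<odot>\<^bsub>M\<^esub> b \<oplus>\<^bsub>M\<^esub> s"
        and 2: "t' \<in> carrier R" "s' \<in> W" "y = t' \<odot>\<^bsub>M\<^esub> b \<oplus>\<^bsub>M\<^esub> s'"
        using xy by blast
      have "s \<in> carrier M" "s' \<in> carrier M" using E(1) 1(2) 2(2) by auto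
      then have "x \<oplus>\<^bsub>M\<^esub> y = (t \<oplus> t') \<odot>\<^bsub>M\<^esub> b \<oplus>\<^bsub>M\<^esub> (s \<oplus>\<^bsub>M\<^esub> s')"
        unfolding 1(3) 2(3) using b 1(1) 2(1) by (simp add: smult_l_distr M.a_ac)
      then show ?thesis using memI[OF R.a_closed[OF 1(1) 2(1)] E(5)[OF 1(2) 2(2)]] by simp
    qed
    show "c \<odot>\<^bsub>M\<^esub> x \<in> ?V" if c: "c \<in> carrier R" and x: "x \<in> ?V" for c x
    proof -
      obtain t s where 1: "t \<in> carrier R" "s \<in> W" "x = t \<odot>\<^bsub>M\<^esub> b \<oplus>\<^bsub>M\<^esub> s"
        using x by blast
      have "s \<in> carrier M" using E(1) 1(2) by auto
      then have "c \<odot>\<^bsub>M\<^esub> x = (c \<otimes> t) \<odot>\<^bsub>M\<^esub> b \<oplus>\<^bsub>M\<^esub> c \<odot>\<^bsub>M\<^esub> s"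
        unfolding 1(3) using b c 1(1) by (simp add: smult_r_distr smult_assoc1)
      then show ?thesis using memI[OF R.m_closed[OF c 1(1)] E(4)[OF c 1(2)]] by simp
    qed
  qed
qed

text \<open>
  A subspace \<open>V \<supseteq> W\<close> that is maximal without \<open>b\<close> is a complement of the line through \<open>b\<close>.  The functional
  is the coordinate along \<open>b\<close>.
\<close>

theorem separating_functional:
  assumes K: "field R" and W: "submodule W R M" and b: "b \<in> carrier M" "b \<notin> W"
  obtains f where "linear_functional R M f" "\<And>x. x \<in> W \<Longrightarrow> f x = \<zero>" "f b = \<one>"
proof -
  interpret K: field R by fact
  define \<A> where "\<A> = {V. submodule V R M \<and> W \<subseteq> V \<and> b \<notin> V}"
  have "\<exists>V\<in>\<A>. \<forall>Z\<in>\<A>. V \<subseteq> Z \<longrightarrow> Z = V"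
  proof (rule subset_Zorn_nonempty)
    show "\<A> \<noteq> {}" using W b by (auto simp: \<A>_def)
    fix C assume C: "C \<noteq> {}" "subset.chain \<A> C"
    have CA: "C \<subseteq> \<A>" and tot: "\<And>V V'. V \<in> C \<Longrightarrow> V' \<in> C \<Longrightarrow> V \<subseteq> V' \<or> V' \<subseteq> V"
      using C(2) by (auto simp: subset_chain_def)
    have sm: "submodule V R M" if "V \<in> C" for V using CA that by (auto simp: \<A>_def)
    have "submodule (\<Union>C) R M"
    proof (rule submoduleI_closed)
      show "\<Union>C \<subseteq> carrier M" using submoduleE(1)[OF sm] by blast
      show "\<zero>\<^bsub>M\<^esub> \<in> \<Union>C" using C(1) submodule_zero_closed[OF sm] by blast
      show "x \<oplus>\<^bsub>M\<^esub> y \<in> \<Union>C" if xy: "x \<in> \<Union>C" "y \<in> \<Union>C" for x y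
      proof -
        obtain V V' where V: "V \<in> C" "x \<in> V" "V' \<in> C" "y \<in> V'" using xy by blast
        then obtain V'' where "V'' \<in> C" "x \<in> V''" "y \<in> V''" using tot[OF V(1,3)] by blast
        then show ?thesis using submoduleE(5)[OF sm] by blast
      qed
      show "c \<odot>\<^bsub>M\<^esub> x \<in> \<Union>C" if "c \<in> carrier R" "x \<in> \<Union>C" for c x
        using that submoduleE(4)[OF sm] by blast
    qed
    then show "\<Union>C \<in> \<A>" using CA C(1) by (auto simp: \<A>_def)
  qed
  then obtain V where "V \<in> \<A>" and maxV: "\<And>Z. Z \<in> \<A> \<Longrightarrow> V \<subseteq> Z \<Longrightarrow> Z = V"
    by metis
  then have V: "submodule V R M" and WV: "W \<subseteq> V" and bV: "b \<notin> V"
    by (simp_all add: \<A>_def)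
  have max: "Z = V" if "submodule Z R M" "W \<subseteq> Z" "b \<notin> Z" "V \<subseteq> Z" for Z
    using maxV[of Z] that by (simp add: \<A>_def)
  note E = submoduleE[OF V]
  \<comment> \<open>\<open>P c t\<close> says that \<open>t\<close> is the coordinate of \<open>c\<close> along \<open>b\<close>.\<close>
  define P where "P c t \<longleftrightarrow> t \<in> carrier R \<and> (\<exists>m\<in>V. c = t \<odot>\<^bsub>M\<^esub> b \<oplus>\<^bsub>M\<^esub> m)" for c t
  have uniq: "t = t'" if PP: "P c t" "P c t'" for c t t'
  proof (rule ccontr)
    assume ne: "t \<noteq> t'"
    obtain m m' where m: "m \<in> V" "m' \<in> V" and t: "t \<in> carrier R" "t' \<in> carrier R"
      and eq: "t \<odot>\<^bsub>M\<^esub> b \<oplus>\<^bsub>M\<^esub> m = t' \<odot>\<^bsub>M\<^esub> b \<oplus>\<^bsub>M\<^esub> m'"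
      using PP unfolding P_def by metis
    have mc: "m \<in> carrier M" "m' \<in> carrier M" using m E(1) by auto
    have "(t \<ominus> t') \<odot>\<^bsub>M\<^esub> b = (t \<odot>\<^bsub>M\<^esub> b \<oplus>\<^bsub>M\<^esub> m) \<ominus>\<^bsub>M\<^esub> m \<ominus>\<^bsub>M\<^esub> t' \<odot>\<^bsub>M\<^esub> b"
      using t b mc by (simp add: R.minus_eq M.minus_eq smult_l_distr smult_l_minus M.a_assoc M.r_neg1 M.r_neg2 M.r_neg)
    also have "\<dots> = m' \<ominus>\<^bsub>M\<^esub> m"
      unfolding eq using t b mc by (simp add: M.minus_eq M.a_ac M.r_neg1 M.r_neg2 M.r_neg)
    finally have "(t \<ominus> t') \<odot>\<^bsub>M\<^esub> b \<in> V" using m E(3,5) by (simp add: M.minus_eq)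
    moreover have u: "t \<ominus> t' \<in> Units R"
      using ne t by (simp add: K.field_Units)
    ultimately have "inv (t \<ominus> t') \<odot>\<^bsub>M\<^esub> ((t \<ominus> t') \<odot>\<^bsub>M\<^esub> b) \<in> V" using E(4) by simp
    then show False using bV u b t by (simp flip: smult_assoc1)
  qed
  have ex: "\<exists>t. P c t" if c: "c \<in> carrier M" for c
  proof (cases "c \<in> V")
    case True
    then have "P c \<zero>" using b c by (auto simp: P_def intro!: bexI[of _ c])
    then show ?thesis ..
  next
    case False
    note adj = submodule_adjoin[OF V c]
    have "b \<in> {t \<odot>\<^bsub>M\<^esub> c \<oplus>\<^bsub>M\<^esub> s | t s. t \<in> carrier R \<and> s \<in> V}"
      using max[OF adj(1) _ _ adj(2)] WV adj(2,3) False by auto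
    then obtain s m where s: "s \<in> carrier R" and m: "m \<in> V" and beq: "b = s \<odot>\<^bsub>M\<^esub> c \<oplus>\<^bsub>M\<^esub> m"
      by blast
    have mc: "m \<in> carrier M" using m E(1) by auto
    have "s \<noteq> \<zero>" using bV m mc c beq by auto
    then have u: "s \<in> Units R" using s by (simp add: K.field_Units)
    have "inv s \<odot>\<^bsub>M\<^esub> b \<oplus>\<^bsub>M\<^esub> \<ominus>\<^bsub>M\<^esub> (inv s \<odot>\<^bsub>M\<^esub> m) = c"
      unfolding beq using u s c mc by (simp add: smult_r_distr M.a_assoc M.r_neg flip: smult_assoc1)
    then have "P c (inv s)"
      using u m E(3,4) by (auto simp: P_def intro!: bexI[of _ "\<ominus>\<^bsub>M\<^esub> (inv s \<odot>\<^bsub>M\<^esub> m)"])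
    then show ?thesis ..
  qed
  define f where "f c = (SOME t. P c t)" for c
  have Pf: "P c (f c)" if "c \<in> carrier M" for c
    unfolding f_def using ex[OF that] by (rule someI_ex)
  have f_eqI: "f c = t" if "P c t" for c t
    unfolding f_def using that uniq by blast
  have f_car: "f c \<in> carrier R" if "c \<in> carrier M" for c using Pf[OF that] by (simp add: P_def)
  show thesis
  proof
    show "f x = \<zero>" if "x \<in> W" for x
      using that WV E(1) b by (intro f_eqI) (force simp: P_def intro!: bexI[of _ x])
    show "f b = \<one>"
      using b submodule_zero_closed[OF V] by (intro f_eqI) (auto simp: P_def intro!: bexI[of _ "\<zero>\<^bsub>M\<^esub>"])
    show "linear_functional R M f"
      unfolding linear_functional_def
    proof (intro conjI ballI)
      show "f \<in> carrier M \<rightarrow> carrier R" using f_car by blast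
      show "f (x \<oplus>\<^bsub>M\<^esub> y) = f x \<oplus> f y" if x: "x \<in> carrier M" and y: "y \<in> carrier M" for x y
      proof (rule f_eqI)
        obtain m m' where m: "m \<in> V" "x = f x \<odot>\<^bsub>M\<^esub> b \<oplus>\<^bsub>M\<^esub> m" "m' \<in> V" "y = f y \<odot>\<^bsub>M\<^esub> b \<oplus>\<^bsub>M\<^esub> m'"
          using Pf[OF x] Pf[OF y] by (auto simp: P_def)
        have mc: "m \<in> carrier M" "m' \<in> carrier M" using m E(1) by auto
        have "x \<oplus>\<^bsub>M\<^esub> y = (f x \<odot>\<^bsub>M\<^esub> b \<oplus>\<^bsub>M\<^esub> m) \<oplus>\<^bsub>M\<^esub> (f y \<odot>\<^bsub>M\<^esub> b \<oplus>\<^bsub>M\<^esub> m')"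
          using m(2,4) by simp
        also have "\<dots> = (f x \<oplus> f y) \<odot>\<^bsub>M\<^esub> b \<oplus>\<^bsub>M\<^esub> (m \<oplus>\<^bsub>M\<^esub> m')"
          using mc b f_car[OF x] f_car[OF y] by (simp add: smult_l_distr M.a_ac)
        finally show "P (x \<oplus>\<^bsub>M\<^esub> y) (f x \<oplus> f y)"
          using f_car[OF x] f_car[OF y] E(5)[OF m(1,3)] unfolding P_def by blast
      qed
      show "f (c \<odot>\<^bsub>M\<^esub> x) = c \<otimes> f x" if c: "c \<in> carrier R" and x: "x \<in> carrier M" for c x
      proof (rule f_eqI)
        obtain m where m: "m \<in> V" "x = f x \<odot>\<^bsub>M\<^esub> b \<oplus>\<^bsub>M\<^esub> m"
          using Pf[OF x] by (auto simp: P_def)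
        have mc: "m \<in> carrier M" using m E(1) by auto
        have "c \<odot>\<^bsub>M\<^esub> x = c \<odot>\<^bsub>M\<^esub> (f x \<odot>\<^bsub>M\<^esub> b \<oplus>\<^bsub>M\<^esub> m)" using m(2) by simp
        also have "\<dots> = (c \<otimes> f x) \<odot>\<^bsub>M\<^esub> b \<oplus>\<^bsub>M\<^esub> c \<odot>\<^bsub>M\<^esub> m"
          using mc b c f_car[OF x] by (simp add: smult_r_distr smult_assoc1)
        finally show "P (c \<odot>\<^bsub>M\<^esub> x) (c \<otimes> f x)"
          using c f_car[OF x] E(4)[OF c m(1)] unfolding P_def by blast
      qed
    qed
  qed
qed

end

text \<open>
  Scalars act through the ring, as multiples of its unit.
\<close>

lemma (in algebra) ideal_is_submodule:
  assumes "ideal I M"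
  shows "submodule I R M"
proof (rule submoduleI_closed)
  interpret I: ideal I M by fact
  show "I \<subseteq> carrier M" by (rule I.a_subset)
  show "c \<odot>\<^bsub>M\<^esub> x \<in> I" if "c \<in> carrier R" "x \<in> I" for c x
    using I.I_l_closed[OF that(2), of "c \<odot>\<^bsub>M\<^esub> \<one>\<^bsub>M\<^esub>"] that I.Icarr[OF that(2)]
    by (simp add: smult_assoc2)
  show "\<zero>\<^bsub>M\<^esub> \<in> I" by simp
  show "x \<oplus>\<^bsub>M\<^esub> y \<in> I" if "x \<in> I" "y \<in> I" for x y using that by simp
qed

section \<open>Tensor products over a field, axiomatically\<close>

primrec tensor_sum :: "('r, 'o) ring_scheme \<Rightarrow> ('a \<Rightarrow> 'b \<Rightarrow> 'r) \<Rightarrow> ('a \<times> 'b) list \<Rightarrow> 'r" where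
  "tensor_sum R p [] = \<zero>\<^bsub>R\<^esub>"
| "tensor_sum R p (x # xs) = p (fst x) (snd x) \<oplus>\<^bsub>R\<^esub> tensor_sum R p xs"

text \<open>
  Here \<open>h\<close> is the map \<open>id \<otimes> f\<close> from \<open>A \<otimes> B\<close> to \<open>A \<otimes> k = A\<close>.
\<close>

definition slice :: "('k, 'a, 'm) module_scheme \<Rightarrow> ('k, 'b, 'n) module_scheme \<Rightarrow> ('r, 'o) ring_scheme
    \<Rightarrow> ('a \<Rightarrow> 'b \<Rightarrow> 'r) \<Rightarrow> ('b \<Rightarrow> 'k) \<Rightarrow> ('r \<Rightarrow> 'a) \<Rightarrow> bool"
  where "slice A B R p f h \<longleftrightarrow> h \<in> carrier R \<rightarrow> carrier A \<and>
    (\<forall>x\<in>carrier R. \<forall>y\<in>carrier R. h (x \<oplus>\<^bsub>R\<^esub> y) = h x \<oplus>\<^bsub>A\<^esub> h y) \<and>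
    (\<forall>a\<in>carrier A. \<forall>b\<in>carrier B. h (p a b) = f b \<odot>\<^bsub>A\<^esub> a)"

lemma sliceD:
  assumes "slice A B R p f h"
  shows "x \<in> carrier R \<Longrightarrow> h x \<in> carrier A"
    and "x \<in> carrier R \<Longrightarrow> y \<in> carrier R \<Longrightarrow> h (x \<oplus>\<^bsub>R\<^esub> y) = h x \<oplus>\<^bsub>A\<^esub> h y"
    and "a \<in> carrier A \<Longrightarrow> b \<in> carrier B \<Longrightarrow> h (p a b) = f b \<odot>\<^bsub>A\<^esub> a"
  using assms by (auto simp: slice_def)

text \<open>
  The properties of \<open>A \<otimes> B\<close> that the argument needs.  They are symmetric in \<open>A\<close> and \<open>B\<close>, so that each result
  about the left factor holds for the right factor too (\<open>swap\<close>).
\<close>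

locale algebra_tensor_product = K: field k + A: algebra k A + B: algebra k B + R?: cring R
  for k :: "('k, 'l) ring_scheme" and A :: "('k, 'a, 'm) module_scheme"
    and B :: "('k, 'b, 'n) module_scheme" and R :: "('r, 'o) ring_scheme" (structure) +
  fixes p :: "'a \<Rightarrow> 'b \<Rightarrow> 'r"
  assumes p_closed [simp]: "a \<in> carrier A \<Longrightarrow> b \<in> carrier B \<Longrightarrow> p a b \<in> carrier R"
    and p_mult: "a \<in> carrier A \<Longrightarrow> b \<in> carrier B \<Longrightarrow> a' \<in> carrier A \<Longrightarrow> b' \<in> carrier B \<Longrightarrow>
      p a b \<otimes> p a' b' = p (a \<otimes>\<^bsub>A\<^esub> a') (b \<otimes>\<^bsub>B\<^esub> b')"
    and p_one: "p \<one>\<^bsub>A\<^esub> \<one>\<^bsub>B\<^esub> = \<one>"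
    and p_add_left: "a \<in> carrier A \<Longrightarrow> a' \<in> carrier A \<Longrightarrow> b \<in> carrier B \<Longrightarrow>
      p (a \<oplus>\<^bsub>A\<^esub> a') b = p a b \<oplus> p a' b"
    and p_add_right: "a \<in> carrier A \<Longrightarrow> b \<in> carrier B \<Longrightarrow> b' \<in> carrier B \<Longrightarrow>
      p a (b \<oplus>\<^bsub>B\<^esub> b') = p a b \<oplus> p a b'"
    and p_balanced: "c \<in> carrier k \<Longrightarrow> a \<in> carrier A \<Longrightarrow> b \<in> carrier B \<Longrightarrow>
      p (c \<odot>\<^bsub>A\<^esub> a) b = p a (c \<odot>\<^bsub>B\<^esub> b)"
    and generated: "z \<in> carrier R \<Longrightarrow> \<exists>xs. set xs \<subseteq> carrier A \<times> carrier B \<and> z = tensor_sum R p xs"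
    and slice_left: "linear_functional k B f \<Longrightarrow> \<exists>h. slice A B R p f h"
    and slice_right: "linear_functional k A g \<Longrightarrow> \<exists>h. slice B A R (\<lambda>b a. p a b) g h"
begin

lemma tensor_sum_closed: "set xs \<subseteq> carrier A \<times> carrier B \<Longrightarrow> tensor_sum R p xs \<in> carrier R"
  by (induction xs) auto

lemma tensor_sum_append:
  "set xs \<subseteq> carrier A \<times> carrier B \<Longrightarrow> set ys \<subseteq> carrier A \<times> carrier B \<Longrightarrow>
    tensor_sum R p (xs @ ys) = tensor_sum R p xs \<oplus> tensor_sum R p ys"
  by (induction xs) (auto simp: tensor_sum_closed a_assoc)

lemma swap: "algebra_tensor_product k B A R (\<lambda>b a. p a b)"
proof (unfold_locales, goal_cases)
  case (7 z)
  then obtain xs where xs: "set xs \<subseteq> carrier A \<times> carrier B" "z = tensor_sum R p xs"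
    using generated by blast
  have "tensor_sum R p xs = tensor_sum R (\<lambda>b a. p a b) (map prod.swap xs)"
    by (induction xs) auto
  then show ?case using xs by (intro exI[of _ "map prod.swap xs"]) auto
qed (simp_all add: p_mult p_one p_add_left p_add_right p_balanced slice_left slice_right)

lemma p_zero_right: "a \<in> carrier A \<Longrightarrow> p a \<zero>\<^bsub>B\<^esub> = \<zero>"
  using p_add_right[of a "\<zero>\<^bsub>B\<^esub>" "\<zero>\<^bsub>B\<^esub>"] p_closed[of a "\<zero>\<^bsub>B\<^esub>"]
  by (metis B.M.add.r_cancel_one' B.M.zero_closed add.r_cancel_one' p_closed)

lemma pure_mult_tensor_sum:
  assumes "c \<in> carrier A" "d \<in> carrier B" "set xs \<subseteq> carrier A \<times> carrier B"
  shows "p c d \<otimes> tensor_sum R p xs = tensor_sum R p (map (\<lambda>x. (c \<otimes>\<^bsub>A\<^esub> fst x, d \<otimes>\<^bsub>B\<^esub> snd x)) xs)"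
  using assms(3)
  by (induction xs) (use assms(1,2) in \<open>auto simp: r_distr p_mult tensor_sum_closed\<close>)

text \<open>
  A set of pure tensors that is stable under multiplication by pure tensors generates an ideal without
  any further coefficients.
\<close>

lemma genideal_pure_subset:
  assumes sub: "G \<subseteq> carrier A \<times> carrier B"
    and G: "\<And>a b c d. (a, b) \<in> G \<Longrightarrow> c \<in> carrier A \<Longrightarrow> d \<in> carrier B \<Longrightarrow> (c \<otimes>\<^bsub>A\<^esub> a, d \<otimes>\<^bsub>B\<^esub> b) \<in> G"
    and z: "z \<in> Idl (case_prod p ` G)"
  shows "\<exists>xs. set xs \<subseteq> G \<and> z = tensor_sum R p xs"
proof -
  have mult: "\<exists>zs. set zs \<subseteq> G \<and> tensor_sum R p ys \<otimes> tensor_sum R p xs = tensor_sum R p zs"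
    if "set ys \<subseteq> carrier A \<times> carrier B" "set xs \<subseteq> G" for xs ys
    using that(1)
  proof (induction ys)
    case Nil
    then show ?case using tensor_sum_closed[of xs] that(2) sub by (intro exI[of _ "[]"]) auto
  next
    case (Cons y ys)
    then obtain zs where zs: "set zs \<subseteq> G" "tensor_sum R p ys \<otimes> tensor_sum R p xs = tensor_sum R p zs"
      by auto
    obtain c d where y: "y = (c, d)" by fastforce
    define xs' where "xs' = map (\<lambda>x. (c \<otimes>\<^bsub>A\<^esub> fst x, d \<otimes>\<^bsub>B\<^esub> snd x)) xs"
    have xs': "set xs' \<subseteq> G" unfolding xs'_def using that(2) Cons.prems G by (force simp: y)
    have "tensor_sum R p (y # ys) \<otimes> tensor_sum R p xs = tensor_sum R p xs' \<oplus> tensor_sum R p zs"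
      using Cons.prems that(2) sub
      by (simp add: y l_distr tensor_sum_closed pure_mult_tensor_sum xs'_def flip: zs(2))
    also have "\<dots> = tensor_sum R p (xs' @ zs)"
      using xs' zs(1) sub by (intro tensor_sum_append[symmetric]) auto
    finally show ?case using xs' zs(1) by (intro exI[of _ "xs' @ zs"]) auto
  qed
  have "ideal {tensor_sum R p xs | xs. set xs \<subseteq> G} R"
  proof (rule idealI_closed)
    show "{tensor_sum R p xs | xs. set xs \<subseteq> G} \<subseteq> carrier R"
      using sub tensor_sum_closed by blast
    show "\<zero> \<in> {tensor_sum R p xs | xs. set xs \<subseteq> G}" by (auto intro!: exI[of _ "[]"])
    show "x \<oplus> y \<in> {tensor_sum R p xs | xs. set xs \<subseteq> G}"
      if xy: "x \<in> {tensor_sum R p xs | xs. set xs \<subseteq> G}" "y \<in> {tensor_sum R p xs | xs. set xs \<subseteq> G}" for x y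
    proof -
      obtain xs ys where "set xs \<subseteq> G" "x = tensor_sum R p xs" "set ys \<subseteq> G" "y = tensor_sum R p ys"
        using xy by blast
      then show ?thesis using sub by (auto intro!: exI[of _ "xs @ ys"] tensor_sum_append[symmetric])
    qed
    show "r \<otimes> x \<in> {tensor_sum R p xs | xs. set xs \<subseteq> G}"
      if x: "x \<in> {tensor_sum R p xs | xs. set xs \<subseteq> G}" and r: "r \<in> carrier R" for x r
      using mult x generated[OF r] by blast
  qed
  moreover have "case_prod p ` G \<subseteq> {tensor_sum R p xs | xs. set xs \<subseteq> G}"
  proof
    fix w assume "w \<in> case_prod p ` G"
    then obtain a b where ab: "(a, b) \<in> G" "w = p a b" by auto
    then have "w = tensor_sum R p [(a, b)]" using sub by auto
    then show "w \<in> {tensor_sum R p xs | xs. set xs \<subseteq> G}"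
      using ab(1) by (intro CollectI exI[of _ "[(a, b)]"]) simp
  qed
  ultimately show ?thesis using genideal_minimal z by blast
qed

lemma slice_zero:
  assumes h: "slice A B R p f h"
  shows "h \<zero> = \<zero>\<^bsub>A\<^esub>"
  using sliceD(2)[OF h zero_closed zero_closed] sliceD(1)[OF h zero_closed]
  by (metis A.M.add.r_cancel_one' r_zero zero_closed)

lemma slice_tensor_sum_mem:
  assumes h: "slice A B R p f h" and X: "ideal I A"
    and xs: "set xs \<subseteq> carrier A \<times> carrier B"
    and mem: "\<And>a b. (a, b) \<in> set xs \<Longrightarrow> f b \<odot>\<^bsub>A\<^esub> a \<in> I"
  shows "h (tensor_sum R p xs) \<in> I"
  using xs mem
proof (induction xs)
  case Nil
  show ?case using slice_zero[OF h] X by (simp add: additive_subgroup.zero_closed ideal.axioms(1))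
next
  case (Cons x xs)
  obtain a b where x: "x = (a, b)" by fastforce
  have "h (tensor_sum R p (x # xs)) = f b \<odot>\<^bsub>A\<^esub> a \<oplus>\<^bsub>A\<^esub> h (tensor_sum R p xs)"
    using Cons.prems(1) by (simp add: x sliceD(2,3)[OF h] tensor_sum_closed)
  also have "\<dots> \<in> I"
    using Cons.prems Cons.IH
    by (intro additive_subgroup.a_closed[OF ideal.axioms(1)[OF X]]) (auto simp: x)
  finally show ?case .
qed

lemma slice_mult_left:
  assumes h: "slice A B R p f h" and f: "linear_functional k B f"
    and a: "a \<in> carrier A" and z: "z \<in> carrier R"
  shows "h (p a \<one>\<^bsub>B\<^esub> \<otimes> z) = a \<otimes>\<^bsub>A\<^esub> h z"
proof -
  obtain xs where xs: "set xs \<subseteq> carrier A \<times> carrier B" "z = tensor_sum R p xs"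
    using generated[OF z] by blast
  have "h (p a \<one>\<^bsub>B\<^esub> \<otimes> tensor_sum R p xs) = a \<otimes>\<^bsub>A\<^esub> h (tensor_sum R p xs)"
    using xs(1)
  proof (induction xs)
    case Nil
    then show ?case using a by (simp add: slice_zero[OF h])
  next
    case (Cons x xs)
    obtain c d where x: "x = (c, d)" by fastforce
    have cd: "c \<in> carrier A" "d \<in> carrier B" and xs: "set xs \<subseteq> carrier A \<times> carrier B"
      using Cons.prems by (auto simp: x)
    have fd: "f d \<in> carrier k" by (rule linear_functionalD(1)[OF f cd(2)])
    have "h (p a \<one>\<^bsub>B\<^esub> \<otimes> tensor_sum R p (x # xs))
        = h (p (a \<otimes>\<^bsub>A\<^esub> c) d) \<oplus>\<^bsub>A\<^esub> h (p a \<one>\<^bsub>B\<^esub> \<otimes> tensor_sum R p xs)"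
      using a cd xs by (simp add: x r_distr p_mult tensor_sum_closed sliceD(2)[OF h])
    also have "\<dots> = f d \<odot>\<^bsub>A\<^esub> (a \<otimes>\<^bsub>A\<^esub> c) \<oplus>\<^bsub>A\<^esub> a \<otimes>\<^bsub>A\<^esub> h (tensor_sum R p xs)"
      using a cd Cons.IH[OF xs] by (simp add: sliceD(3)[OF h])
    also have "f d \<odot>\<^bsub>A\<^esub> (a \<otimes>\<^bsub>A\<^esub> c) = a \<otimes>\<^bsub>A\<^esub> (f d \<odot>\<^bsub>A\<^esub> c)"
      using a cd fd by (metis A.m_comm A.smult_assoc2 A.smult_closed)
    also have "a \<otimes>\<^bsub>A\<^esub> (f d \<odot>\<^bsub>A\<^esub> c) \<oplus>\<^bsub>A\<^esub> a \<otimes>\<^bsub>A\<^esub> h (tensor_sum R p xs) = a \<otimes>\<^bsub>A\<^esub> h (tensor_sum R p (x # xs))"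
      using a cd fd xs
      by (simp add: x sliceD(2,3)[OF h] sliceD(1)[OF h] tensor_sum_closed A.r_distr)
    finally show ?case .
  qed
  then show ?thesis using xs(2) by simp
qed

end

text \<open>
  The span is defined by recursion on the list of generators because tensor sums are rewritten one
  summand at a time.
\<close>

primrec span_over :: "('k, 'l) ring_scheme \<Rightarrow> ('k, 'b, 'n) module_scheme \<Rightarrow> 'b set \<Rightarrow> 'b list \<Rightarrow> 'b set" where
  "span_over k M W [] = W"
| "span_over k M W (b # bs) = {t \<odot>\<^bsub>M\<^esub> b \<oplus>\<^bsub>M\<^esub> s | t s. t \<in> carrier k \<and> s \<in> span_over k M W bs}"

lemma (in module) span_over:
  assumes "submodule W R M" "set bs \<subseteq> carrier M"
  shows "submodule (span_over R M W bs) R M \<and> W \<subseteq> span_over R M W bs \<and> set bs \<subseteq> span_over R M W bs"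
  using assms(2)
proof (induction bs)
  case Nil
  then show ?case using assms(1) by simp
next
  case (Cons b bs)
  then have IH: "submodule (span_over R M W bs) R M" "W \<subseteq> span_over R M W bs" "set bs \<subseteq> span_over R M W bs"
    and b: "b \<in> carrier M"
    by auto
  show ?case
    using submodule_adjoin[OF IH(1) b] IH(2,3) unfolding span_over.simps list.set by blast
qed

context algebra_tensor_product
begin

lemma items_closed:
  assumes "\<forall>(i::nat, a, b)\<in>set zs. a \<in> carrier A \<and> b \<in> carrier B"
  shows "set (map snd zs) \<subseteq> carrier A \<times> carrier B"
  using assms by fastforce

text \<open>
  If \<open>c\<close> is a combination of the right factors in a tensor sum modulo \<open>W\<close>, then \<open>x \<otimes> c\<close> can be distributed
  over the summands, changing left factors only, up to a remainder \<open>x \<otimes> \<beta>\<close> with \<open>\<beta> \<in> W\<close>.  The number attached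
  to each summand is its level in the proof below, which the rewriting must preserve.
\<close>

lemma absorb_in_tensor_sum:
  assumes W: "submodule W k B" and zs: "\<forall>(i::nat, a, b)\<in>set zs. a \<in> carrier A \<and> b \<in> carrier B"
    and x: "x \<in> carrier A" and c: "c \<in> span_over k B W (map (\<lambda>(i, a, b). b) zs)"
  shows "\<exists>\<beta>\<in>W. \<exists>zs'. map (\<lambda>(i, a, b). (i, b)) zs' = map (\<lambda>(i, a, b). (i, b)) zs \<and>
    (\<forall>(i, a, b)\<in>set zs'. a \<in> carrier A \<and> b \<in> carrier B) \<and>
    p x c \<oplus> tensor_sum R p (map snd zs) = p x \<beta> \<oplus> tensor_sum R p (map snd zs')"
  using zs c
proof (induction zs arbitrary: c)
  case Nil
  then show ?case by (intro bexI[of _ c] exI[of _ "[]"]) auto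
next
  case (Cons z zs)
  obtain i a b where z: "z = (i, a, b)" by (cases z) auto
  have ab: "a \<in> carrier A" "b \<in> carrier B" and zs: "\<forall>(i, a, b)\<in>set zs. a \<in> carrier A \<and> b \<in> carrier B"
    using Cons.prems(1) by (auto simp: z)
  obtain t s where t: "t \<in> carrier k" and s: "s \<in> span_over k B W (map (\<lambda>(i, a, b). b) zs)"
    and c: "c = t \<odot>\<^bsub>B\<^esub> b \<oplus>\<^bsub>B\<^esub> s"
    using Cons.prems(2) by (auto simp: z)
  obtain \<beta> zs' where \<beta>: "\<beta> \<in> W" and shape: "map (\<lambda>(i, a, b). (i, b)) zs' = map (\<lambda>(i, a, b). (i, b)) zs"
    and zs': "\<forall>(i, a, b)\<in>set zs'. a \<in> carrier A \<and> b \<in> carrier B"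
    and eq: "p x s \<oplus> tensor_sum R p (map snd zs) = p x \<beta> \<oplus> tensor_sum R p (map snd zs')"
    using Cons.IH[OF zs s] by blast
  have bs: "set (map (\<lambda>(i, a, b). b) zs) \<subseteq> carrier B" using zs by auto
  have sc: "s \<in> carrier B"
    using s B.submoduleE(1)[of "span_over k B W (map (\<lambda>(i, a, b). b) zs)"] B.span_over[OF W bs] by blast
  have \<beta>c: "\<beta> \<in> carrier B" using \<beta> B.submoduleE(1)[OF W] by blast
  have car: "tensor_sum R p (map snd zs) \<in> carrier R" "tensor_sum R p (map snd zs') \<in> carrier R"
    using tensor_sum_closed[OF items_closed[OF zs]] tensor_sum_closed[OF items_closed[OF zs']] by simp_all
  have tx: "t \<odot>\<^bsub>A\<^esub> x \<in> carrier A" using t x by simp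
  have "p x c \<oplus> tensor_sum R p (map snd (z # zs))
      = p (t \<odot>\<^bsub>A\<^esub> x) b \<oplus> p x s \<oplus> (p a b \<oplus> tensor_sum R p (map snd zs))"
    using x t ab sc by (simp add: c z p_add_right p_balanced)
  also have "\<dots> = p (t \<odot>\<^bsub>A\<^esub> x \<oplus>\<^bsub>A\<^esub> a) b \<oplus> (p x s \<oplus> tensor_sum R p (map snd zs))"
    using x tx ab sc car by (simp add: p_add_left a_ac)
  also have "\<dots> = p x \<beta> \<oplus> tensor_sum R p (map snd ((i, t \<odot>\<^bsub>A\<^esub> x \<oplus>\<^bsub>A\<^esub> a, b) # zs'))"
    unfolding eq using x tx ab \<beta>c car by (simp add: a_ac)
  finally show ?case
    using \<beta> shape zs' tx ab
    by (intro bexI[of _ \<beta>] exI[of _ "(i, t \<odot>\<^bsub>A\<^esub> x \<oplus>\<^bsub>A\<^esub> a, b) # zs'"]) (auto simp: z)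
qed

text \<open>
  Write \<open>z\<close> for the tensor sum.  Each of its summands \<open>a \<otimes> b\<close> carries a level \<open>l\<close> with \<open>b \<in> Y l\<close>, and the induction is on the
  sum of the successors of the levels.  A summand of level \<open>0\<close> vanishes.  Consider a summand of level
  \<open>m + 1\<close>.  If \<open>b\<close> is a combination of the other right factors modulo \<open>Y m\<close>, then the summand can be
  replaced by one of level \<open>m\<close>.  Otherwise some functional vanishes on \<open>Y m\<close> and on the other right factors,
  and takes the value \<open>1\<close> at \<open>b\<close>.  The slice along it sends \<open>z\<close> to \<open>a\<close>, so \<open>a \<in> C m\<close> and the summand lies in \<open>U\<close>.  The rest
  still satisfies the hypothesis on slices, because \<open>a \<otimes> b\<close> does.
\<close>

lemma mem_filtered_span_if_slices:
  assumes Y0: "Y 0 = {\<zero>\<^bsub>B\<^esub>}" and Y: "\<And>i. submodule (Y i) k B" and Y_mono: "\<And>i j. i \<le> j \<Longrightarrow> Y i \<subseteq> Y j"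
    and C: "\<And>i. ideal (C i) A" and C_anti: "\<And>i j. i \<le> j \<Longrightarrow> C j \<subseteq> C i"
    and U: "ideal U R" and CYU: "\<And>i a b. a \<in> C i \<Longrightarrow> b \<in> Y (Suc i) \<Longrightarrow> p a b \<in> U"
    and zs: "\<forall>(i, a, b)\<in>set zs. a \<in> carrier A \<and> b \<in> Y i"
    and slices: "\<And>i f h. linear_functional k B f \<Longrightarrow> (\<And>y. y \<in> Y i \<Longrightarrow> f y = \<zero>\<^bsub>k\<^esub>) \<Longrightarrow>
      slice A B R p f h \<Longrightarrow> h (tensor_sum R p (map snd zs)) \<in> C i"
  shows "tensor_sum R p (map snd zs) \<in> U"
  using zs slices
proof (induction "sum_list (map (\<lambda>(i, a, b). Suc i) zs)" arbitrary: zs rule: less_induct)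
  case less
  note zs = less.prems(1) and slices = less.prems(2)
  have Yc: "y \<in> carrier B" if "y \<in> Y i" for y i using B.submoduleE(1)[OF Y] that by blast
  show ?case
  proof (cases zs)
    case Nil
    then show ?thesis using U by (simp add: additive_subgroup.zero_closed ideal.axioms(1))
  next
    case (Cons z rest)
    obtain l a b where z: "z = (l, a, b)" by (cases z) auto
    have a: "a \<in> carrier A" and b: "b \<in> Y l" and rest: "\<forall>(i, a, b)\<in>set rest. a \<in> carrier A \<and> b \<in> Y i"
      using zs by (auto simp: Cons z)
    have bc: "b \<in> carrier B" using Yc[OF b] .
    have restc: "\<forall>(i, a, b)\<in>set rest. a \<in> carrier A \<and> b \<in> carrier B" using rest Yc by fast
    have rest_car: "tensor_sum R p (map snd rest) \<in> carrier R"
      by (rule tensor_sum_closed[OF items_closed[OF restc]])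
    have val: "tensor_sum R p (map snd zs) = p a b \<oplus> tensor_sum R p (map snd rest)"
      by (simp add: Cons z)
    show ?thesis
    proof (cases l)
      case 0
      have "b = \<zero>\<^bsub>B\<^esub>" using b by (simp add: 0 Y0)
      then have eq: "tensor_sum R p (map snd zs) = tensor_sum R p (map snd rest)"
        unfolding val using a rest_car by (simp add: p_zero_right)
      show ?thesis
        unfolding eq
      proof (rule less.hyps[OF _ rest])
        show "sum_list (map (\<lambda>(i, a, b). Suc i) rest) < sum_list (map (\<lambda>(i, a, b). Suc i) zs)"
          by (simp add: Cons z)
        show "h (tensor_sum R p (map snd rest)) \<in> C i"
          if "linear_functional k B f" "\<And>y. y \<in> Y i \<Longrightarrow> f y = \<zero>\<^bsub>k\<^esub>" "slice A B R p f h" for i f h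
          unfolding eq[symmetric] using that by (rule slices)
      qed
    next
      case (Suc m)
      define W where "W = span_over k B (Y m) (map (\<lambda>(i, a, b). b) rest)"
      have "set (map (\<lambda>(i, a, b). b) rest) \<subseteq> carrier B" using restc by auto
      note W = B.span_over[OF Y[of m] this, folded W_def]
      show ?thesis
      proof (cases "b \<in> W")
        case True
        obtain \<beta> rest' where \<beta>: "\<beta> \<in> Y m"
          and shape: "map (\<lambda>(i, a, b). (i, b)) rest' = map (\<lambda>(i, a, b). (i, b)) rest"
          and rest'c: "\<forall>(i, a, b)\<in>set rest'. a \<in> carrier A \<and> b \<in> carrier B"
          and eq: "p a b \<oplus> tensor_sum R p (map snd rest) = p a \<beta> \<oplus> tensor_sum R p (map snd rest')"
          using absorb_in_tensor_sum[OF Y[of m] restc a, of b] True unfolding W_def by blast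
        have rest': "\<forall>(i, a, b)\<in>set rest'. a \<in> carrier A \<and> b \<in> Y i"
        proof (intro ballI, clarify)
          fix i a' b' assume m: "(i, a', b') \<in> set rest'"
          then have "(i, b') \<in> set (map (\<lambda>(i, a, b). (i, b)) rest')" by force
          then have "(i, b') \<in> set (map (\<lambda>(i, a, b). (i, b)) rest)" unfolding shape .
          then have "b' \<in> Y i" using rest by auto
          then show "a' \<in> carrier A \<and> b' \<in> Y i" using rest'c m by auto
        qed
        have sum_eq: "sum_list (map (\<lambda>(i, a, b). Suc i) rest') = sum_list (map (\<lambda>(i, a, b). Suc i) rest)"
        proof -
          have "map (\<lambda>(i, a, b). Suc i) xs = map (Suc \<circ> fst) (map (\<lambda>(i, a, b). (i, b)) xs)"
            for xs :: "(nat \<times> 'a \<times> 'b) list"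
            by auto
          then show ?thesis using shape by metis
        qed
        have eq': "tensor_sum R p (map snd zs) = tensor_sum R p (map snd ((m, a, \<beta>) # rest'))"
          unfolding val eq by simp
        show ?thesis
          unfolding eq'
        proof (rule less.hyps)
          show "sum_list (map (\<lambda>(i, a, b). Suc i) ((m, a, \<beta>) # rest')) < sum_list (map (\<lambda>(i, a, b). Suc i) zs)"
            by (simp add: sum_eq Cons z Suc)
          show "\<forall>(i, a, b)\<in>set ((m, a, \<beta>) # rest'). a \<in> carrier A \<and> b \<in> Y i"
            using rest' a \<beta> by auto
          show "h (tensor_sum R p (map snd ((m, a, \<beta>) # rest'))) \<in> C i"
            if "linear_functional k B f" "\<And>y. y \<in> Y i \<Longrightarrow> f y = \<zero>\<^bsub>k\<^esub>" "slice A B R p f h" for i f h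
            unfolding eq'[symmetric] using that by (rule slices)
        qed
      next
        case False
        obtain f where f: "linear_functional k B f" and fW: "\<And>y. y \<in> W \<Longrightarrow> f y = \<zero>\<^bsub>k\<^esub>"
          and fb: "f b = \<one>\<^bsub>k\<^esub>"
          using B.separating_functional[OF K.field_axioms conjunct1[OF W] bc False] by blast
        obtain h where h: "slice A B R p f h" using slice_left[OF f] by blast
        have "h (tensor_sum R p (map snd rest)) \<in> {\<zero>\<^bsub>A\<^esub>}"
        proof (rule slice_tensor_sum_mem[OF h A.zeroideal items_closed[OF restc]])
          fix a' b' assume "(a', b') \<in> set (map snd rest)"
          then have "b' \<in> W" "a' \<in> carrier A" using W restc by force+
          then show "f b' \<odot>\<^bsub>A\<^esub> a' \<in> {\<zero>\<^bsub>A\<^esub>}" using fW by simp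
        qed
        then have "h (tensor_sum R p (map snd zs)) = a"
          unfolding val using a bc rest_car fb by (simp add: sliceD[OF h])
        then have aX: "a \<in> C m" using slices[OF f _ h, of m] fW W by auto
        have "tensor_sum R p (map snd rest) \<in> U"
        proof (rule less.hyps[OF _ rest])
          show "sum_list (map (\<lambda>(i, a, b). Suc i) rest) < sum_list (map (\<lambda>(i, a, b). Suc i) zs)"
            by (simp add: Cons z)
          fix i g h'
          assume g: "linear_functional k B g" and gY: "\<And>y. y \<in> Y i \<Longrightarrow> g y = \<zero>\<^bsub>k\<^esub>"
            and h': "slice A B R p g h'"
          interpret Ci: ideal "C i" A by (rule C)
          have gb: "g b \<in> carrier k" by (rule linear_functionalD(1)[OF g bc])
          have ga: "g b \<odot>\<^bsub>A\<^esub> a \<in> C i"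
          proof (cases "l \<le> i")
            case True
            then have "g b = \<zero>\<^bsub>k\<^esub>" using gY Y_mono b by blast
            then show ?thesis using a by simp
          next
            case False
            then have "a \<in> C i" using aX C_anti[of i m] Suc by auto
            then show ?thesis using A.submoduleE(4)[OF A.ideal_is_submodule[OF C]] gb by blast
          qed
          have "h' (tensor_sum R p (map snd zs)) \<in> C i" by (rule slices[OF g gY h'])
          then have 1: "g b \<odot>\<^bsub>A\<^esub> a \<oplus>\<^bsub>A\<^esub> h' (tensor_sum R p (map snd rest)) \<in> C i"
            unfolding val using a bc rest_car by (simp add: sliceD[OF h'])
          have 2: "h' (tensor_sum R p (map snd rest)) \<in> carrier A" using sliceD(1)[OF h' rest_car] .
          have "\<ominus>\<^bsub>A\<^esub> (g b \<odot>\<^bsub>A\<^esub> a) \<oplus>\<^bsub>A\<^esub> (g b \<odot>\<^bsub>A\<^esub> a \<oplus>\<^bsub>A\<^esub> h' (tensor_sum R p (map snd rest))) \<in> C i"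
            using 1 ga by blast
          then show "h' (tensor_sum R p (map snd rest)) \<in> C i"
            using 2 a gb by (simp add: A.M.r_neg1)
        qed
        moreover have "p a b \<in> U" using CYU[OF aX] b by (simp add: Suc)
        ultimately show ?thesis
          unfolding val using additive_subgroup.a_closed[OF ideal.axioms(1)[OF U]] by blast
      qed
    qed
  qed
qed

end

section \<open>Colon ideals and division in a sum of products\<close>

lemma (in cring) colon_ideal_is_ideal:
  assumes I: "ideal I R" and J: "J \<subseteq> carrier R"
  shows "ideal (colon_ideal R I J) R"
proof (rule idealI_closed)
  interpret I: ideal I R by fact
  show "colon_ideal R I J \<subseteq> carrier R" by (auto simp: colon_ideal_def)
  show "\<zero> \<in> colon_ideal R I J" using J by (auto simp: colon_ideal_def)
  show "x \<oplus> y \<in> colon_ideal R I J" if "x \<in> colon_ideal R I J" "y \<in> colon_ideal R I J" for x y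
    using that J by (auto simp: colon_ideal_def l_distr subset_iff)
  show "r \<otimes> x \<in> colon_ideal R I J" if "x \<in> colon_ideal R I J" "r \<in> carrier R" for x r
    using that J by (auto simp: colon_ideal_def m_assoc subset_iff intro: I.I_l_closed)
qed

lemma colon_ideal_mono: "I \<subseteq> I' \<Longrightarrow> J' \<subseteq> J \<Longrightarrow> colon_ideal R I J \<subseteq> colon_ideal R I' J'"
  by (auto simp: colon_ideal_def)

lemma (in cring) colon_ideal_carrier: "J \<subseteq> carrier R \<Longrightarrow> colon_ideal R (carrier R) J = carrier R"
  by (auto simp: colon_ideal_def)

definition ideal_filtration :: "('r, 'o) ring_scheme \<Rightarrow> rat \<Rightarrow> (rat \<Rightarrow> 'r set) \<Rightarrow> bool"
  where "ideal_filtration R u C \<longleftrightarrow> C 0 = carrier R \<and> (\<forall>w\<in>{0..u}. ideal (C w) R) \<and>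
    (\<forall>v w. 0 \<le> v \<longrightarrow> v \<le> w \<longrightarrow> w \<le> u \<longrightarrow> C w \<subseteq> C v)"

lemma ideal_filtrationD:
  assumes "ideal_filtration R u C"
  shows "C 0 = carrier R" "w \<in> {0..u} \<Longrightarrow> ideal (C w) R"
    "0 \<le> v \<Longrightarrow> v \<le> w \<Longrightarrow> w \<le> u \<Longrightarrow> C w \<subseteq> C v"
  using assms by (auto simp: ideal_filtration_def)

lemma (in cring) ideal_filtration_colon:
  assumes "ideal_filtration R u C" "J \<subseteq> carrier R"
  shows "ideal_filtration R u (\<lambda>w. colon_ideal R (C w) J)"
  unfolding ideal_filtration_def
proof (intro conjI ballI allI impI)
  show "colon_ideal R (C 0) J = carrier R"
    using ideal_filtrationD(1)[OF assms(1)] colon_ideal_carrier[OF assms(2)] by simp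
  show "ideal (colon_ideal R (C w) J) R" if "w \<in> {0..u}" for w
    using colon_ideal_is_ideal[OF ideal_filtrationD(2)[OF assms(1) that] assms(2)] .
  show "colon_ideal R (C w) J \<subseteq> colon_ideal R (C v) J" if "0 \<le> v" "v \<le> w" "w \<le> u" for v w
    using colon_ideal_mono[OF ideal_filtrationD(3)[OF assms(1) that] order_refl] .
qed

text \<open>
  The pure tensors of these pairs generate \<open>\<Sum> C w \<cdot> Y (u - w)\<close>, with \<open>w\<close> ranging over \<open>F\<close>.  Exchanging \<open>C\<close> and
  \<open>Y\<close> corresponds to reflecting \<open>F\<close> at \<open>u / 2\<close>.
\<close>

definition complementary_pairs :: "rat \<Rightarrow> rat set \<Rightarrow> (rat \<Rightarrow> 'a set) \<Rightarrow> (rat \<Rightarrow> 'b set) \<Rightarrow> ('a \<times> 'b) set"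
  where "complementary_pairs u F C Y = {(a, b). \<exists>w\<in>F. a \<in> C w \<and> b \<in> Y (u - w)}"

lemma finite_set_enumeration:
  fixes F :: "rat set"
  assumes "finite F" "u \<in> F" "\<And>w. w \<in> F \<Longrightarrow> w \<le> u"
  obtains w :: "nat \<Rightarrow> rat" and n where "mono w" "range w = F" "w n = u"
proof -
  define l where "l = sorted_list_of_set F"
  have l: "sorted l" "set l = F" using assms(1) by (simp_all add: l_def)
  define w where "w i = (if i < length l then l ! i else u)" for i
  show thesis
  proof
    show "mono w"
    proof (rule monoI)
      fix i j :: nat assume "i \<le> j"
      then show "w i \<le> w j"
        using sorted_nth_mono[OF l(1), of i j] assms(3) l(2) by (auto simp: w_def)
    qed
    show "range w = F"
    proof
      show "range w \<subseteq> F" using assms(2) l(2) by (auto simp: w_def)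
      show "F \<subseteq> range w"
      proof
        fix v assume "v \<in> F"
        then obtain i where "i < length l" "l ! i = v" using l(2) by (metis in_set_conv_nth)
        then have "v = w i" by (simp add: w_def)
        then show "v \<in> range w" by simp
      qed
    qed
    show "w (length l) = u" by (simp add: w_def)
  qed
qed

context algebra_tensor_product
begin

lemma complementary_pairs_closed:
  assumes F: "F \<subseteq> {0..u}" and C: "ideal_filtration A u C" and Y: "ideal_filtration B u Y"
  shows "complementary_pairs u F C Y \<subseteq> carrier A \<times> carrier B"
    and "(a, b) \<in> complementary_pairs u F C Y \<Longrightarrow> c \<in> carrier A \<Longrightarrow> d \<in> carrier B \<Longrightarrow>
      (c \<otimes>\<^bsub>A\<^esub> a, d \<otimes>\<^bsub>B\<^esub> b) \<in> complementary_pairs u F C Y"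
proof -
  have w: "w \<in> {0..u}" "u - w \<in> {0..u}" if "w \<in> F" for w using F that by auto
  note ids = ideal_filtrationD(2)[OF C] ideal_filtrationD(2)[OF Y]
  show "complementary_pairs u F C Y \<subseteq> carrier A \<times> carrier B"
    using ideal.Icarr[OF ids(1)[OF w(1)]] ideal.Icarr[OF ids(2)[OF w(2)]]
    unfolding complementary_pairs_def by blast
  show "(c \<otimes>\<^bsub>A\<^esub> a, d \<otimes>\<^bsub>B\<^esub> b) \<in> complementary_pairs u F C Y"
    if "(a, b) \<in> complementary_pairs u F C Y" "c \<in> carrier A" "d \<in> carrier B"
    using that ideal.I_l_closed[OF ids(1)[OF w(1)]] ideal.I_l_closed[OF ids(2)[OF w(2)]]
    unfolding complementary_pairs_def by blast
qed

text \<open>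
  Slices of \<open>z\<close> satisfy \<open>x (id \<otimes> f) z = (id \<otimes> f) ((x \<otimes> 1) z)\<close>.  The right-hand side lies in \<open>C w\<close> for all functionals
  \<open>f\<close> that vanish on the ideals \<open>Y (u - v)\<close> with \<open>v < w\<close> in \<open>F\<close>, so these slices of \<open>z\<close> lie in the colon ideal.  The slice
  criterion now applies to the chain of the ideals \<open>Y (u - w)\<close>, which increase with \<open>w \<in> F\<close>.
\<close>

lemma divide_left:
  assumes F: "finite F" "F \<subseteq> {0..u}" "u \<in> F"
    and C: "ideal_filtration A u C" and Y: "ideal_filtration B u Y"
    and S: "S \<subseteq> carrier A" and z: "z \<in> carrier R"
    and div: "\<And>x. x \<in> S \<Longrightarrow> p x \<one>\<^bsub>B\<^esub> \<otimes> z \<in> Idl (case_prod p ` complementary_pairs u F C Y)"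
  shows "z \<in> Idl (case_prod p ` complementary_pairs u F (\<lambda>w. colon_ideal A (C w) S) Y)"
proof -
  have Fle: "w \<le> u" if "w \<in> F" for w using F(2) that by auto
  obtain w :: "nat \<Rightarrow> rat" and n where w: "mono w" "range w = F" "w n = u"
    by (rule finite_set_enumeration[OF F(1,3) Fle])
  have w_in: "w i \<in> F" for i using w(2) by blast
  have w_bd: "0 \<le> w i" "w i \<le> u" for i using w_in[of i] F(2) by auto
  define C' where "C' = (\<lambda>w. colon_ideal A (C w) S)"
  have C': "ideal_filtration A u C'"
    unfolding C'_def by (rule A.ideal_filtration_colon[OF C S])
  \<comment> \<open>The chain starts with the zero ideal, which shifts all indices by one.\<close>
  define V where "V i = (case i of 0 \<Rightarrow> {\<zero>\<^bsub>B\<^esub>} | Suc j \<Rightarrow> Y (u - w j))" for i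
  have idY: "ideal (Y (u - w i)) B" for i using ideal_filtrationD(2)[OF Y] w_bd[of i] by simp
  have idX: "ideal (C (w i)) A" for i using ideal_filtrationD(2)[OF C] w_bd[of i] by simp
  define xs where "xs = (SOME xs. set xs \<subseteq> carrier A \<times> carrier B \<and> z = tensor_sum R p xs)"
  have xs: "set xs \<subseteq> carrier A \<times> carrier B" "z = tensor_sum R p xs"
    using someI_ex[OF generated[OF z], folded xs_def] by auto
  \<comment> \<open>Since \<open>w n = u\<close>, level \<open>n + 1\<close> of the chain is \<open>Y 0\<close>, which is all of \<open>B\<close>.\<close>
  define zs where "zs = map (Pair (Suc n)) xs"
  have snd_zs: "map snd zs = xs" by (simp add: zs_def o_def)
  have "tensor_sum R p (map snd zs) \<in> Idl (case_prod p ` complementary_pairs u F C' Y)"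
  proof (rule mem_filtered_span_if_slices[where Y = V and C = "\<lambda>i. C' (w i)"])
    show "V 0 = {\<zero>\<^bsub>B\<^esub>}" by (simp add: V_def)
    show "submodule (V i) k B" for i
      using B.ideal_is_submodule[OF B.zeroideal] B.ideal_is_submodule[OF idY]
      by (simp add: V_def split: nat.split)
    show "V i \<subseteq> V j" if ij: "i \<le> j" for i j
    proof (cases i)
      case 0
      have "\<zero>\<^bsub>B\<^esub> \<in> V j"
        using additive_subgroup.zero_closed[OF ideal.axioms(1)[OF idY]] by (simp add: V_def split: nat.split)
      then show ?thesis by (simp add: 0 V_def)
    next
      case (Suc i')
      then obtain j' where j': "j = Suc j'" "i' \<le> j'" using ij by (cases j) auto
      then show ?thesis
        using monoD[OF w(1) j'(2)] w_bd[of i'] w_bd[of j'] ideal_filtrationD(3)[OF Y, of "u - w j'" "u - w i'"]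
        by (simp add: V_def Suc)
    qed
    show "ideal (C' (w i)) A" for i using ideal_filtrationD(2)[OF C'] w_bd[of i] by simp
    show "C' (w j) \<subseteq> C' (w i)" if "i \<le> j" for i j
      using ideal_filtrationD(3)[OF C'] w_bd monoD[OF w(1) that] by blast
    show "ideal (Idl (case_prod p ` complementary_pairs u F C' Y)) R"
      using complementary_pairs_closed(1)[OF F(2) C' Y] by (intro genideal_ideal) auto
    show "p a b \<in> Idl (case_prod p ` complementary_pairs u F C' Y)"
      if "a \<in> C' (w i)" "b \<in> V (Suc i)" for i a b
    proof -
      have "(a, b) \<in> complementary_pairs u F C' Y"
        using that w_in[of i] by (auto simp: complementary_pairs_def V_def)
      then show ?thesis
        using complementary_pairs_closed(1)[OF F(2) C' Y]
        by (intro subsetD[OF genideal_self]) force+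
    qed
    show "\<forall>(i, a, b)\<in>set zs. a \<in> carrier A \<and> b \<in> V i"
      using xs(1) w(3) ideal_filtrationD(1)[OF Y] by (auto simp: zs_def V_def)
    show "h (tensor_sum R p (map snd zs)) \<in> C' (w i)"
      if f: "linear_functional k B f" and fV: "\<And>y. y \<in> V i \<Longrightarrow> f y = \<zero>\<^bsub>k\<^esub>" and h: "slice A B R p f h"
      for i f h
    proof -
      have "h z \<otimes>\<^bsub>A\<^esub> x \<in> C (w i)" if x: "x \<in> S" for x
      proof -
        have xc: "x \<in> carrier A" using x S by blast
        obtain ys where ys: "set ys \<subseteq> complementary_pairs u F C Y" "p x \<one>\<^bsub>B\<^esub> \<otimes> z = tensor_sum R p ys"
          using genideal_pure_subset[OF complementary_pairs_closed[OF F(2) C Y] div[OF x]] by blast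
        have ysc: "set ys \<subseteq> carrier A \<times> carrier B"
          using ys(1) complementary_pairs_closed(1)[OF F(2) C Y] by blast
        have "h (tensor_sum R p ys) \<in> C (w i)"
        proof (rule slice_tensor_sum_mem[OF h idX ysc])
          fix a b assume ab: "(a, b) \<in> set ys"
          then obtain v where v: "v \<in> F" "a \<in> C v" "b \<in> Y (u - v)"
            using ys(1) by (auto simp: complementary_pairs_def)
          obtain j where j: "v = w j" using v(1) w(2) by auto
          have abc: "a \<in> carrier A" "b \<in> carrier B" using ab ysc by auto
          show "f b \<odot>\<^bsub>A\<^esub> a \<in> C (w i)"
          proof (cases "i \<le> j")
            case True
            then have "a \<in> C (w i)"
              using v(2) ideal_filtrationD(3)[OF C] w_bd monoD[OF w(1) True] unfolding j by blast
            then show ?thesis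
              using A.submoduleE(4)[OF A.ideal_is_submodule[OF idX]] linear_functionalD(1)[OF f abc(2)] by blast
          next
            case False
            then obtain i' where i': "i = Suc i'" "j \<le> i'" by (cases i) auto
            have "Y (u - w j) \<subseteq> Y (u - w i')"
              using monoD[OF w(1) i'(2)] w_bd[of i'] w_bd[of j]
              by (intro ideal_filtrationD(3)[OF Y]) auto
            then have "f b = \<zero>\<^bsub>k\<^esub>" using v(3) fV by (auto simp: V_def i'(1) j)
            then show ?thesis
              using abc additive_subgroup.zero_closed[OF ideal.axioms(1)[OF idX]] by simp
          qed
        qed
        then have "x \<otimes>\<^bsub>A\<^esub> h z \<in> C (w i)"
          using slice_mult_left[OF h f xc z] ys(2) by simp
        then show ?thesis using A.m_comm[OF xc sliceD(1)[OF h z]] by simp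
      qed
      then show ?thesis
        using sliceD(1)[OF h z] by (simp add: C'_def colon_ideal_def snd_zs flip: xs(2))
    qed
  qed
  then show ?thesis by (simp add: snd_zs C'_def flip: xs(2))
qed

text \<open>
  First the left factor is treated, for all \<open>(1 \<otimes> y) z\<close> at once.  Its conclusion is the hypothesis for the
  right factor, with \<open>F\<close> reflected.
\<close>

theorem divide_both:
  assumes F: "finite F" "F \<subseteq> {0..u}" "0 \<in> F" "u \<in> F"
    and C: "ideal_filtration A u C" and Y: "ideal_filtration B u Y"
    and S: "S \<subseteq> carrier A" and T: "T \<subseteq> carrier B" and z: "z \<in> carrier R"
    and div: "\<And>x y. x \<in> S \<Longrightarrow> y \<in> T \<Longrightarrow> z \<otimes> p x y \<in> Idl (case_prod p ` complementary_pairs u F C Y)"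
  shows "z \<in> Idl (case_prod p ` complementary_pairs u F (\<lambda>w. colon_ideal A (C w) S) (\<lambda>w. colon_ideal B (Y w) T))"
proof -
  interpret S: algebra_tensor_product k B A R "\<lambda>b a. p a b" by (rule swap)
  define C' where "C' = (\<lambda>w. colon_ideal A (C w) S)"
  have C': "ideal_filtration A u C'"
    unfolding C'_def by (rule A.ideal_filtration_colon[OF C S])
  define G where "G = (\<lambda>w. u - w) ` F"
  have pairs: "(case_prod (\<lambda>b a. p a b)) ` complementary_pairs u G Z C' = case_prod p ` complementary_pairs u F C' Z"
    for Z :: "rat \<Rightarrow> 'b set"
    by (force simp: complementary_pairs_def G_def image_iff)
  have "z \<in> Idl (case_prod (\<lambda>b a. p a b) ` complementary_pairs u G (\<lambda>w. colon_ideal B (Y w) T) C')"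
  proof (rule S.divide_left[OF _ _ _ Y C' T z])
    show "finite G" "G \<subseteq> {0..u}" "u \<in> G" using F by (auto simp: G_def image_iff)
    fix y assume y: "y \<in> T"
    have yc: "y \<in> carrier B" using y T by blast
    have "p \<one>\<^bsub>A\<^esub> y \<otimes> z \<in> Idl (case_prod p ` complementary_pairs u F C' Y)"
      unfolding C'_def
    proof (rule divide_left[OF F(1,2,4) C Y S])
      show "p \<one>\<^bsub>A\<^esub> y \<otimes> z \<in> carrier R" using yc z by simp
      fix x assume x: "x \<in> S"
      have xc: "x \<in> carrier A" using x S by blast
      have "p x \<one>\<^bsub>B\<^esub> \<otimes> (p \<one>\<^bsub>A\<^esub> y \<otimes> z) = (p x \<one>\<^bsub>B\<^esub> \<otimes> p \<one>\<^bsub>A\<^esub> y) \<otimes> z"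
        using xc yc z by (simp add: m_assoc)
      also have "\<dots> = z \<otimes> p x y" using xc yc z by (simp add: p_mult m_comm)
      finally show "p x \<one>\<^bsub>B\<^esub> \<otimes> (p \<one>\<^bsub>A\<^esub> y \<otimes> z) \<in> Idl (case_prod p ` complementary_pairs u F C Y)"
        using div[OF x y] by simp
    qed
    then show "p \<one>\<^bsub>A\<^esub> y \<otimes> z \<in> Idl (case_prod (\<lambda>b a. p a b) ` complementary_pairs u G Y C')"
      by (simp add: pairs)
  qed
  then show ?thesis unfolding pairs unfolding C'_def .
qed

end

section \<open>Slices of the tensor product of two algebras\<close>

text \<open>
  The universal property of the tensor product as a module, which yields maps that are not
  multiplicative, such as slices.
\<close>

lemma tensor_additive_universal:
  assumes A: "algebra k A" and B: "algebra k B" and C: "abelian_group C"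
    and f_closed: "\<And>a b. a \<in> carrier A \<Longrightarrow> b \<in> carrier B \<Longrightarrow> f a b \<in> carrier C"
    and f_add_left: "\<And>a a' b. a \<in> carrier A \<Longrightarrow> a' \<in> carrier A \<Longrightarrow> b \<in> carrier B \<Longrightarrow>
      f (a \<oplus>\<^bsub>A\<^esub> a') b = f a b \<oplus>\<^bsub>C\<^esub> f a' b"
    and f_add_right: "\<And>a b b'. a \<in> carrier A \<Longrightarrow> b \<in> carrier B \<Longrightarrow> b' \<in> carrier B \<Longrightarrow>
      f a (b \<oplus>\<^bsub>B\<^esub> b') = f a b \<oplus>\<^bsub>C\<^esub> f a b'"
    and f_balanced: "\<And>c a b. c \<in> carrier k \<Longrightarrow> a \<in> carrier A \<Longrightarrow> b \<in> carrier B \<Longrightarrow>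
      f (c \<odot>\<^bsub>A\<^esub> a) b = f a (c \<odot>\<^bsub>B\<^esub> b)"
  obtains h where "h \<in> carrier (tensor k A B) \<rightarrow> carrier C"
    "\<And>V W. V \<in> carrier (tensor k A B) \<Longrightarrow> W \<in> carrier (tensor k A B) \<Longrightarrow>
      h (V \<oplus>\<^bsub>tensor k A B\<^esub> W) = h V \<oplus>\<^bsub>C\<^esub> h W"
    "\<And>a b. a \<in> carrier A \<Longrightarrow> b \<in> carrier B \<Longrightarrow> h (pure_tensor k A B a b) = f a b"
proof -
  interpret A: algebra k A by fact
  interpret B: algebra k B by fact
  interpret C: abelian_group C by fact
  let ?T = "tensor_free A B" and ?S = "carrier A \<times> carrier B" and ?N = "tensor_ideal k A B"
  interpret T: cring ?T by (intro cring_tensor_free A.M_cring B.M_cring)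
  obtain g where g: "g \<in> hom (free_Abelian_group ?S) (add_monoid C)"
    and g_of: "\<And>s. s \<in> ?S \<Longrightarrow> g (frag_of s) = (case s of (a, b) \<Rightarrow> f a b)"
    by (rule comm_group.free_Abelian_group_universal[OF C.a_comm_group, of "\<lambda>s. case s of (a, b) \<Rightarrow> f a b" ?S])
      (auto intro!: f_closed)
  have gc: "g x \<in> carrier C" if "Poly_Mapping.keys x \<subseteq> ?S" for x
    using g that by (auto simp: hom_def Pi_def)
  have g_add: "g (x + y) = g x \<oplus>\<^bsub>C\<^esub> g y"
    if "Poly_Mapping.keys x \<subseteq> ?S" "Poly_Mapping.keys y \<subseteq> ?S" for x y
    using g that by (auto simp: hom_def)
  have keys_diff': "Poly_Mapping.keys (x - y) \<subseteq> ?S"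
    if "Poly_Mapping.keys x \<subseteq> ?S" "Poly_Mapping.keys y \<subseteq> ?S" for x y :: "_ \<Rightarrow>\<^sub>0 int"
    using keys_diff[of x y] that by blast
  have g_diff: "g (x - y) = g x \<ominus>\<^bsub>C\<^esub> g y"
    if "Poly_Mapping.keys x \<subseteq> ?S" "Poly_Mapping.keys y \<subseteq> ?S" for x y
    using g_add[OF keys_diff'[OF that] that(2)] gc[OF that(1)] gc[OF that(2)] gc[OF keys_diff'[OF that]]
    by (simp add: C.minus_eq C.a_assoc C.r_neg)
  have g_0: "g 0 = \<zero>\<^bsub>C\<^esub>"
    using g_diff[of 0 0] gc[of 0] by (simp add: C.minus_eq C.r_neg)
  have rel0: "g x = \<zero>\<^bsub>C\<^esub>" if "x \<in> tensor_rels k A B" for x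
    using that
  proof cases
    case (add_left a a' b)
    have "g x = f (a \<oplus>\<^bsub>A\<^esub> a') b \<ominus>\<^bsub>C\<^esub> f a b \<ominus>\<^bsub>C\<^esub> f a' b"
      unfolding add_left(1) using add_left(2-) by (subst g_diff g_of | simp add: keys_diff')+
    then show ?thesis using add_left(2-) f_closed
      by (simp add: f_add_left C.minus_eq C.a_ac C.r_neg1 C.r_neg2 C.r_neg)
  next
    case (add_right a b b')
    have "g x = f a (b \<oplus>\<^bsub>B\<^esub> b') \<ominus>\<^bsub>C\<^esub> f a b \<ominus>\<^bsub>C\<^esub> f a b'"
      unfolding add_right(1) using add_right(2-) by (subst g_diff g_of | simp add: keys_diff')+
    then show ?thesis using add_right(2-) f_closed
      by (simp add: f_add_right C.minus_eq C.a_ac C.r_neg1 C.r_neg2 C.r_neg)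
  next
    case (balanced c a b)
    have "g x = f (c \<odot>\<^bsub>A\<^esub> a) b \<ominus>\<^bsub>C\<^esub> f a (c \<odot>\<^bsub>B\<^esub> b)"
      unfolding balanced(1) using balanced(2-) by (subst g_diff g_of | simp)+
    then show ?thesis using balanced(2-) f_closed by (simp add: f_balanced C.minus_eq C.r_neg)
  qed
  have rel_mult: "x \<otimes>\<^bsub>?T\<^esub> frag_of s \<in> tensor_rels k A B"
    if "x \<in> tensor_rels k A B" and s: "s \<in> ?S" for x s
  proof -
    obtain c d where cd: "s = (c, d)" "c \<in> carrier A" "d \<in> carrier B" using s by auto
    show ?thesis using that(1)
    proof cases
      case (add_left a a' b)
      then show ?thesis
        using tensor_rels.add_left[of "a \<otimes>\<^bsub>A\<^esub> c" A "a' \<otimes>\<^bsub>A\<^esub> c" "b \<otimes>\<^bsub>B\<^esub> d" B k] cd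
        by (simp add: tensor_free_mult_diff A.l_distr)
    next
      case (add_right a b b')
      then show ?thesis
        using tensor_rels.add_right[of "a \<otimes>\<^bsub>A\<^esub> c" A "b \<otimes>\<^bsub>B\<^esub> d" B "b' \<otimes>\<^bsub>B\<^esub> d" k] cd
        by (simp add: tensor_free_mult_diff B.l_distr)
    next
      case (balanced e a b)
      then show ?thesis
        using tensor_rels.balanced[of e k "a \<otimes>\<^bsub>A\<^esub> c" A "b \<otimes>\<^bsub>B\<^esub> d" B] cd
        by (simp add: tensor_free_mult_diff A.smult_assoc2 B.smult_assoc2)
    qed
  qed
  note rels_car = tensor_rels_carrier[OF A B]
  \<comment> \<open>The relations generate an ideal by definition, whereas the additive map \<open>g\<close> has a kernel that need not
    be an ideal.  \<open>Z\<close> is the largest ideal inside the kernel.\<close>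
  define Z where "Z = {x \<in> carrier ?T. \<forall>y\<in>carrier ?T. g (x \<otimes>\<^bsub>?T\<^esub> y) = \<zero>\<^bsub>C\<^esub>}"
  have "ideal Z ?T"
  proof (rule T.idealI_closed)
    show "Z \<subseteq> carrier ?T" by (auto simp: Z_def)
    show "\<zero>\<^bsub>?T\<^esub> \<in> Z" by (simp add: Z_def g_0)
    show "x \<oplus>\<^bsub>?T\<^esub> y \<in> Z" if xy: "x \<in> Z" "y \<in> Z" for x y
    proof -
      have "g ((x \<oplus>\<^bsub>?T\<^esub> y) \<otimes>\<^bsub>?T\<^esub> w) = \<zero>\<^bsub>C\<^esub>" if w: "w \<in> carrier ?T" for w
      proof -
        have xyc: "x \<in> carrier ?T" "y \<in> carrier ?T" and z: "g (x \<otimes>\<^bsub>?T\<^esub> w) = \<zero>\<^bsub>C\<^esub>" "g (y \<otimes>\<^bsub>?T\<^esub> w) = \<zero>\<^bsub>C\<^esub>"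
          using xy w unfolding Z_def by blast+
        have "g ((x \<oplus>\<^bsub>?T\<^esub> y) \<otimes>\<^bsub>?T\<^esub> w) = g (x \<otimes>\<^bsub>?T\<^esub> w + y \<otimes>\<^bsub>?T\<^esub> w)"
          by (simp only: tensor_free_simps(4) tensor_free_mult_add(1))
        also have "\<dots> = \<zero>\<^bsub>C\<^esub>"
          using g_add[of "x \<otimes>\<^bsub>?T\<^esub> w" "y \<otimes>\<^bsub>?T\<^esub> w"] T.m_closed[OF xyc(1) w] T.m_closed[OF xyc(2) w] z
          by simp
        finally show ?thesis .
      qed
      moreover have "x \<oplus>\<^bsub>?T\<^esub> y \<in> carrier ?T" using xy unfolding Z_def by (blast intro: T.a_closed)
      ultimately show ?thesis unfolding Z_def by blast
    qed
    show "r \<otimes>\<^bsub>?T\<^esub> x \<in> Z" if x: "x \<in> Z" and r: "r \<in> carrier ?T" for x r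
    proof -
      have xc: "x \<in> carrier ?T" using x unfolding Z_def by blast
      have "g ((r \<otimes>\<^bsub>?T\<^esub> x) \<otimes>\<^bsub>?T\<^esub> w) = \<zero>\<^bsub>C\<^esub>" if w: "w \<in> carrier ?T" for w
      proof -
        have "(r \<otimes>\<^bsub>?T\<^esub> x) \<otimes>\<^bsub>?T\<^esub> w = x \<otimes>\<^bsub>?T\<^esub> (r \<otimes>\<^bsub>?T\<^esub> w)"
          unfolding T.m_comm[OF r xc] by (rule T.m_assoc[OF xc r w])
        then show ?thesis using x T.m_closed[OF r w] unfolding Z_def by auto
      qed
      then show ?thesis unfolding Z_def using T.m_closed[OF r xc] by blast
    qed
  qed
  moreover have "tensor_rels k A B \<subseteq> Z"
  proof
    fix x assume x: "x \<in> tensor_rels k A B"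
    have xc: "x \<in> carrier ?T" using rels_car x by blast
    have "g (x \<otimes>\<^bsub>?T\<^esub> y) = \<zero>\<^bsub>C\<^esub>" if "Poly_Mapping.keys y \<subseteq> ?S" for y
    proof -
      have "Poly_Mapping.keys y \<subseteq> ?S \<and> g (x \<otimes>\<^bsub>?T\<^esub> y) = \<zero>\<^bsub>C\<^esub>"
        using that
      proof (induction y rule: frag_induction)
        case zero
        then show ?case by (simp add: g_0)
      next
        case (one s)
        then show ?case using rel0[OF rel_mult[OF x one]] by simp
      next
        case (diff y y')
        have "Poly_Mapping.keys (x \<otimes>\<^bsub>?T\<^esub> y) \<subseteq> ?S" "Poly_Mapping.keys (x \<otimes>\<^bsub>?T\<^esub> y') \<subseteq> ?S"
          using T.m_closed[OF xc, of y] T.m_closed[OF xc, of y'] diff by simp_all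
        then show ?case using diff keys_diff' by (simp add: tensor_free_mult_diff g_diff C.minus_eq)
      qed
      then show ?thesis by simp
    qed
    then show "x \<in> Z" unfolding Z_def using xc by simp
  qed
  ultimately have NZ: "?N \<subseteq> Z"
    unfolding tensor_ideal_def by (rule T.genideal_minimal)
  have val: "the_elem (g ` (?N +>\<^bsub>?T\<^esub> x)) = g x" if x: "x \<in> carrier ?T" for x
  proof -
    have "g y = g x" if y: "y \<in> ?N +>\<^bsub>?T\<^esub> x" for y
    proof -
      obtain n where n: "n \<in> ?N" "y = n \<oplus>\<^bsub>?T\<^esub> x"
        using y unfolding a_r_coset_def' by blast
      have nc: "n \<in> carrier ?T" using n(1) NZ unfolding Z_def by blast
      have "g (n \<otimes>\<^bsub>?T\<^esub> \<one>\<^bsub>?T\<^esub>) = \<zero>\<^bsub>C\<^esub>" using n(1) NZ T.one_closed unfolding Z_def by blast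
      then have "g n = \<zero>\<^bsub>C\<^esub>" by (simp only: T.r_one[OF nc])
      then show ?thesis using n(2) x nc g_add[of n x] gc[of x] by simp
    qed
    moreover have "x \<in> ?N +>\<^bsub>?T\<^esub> x"
      using x ideal_tensor_ideal[OF A B]
      by (intro abelian_subgroup.a_rcos_self abelian_subgroupI3 ideal.axioms(1) T.is_abelian_group)
    ultimately have "g ` (?N +>\<^bsub>?T\<^esub> x) = {g x}" by blast
    then show ?thesis by (simp only: the_elem_eq)
  qed
  note q = ideal.rcos_ring_hom[OF ideal_tensor_ideal[OF A B], folded tensor_def]
  show thesis
  proof
    show "(\<lambda>V. the_elem (g ` V)) \<in> carrier (tensor k A B) \<rightarrow> carrier C"
    proof (rule funcsetI)
      show "the_elem (g ` V) \<in> carrier C" if "V \<in> carrier (tensor k A B)" for V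
        by (rule tensor_carrierE[OF that]) (simp add: val gc)
    qed
    show "the_elem (g ` (V \<oplus>\<^bsub>tensor k A B\<^esub> W)) = the_elem (g ` V) \<oplus>\<^bsub>C\<^esub> the_elem (g ` W)"
      if V: "V \<in> carrier (tensor k A B)" and W: "W \<in> carrier (tensor k A B)" for V W
    proof -
      obtain x y where xy: "x \<in> carrier ?T" "y \<in> carrier ?T"
        "V = ?N +>\<^bsub>?T\<^esub> x" "W = ?N +>\<^bsub>?T\<^esub> y"
        using tensor_carrierE[OF V] tensor_carrierE[OF W] by metis
      show ?thesis
        unfolding xy(3,4) ring_hom_add[OF q xy(1,2), symmetric]
          val[OF xy(1)] val[OF xy(2)] val[OF T.a_closed[OF xy(1,2)]]
        using g_add[of x y] xy(1,2) by simp
    qed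
    show "the_elem (g ` pure_tensor k A B a b) = f a b"
      if "a \<in> carrier A" "b \<in> carrier B" for a b
    proof -
      have "frag_of (a, b) \<in> carrier ?T" using that by simp
      then show ?thesis unfolding pure_tensor_def using val g_of[of "(a, b)"] that by simp
    qed
  qed
qed

lemma tensor_generated:
  assumes A: "algebra k A" and B: "algebra k B" and V: "V \<in> carrier (tensor k A B)"
  shows "\<exists>xs. set xs \<subseteq> carrier A \<times> carrier B \<and> V = tensor_sum (tensor k A B) (pure_tensor k A B) xs"
proof -
  interpret A: algebra k A by fact
  interpret B: algebra k B by fact
  interpret R: cring "tensor k A B" by (rule cring_tensor[OF A B])
  let ?T = "tensor_free A B" and ?S = "carrier A \<times> carrier B" and ?N = "tensor_ideal k A B"
  interpret T: cring ?T by (intro cring_tensor_free A.M_cring B.M_cring)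
  note q = ideal.rcos_ring_hom[OF ideal_tensor_ideal[OF A B], folded tensor_def]
  let ?sum = "tensor_sum (tensor k A B) (pure_tensor k A B)"
  note pc = pure_tensor_closed[OF A B]
  have sum_closed: "?sum xs \<in> carrier (tensor k A B)" if "set xs \<subseteq> ?S" for xs
    using that by (induction xs) (auto simp: pc)
  have sum_append: "?sum (xs @ ys) = ?sum xs \<oplus>\<^bsub>tensor k A B\<^esub> ?sum ys"
    if "set xs \<subseteq> ?S" "set ys \<subseteq> ?S" for xs ys
    using that by (induction xs) (auto simp: sum_closed R.a_assoc pc)
  have pure0: "pure_tensor k A B \<zero>\<^bsub>A\<^esub> b = \<zero>\<^bsub>tensor k A B\<^esub>" if "b \<in> carrier B" for b
  proof -
    have "pure_tensor k A B \<zero>\<^bsub>A\<^esub> b = pure_tensor k A B \<zero>\<^bsub>A\<^esub> b \<oplus>\<^bsub>tensor k A B\<^esub> pure_tensor k A B \<zero>\<^bsub>A\<^esub> b"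
      using pure_tensor_add_left[OF A B A.M.zero_closed A.M.zero_closed that] by simp
    then show ?thesis using pc[OF A.M.zero_closed that] by (metis R.add.r_cancel_one')
  qed
  have pure_neg: "pure_tensor k A B (\<ominus>\<^bsub>A\<^esub> a) b = \<ominus>\<^bsub>tensor k A B\<^esub> pure_tensor k A B a b"
    if "a \<in> carrier A" "b \<in> carrier B" for a b
    using pure_tensor_add_left[OF A B A.M.a_inv_closed[OF that(1)] that] that
      pure0[OF that(2)] pc[OF that] pc[OF A.M.a_inv_closed[OF that(1)] that(2)]
    by (simp add: A.M.l_neg R.minus_equality)
  have neg: "\<ominus>\<^bsub>tensor k A B\<^esub> ?sum xs = ?sum (map (\<lambda>x. (\<ominus>\<^bsub>A\<^esub> fst x, snd x)) xs)" if "set xs \<subseteq> ?S" for xs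
    using that by (induction xs) (auto simp: pure_neg sum_closed pc R.minus_add)
  obtain x where x: "x \<in> carrier ?T" and Vx: "V = ?N +>\<^bsub>?T\<^esub> x" by (rule tensor_carrierE[OF V])
  have "Poly_Mapping.keys x \<subseteq> ?S" using x by simp
  then have "Poly_Mapping.keys x \<subseteq> ?S \<and> (\<exists>xs. set xs \<subseteq> ?S \<and> ?N +>\<^bsub>?T\<^esub> x = ?sum xs)"
  proof (induction x rule: frag_induction)
    case zero
    have "?N +>\<^bsub>?T\<^esub> 0 = \<zero>\<^bsub>tensor k A B\<^esub>"
      using ring_hom_zero[OF q T.ring_axioms R.ring_axioms] by simp
    then show ?case by (intro conjI exI[of _ "[]"]) simp_all
  next
    case (one s)
    obtain a b where s: "s = (a, b)" "a \<in> carrier A" "b \<in> carrier B" using one by auto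
    have "?N +>\<^bsub>?T\<^esub> frag_of s = ?sum [(a, b)]"
      using pc[OF s(2,3)] by (simp add: s(1) pure_tensor_def)
    then show ?case using s by (intro conjI exI[of _ "[(a, b)]"]) simp_all
  next
    case (diff x y)
    obtain xs ys where xs: "set xs \<subseteq> ?S" "?N +>\<^bsub>?T\<^esub> x = ?sum xs"
      and ys: "set ys \<subseteq> ?S" "?N +>\<^bsub>?T\<^esub> y = ?sum ys"
      using diff by blast
    have xc: "x \<in> carrier ?T" and yc: "y \<in> carrier ?T" using diff by simp_all
    have dc: "x - y \<in> carrier ?T" using diff keys_diff[of x y] by auto
    have "?sum xs = (?N +>\<^bsub>?T\<^esub> (x - y)) \<oplus>\<^bsub>tensor k A B\<^esub> ?sum ys"
      using ring_hom_add[OF q dc yc] by (simp flip: xs(2) ys(2))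
    then have "?N +>\<^bsub>?T\<^esub> (x - y) = ?sum xs \<oplus>\<^bsub>tensor k A B\<^esub> \<ominus>\<^bsub>tensor k A B\<^esub> ?sum ys"
      using ring_hom_closed[OF q dc] sum_closed[OF ys(1)] by (simp add: R.a_assoc R.r_neg)
    also have "\<dots> = ?sum (xs @ map (\<lambda>x. (\<ominus>\<^bsub>A\<^esub> fst x, snd x)) ys)"
      using xs(1) ys(1) by (subst sum_append) (auto simp: neg)
    finally show ?case
      using xs(1) ys(1) dc by (intro conjI exI[of _ "xs @ map (\<lambda>x. (\<ominus>\<^bsub>A\<^esub> fst x, snd x)) ys"]) auto
  qed
  then show ?thesis using Vx by blast
qed

text \<open>
  The slices come from the biadditive maps \<open>(a, b) \<mapsto> f b \<odot> a\<close> and \<open>(a, b) \<mapsto> f a \<odot> b\<close>.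
\<close>

theorem algebra_tensor_product_tensor:
  assumes K: "field k" and A: "algebra k A" and B: "algebra k B"
  shows "algebra_tensor_product k A B (tensor k A B) (pure_tensor k A B)"
proof -
  interpret K: field k by fact
  interpret A: algebra k A by fact
  interpret B: algebra k B by fact
  interpret R: cring "tensor k A B" by (rule cring_tensor[OF A B])
  have "\<exists>h. slice A B (tensor k A B) (pure_tensor k A B) f h" if f: "linear_functional k B f" for f
  proof -
    note fD = linear_functionalD[OF f]
    obtain h where "h \<in> carrier (tensor k A B) \<rightarrow> carrier A"
      "\<And>V W. V \<in> carrier (tensor k A B) \<Longrightarrow> W \<in> carrier (tensor k A B) \<Longrightarrow>
        h (V \<oplus>\<^bsub>tensor k A B\<^esub> W) = h V \<oplus>\<^bsub>A\<^esub> h W"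
      "\<And>a b. a \<in> carrier A \<Longrightarrow> b \<in> carrier B \<Longrightarrow> h (pure_tensor k A B a b) = f b \<odot>\<^bsub>A\<^esub> a"
    proof (rule tensor_additive_universal[OF A B A.M.abelian_group_axioms, of "\<lambda>a b. f b \<odot>\<^bsub>A\<^esub> a"])
      show "f b \<odot>\<^bsub>A\<^esub> (c \<odot>\<^bsub>A\<^esub> a) = f (c \<odot>\<^bsub>B\<^esub> b) \<odot>\<^bsub>A\<^esub> a"
        if "c \<in> carrier k" "a \<in> carrier A" "b \<in> carrier B" for c a b
        using that fD by (simp add: K.m_comm[of c] A.smult_assoc1)
    qed (use fD in \<open>auto simp: A.smult_r_distr A.smult_l_distr\<close>)
    then show ?thesis unfolding slice_def by blast
  qed
  moreover have "\<exists>h. slice B A (tensor k A B) (\<lambda>b a. pure_tensor k A B a b) f h"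
    if f: "linear_functional k A f" for f
  proof -
    note fD = linear_functionalD[OF f]
    obtain h where "h \<in> carrier (tensor k A B) \<rightarrow> carrier B"
      "\<And>V W. V \<in> carrier (tensor k A B) \<Longrightarrow> W \<in> carrier (tensor k A B) \<Longrightarrow>
        h (V \<oplus>\<^bsub>tensor k A B\<^esub> W) = h V \<oplus>\<^bsub>B\<^esub> h W"
      "\<And>a b. a \<in> carrier A \<Longrightarrow> b \<in> carrier B \<Longrightarrow> h (pure_tensor k A B a b) = f a \<odot>\<^bsub>B\<^esub> b"
    proof (rule tensor_additive_universal[OF A B B.M.abelian_group_axioms, of "\<lambda>a b. f a \<odot>\<^bsub>B\<^esub> b"])
      show "f (c \<odot>\<^bsub>A\<^esub> a) \<odot>\<^bsub>B\<^esub> b = f a \<odot>\<^bsub>B\<^esub> (c \<odot>\<^bsub>B\<^esub> b)"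
        if "c \<in> carrier k" "a \<in> carrier A" "b \<in> carrier B" for c a b
        using that fD by (simp add: K.m_comm[of c] B.smult_assoc1)
    qed (use fD in \<open>auto simp: B.smult_r_distr B.smult_l_distr\<close>)
    then show ?thesis unfolding slice_def by blast
  qed
  ultimately show ?thesis
    using pure_tensor_closed[OF A B] pure_tensor_mult[OF A B] pure_tensor_one[OF A B]
      pure_tensor_add_left[OF A B] pure_tensor_add_right[OF A B] pure_tensor_balanced[OF A B]
      tensor_generated[OF A B]
    by (intro algebra_tensor_product.intro algebra_tensor_product_axioms.intro K A B R.cring_axioms)
qed

section \<open>Saturation of a sum of products\<close>

definition saturation :: "('r, 'o) ring_scheme \<Rightarrow> 'r set \<Rightarrow> 'r set \<Rightarrow> 'r set"
  where "saturation R Q J = (\<Union>m\<in>{1..}. colon_ideal R Q (ideal_power R J m))"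

context cring
begin

lemma genideal_mono: "S \<subseteq> T \<Longrightarrow> T \<subseteq> carrier R \<Longrightarrow> Idl S \<subseteq> Idl T"
  using genideal_self[of T] by (intro genideal_minimal genideal_ideal) auto

lemma genideal_prod:
  assumes S: "S \<subseteq> carrier R" and T: "T \<subseteq> carrier R"
  shows "(Idl S) \<cdot> (Idl T) = Idl {s \<otimes> t | s t. s \<in> S \<and> t \<in> T}"
proof
  let ?U = "Idl {s \<otimes> t | s t. s \<in> S \<and> t \<in> T}"
  have gens: "{s \<otimes> t | s t. s \<in> S \<and> t \<in> T} \<subseteq> carrier R" using S T by blast
  note U = genideal_ideal[OF gens]
  note ids = genideal_ideal[OF S] genideal_ideal[OF T]
  show "(Idl S) \<cdot> (Idl T) \<subseteq> ?U"
  proof (rule ideal_prod_subsetI[OF U])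
    have 1: "Idl S \<subseteq> colon_ideal R ?U T"
      using S genideal_self[OF gens] by (intro genideal_minimal colon_ideal_is_ideal U T) (auto simp: colon_ideal_def)
    have "t \<otimes> s \<in> ?U" if t: "t \<in> T" and s: "s \<in> Idl S" for s t
    proof -
      have "s \<otimes> t \<in> ?U" using 1 s t by (auto simp: colon_ideal_def)
      then show ?thesis using m_comm[of s t] T t ideal.Icarr[OF ids(1) s] by auto
    qed
    moreover have Sc: "Idl S \<subseteq> carrier R" using ideal.Icarr[OF ids(1)] by blast
    ultimately have "Idl T \<subseteq> colon_ideal R ?U (Idl S)"
      using T by (intro genideal_minimal[OF colon_ideal_is_ideal[OF U Sc]]) (auto simp: colon_ideal_def)
    then have "j \<otimes> i \<in> ?U" if "i \<in> Idl S" "j \<in> Idl T" for i j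
      using that by (auto simp: colon_ideal_def)
    then show "i \<otimes> j \<in> ?U" if "i \<in> Idl S" "j \<in> Idl T" for i j
      using that m_comm[OF ideal.Icarr[OF ids(1)] ideal.Icarr[OF ids(2)], of i j] by simp
  qed
  show "?U \<subseteq> (Idl S) \<cdot> (Idl T)"
    using genideal_self[OF S] genideal_self[OF T]
    by (intro genideal_minimal ideal_prod_is_ideal ids) (auto intro!: ideal_prod.prod)
qed

lemma genideal_UN_genideal:
  assumes "\<And>i. i \<in> N \<Longrightarrow> S i \<subseteq> carrier R"
  shows "Idl (\<Union>i\<in>N. Idl (S i)) = Idl (\<Union>i\<in>N. S i)"
proof
  have U: "(\<Union>i\<in>N. S i) \<subseteq> carrier R" using assms by blast
  have sub: "Idl (S i) \<subseteq> Idl (\<Union>i\<in>N. S i)" if "i \<in> N" for i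
    using that by (intro genideal_mono U) blast
  then show "Idl (\<Union>i\<in>N. Idl (S i)) \<subseteq> Idl (\<Union>i\<in>N. S i)"
    by (intro genideal_minimal genideal_ideal U) blast
  show "Idl (\<Union>i\<in>N. S i) \<subseteq> Idl (\<Union>i\<in>N. Idl (S i))"
  proof (rule genideal_mono)
    show "(\<Union>i\<in>N. S i) \<subseteq> (\<Union>i\<in>N. Idl (S i))" using genideal_self[OF assms] by blast
    show "(\<Union>i\<in>N. Idl (S i)) \<subseteq> carrier R"
      using ideal.Icarr[OF genideal_ideal[OF assms]] by blast
  qed
qed

text \<open>
  The elements generated by finite subsets of \<open>G\<close> form an ideal that contains \<open>G\<close>.
\<close>

lemma genideal_finite_support:
  assumes G: "G \<subseteq> carrier R" and x: "x \<in> Idl G"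
  shows "\<exists>G'\<subseteq>G. finite G' \<and> x \<in> Idl G'"
proof -
  let ?U = "{x. \<exists>G'\<subseteq>G. finite G' \<and> x \<in> Idl G'}"
  have idl: "ideal (Idl G') R" if "G' \<subseteq> G" for G' using that G by (intro genideal_ideal) auto
  have "ideal ?U R"
  proof (rule idealI_closed)
    show "?U \<subseteq> carrier R" using ideal.Icarr[OF idl] by blast
    show "\<zero> \<in> ?U"
      using additive_subgroup.zero_closed[OF ideal.axioms(1)[OF idl[of "{}"]]] by auto
    show "x \<oplus> y \<in> ?U" if xy: "x \<in> ?U" "y \<in> ?U" for x y
    proof -
      obtain G1 G2 where 1: "G1 \<subseteq> G" "finite G1" "x \<in> Idl G1" and 2: "G2 \<subseteq> G" "finite G2" "y \<in> Idl G2"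
        using xy by blast
      have 3: "G1 \<union> G2 \<subseteq> G" using 1 2 by blast
      have "Idl G1 \<subseteq> Idl (G1 \<union> G2)" "Idl G2 \<subseteq> Idl (G1 \<union> G2)"
        by (rule genideal_mono; use 3 G in blast)+
      then have "x \<oplus> y \<in> Idl (G1 \<union> G2)"
        using 1(3) 2(3) additive_subgroup.a_closed[OF ideal.axioms(1)[OF idl[OF 3]]] by blast
      moreover have "finite (G1 \<union> G2)" using 1 2 by simp
      ultimately show ?thesis using 3 by blast
    qed
    show "r \<otimes> x \<in> ?U" if "x \<in> ?U" "r \<in> carrier R" for x r
      using that ideal.I_l_closed[OF idl] by blast
  qed
  moreover have "G \<subseteq> ?U"
  proof
    fix g assume "g \<in> G"
    then have "{g} \<subseteq> G" "g \<in> Idl {g}" using G genideal_self[of "{g}"] by auto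
    then show "g \<in> ?U" by blast
  qed
  ultimately show ?thesis using genideal_minimal x by blast
qed

lemma noetherian_genideal_finite_subset:
  assumes "noetherian_ring R" and G: "G \<subseteq> carrier R"
  shows "\<exists>G'\<subseteq>G. finite G' \<and> Idl G = Idl G'"
proof -
  obtain S where S: "S \<subseteq> carrier R" "finite S" "Idl G = Idl S"
    using noetherian_ring.finetely_gen[OF assms(1) genideal_ideal[OF G]] by blast
  have "\<forall>s\<in>S. \<exists>G'. G' \<subseteq> G \<and> finite G' \<and> s \<in> Idl G'"
    using genideal_finite_support[OF G] genideal_self[OF S(1)] S(3) by blast
  then obtain g where g: "\<And>s. s \<in> S \<Longrightarrow> g s \<subseteq> G \<and> finite (g s) \<and> s \<in> Idl (g s)"
    by metis
  define G' where "G' = (\<Union>s\<in>S. g s)"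
  have sub: "G' \<subseteq> G" and fin: "finite G'" using g S(2) by (auto simp: G'_def)
  have "s \<in> Idl G'" if "s \<in> S" for s
  proof -
    have "Idl (g s) \<subseteq> Idl G'" using that sub G by (intro genideal_mono) (auto simp: G'_def)
    then show ?thesis using g[OF that] by blast
  qed
  then have "Idl G \<subseteq> Idl G'"
    unfolding S(3) using sub G by (intro genideal_minimal genideal_ideal) auto
  moreover have "Idl G' \<subseteq> Idl G" by (rule genideal_mono[OF sub G])
  ultimately show ?thesis using sub fin by blast
qed

text \<open>
  The colon ideals by the powers of \<open>J\<close> form an increasing chain.
\<close>

lemma saturation_is_ideal:
  assumes Q: "ideal Q R" and J: "ideal J R"
  shows "ideal (saturation R Q J) R"
proof (rule idealI_closed)
  have sub: "ideal_power R J m \<subseteq> carrier R" for m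
    using ideal.Icarr[OF ideal_power_is_ideal[OF J]] by blast
  note col = colon_ideal_is_ideal[OF Q sub]
  show "saturation R Q J \<subseteq> carrier R" by (auto simp: saturation_def colon_ideal_def)
  show "\<zero> \<in> saturation R Q J"
    using additive_subgroup.zero_closed[OF ideal.axioms(1)[OF col[of 1]]] unfolding saturation_def by blast
  show "x \<oplus> y \<in> saturation R Q J" if xy: "x \<in> saturation R Q J" "y \<in> saturation R Q J" for x y
  proof -
    obtain m n where m: "1 \<le> m" "x \<in> colon_ideal R Q (ideal_power R J m)"
      and n: "1 \<le> n" "y \<in> colon_ideal R Q (ideal_power R J n)"
      using xy by (auto simp: saturation_def)
    have "x \<in> colon_ideal R Q (ideal_power R J (max m n))" "y \<in> colon_ideal R Q (ideal_power R J (max m n))"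
      using m(2) n(2) colon_ideal_mono[OF order_refl ideal_power_antimono[OF J]] max.cobounded1 max.cobounded2
      by (meson subsetD)+
    then have "x \<oplus> y \<in> colon_ideal R Q (ideal_power R J (max m n))"
      by (rule additive_subgroup.a_closed[OF ideal.axioms(1)[OF col]])
    then show ?thesis using m(1) unfolding saturation_def by (intro UN_I[of "max m n"]) auto
  qed
  show "r \<otimes> x \<in> saturation R Q J" if "x \<in> saturation R Q J" "r \<in> carrier R" for x r
    using that ideal.I_l_closed[OF col] unfolding saturation_def by blast
qed

end

context algebra_tensor_product
begin

lemma pure_subset_carrier: "G \<subseteq> carrier A \<times> carrier B \<Longrightarrow> case_prod p ` G \<subseteq> carrier R"
  by auto

lemma extended_ideals_prod:
  assumes C: "C \<subseteq> carrier A" and D: "D \<subseteq> carrier B"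
  shows "(Idl ((\<lambda>a. p a \<one>\<^bsub>B\<^esub>) ` C)) \<cdot> (Idl ((\<lambda>b. p \<one>\<^bsub>A\<^esub> b) ` D)) = Idl (case_prod p ` (C \<times> D))"
proof -
  have *: "p a \<one>\<^bsub>B\<^esub> \<otimes> p \<one>\<^bsub>A\<^esub> b = p a b" if "a \<in> C" "b \<in> D" for a b
    using that C D by (simp add: p_mult subset_iff)
  have "{s \<otimes> t | s t. s \<in> (\<lambda>a. p a \<one>\<^bsub>B\<^esub>) ` C \<and> t \<in> (\<lambda>b. p \<one>\<^bsub>A\<^esub> b) ` D} = case_prod p ` (C \<times> D)"
    (is "?L = ?R")
  proof
    show "?L \<subseteq> ?R" using * by fastforce
    show "?R \<subseteq> ?L" using *[symmetric] by fastforce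
  qed
  then show ?thesis using C D by (subst genideal_prod) auto
qed

text \<open>
  Both sides are generated by the pure tensors \<open>c c' \<otimes> d d'\<close>: biadditivity reduces a pure tensor of two
  elements of the product ideals to these.
\<close>

lemma pure_ideal_prod:
  assumes ids: "ideal C A" "ideal C' A" "ideal D B" "ideal D' B"
  shows "(Idl (case_prod p ` (C \<times> D))) \<cdot> (Idl (case_prod p ` (C' \<times> D')))
    = Idl (case_prod p ` ((C \<cdot>\<^bsub>A\<^esub> C') \<times> (D \<cdot>\<^bsub>B\<^esub> D')))"
proof -
  note car = ideal.Icarr[OF ids(1)] ideal.Icarr[OF ids(2)] ideal.Icarr[OF ids(3)] ideal.Icarr[OF ids(4)]
  have pc: "C \<cdot>\<^bsub>A\<^esub> C' \<subseteq> carrier A" "D \<cdot>\<^bsub>B\<^esub> D' \<subseteq> carrier B"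
    using A.ideal_prod_in_carrier[OF ids(1,2)] B.ideal_prod_in_carrier[OF ids(3,4)] .
  have sub: "case_prod p ` (C \<times> D) \<subseteq> carrier R" "case_prod p ` (C' \<times> D') \<subseteq> carrier R"
    "case_prod p ` ((C \<cdot>\<^bsub>A\<^esub> C') \<times> (D \<cdot>\<^bsub>B\<^esub> D')) \<subseteq> carrier R"
    using car pc by (auto intro!: p_closed)
  let ?G = "{s \<otimes> t | s t. s \<in> case_prod p ` (C \<times> D) \<and> t \<in> case_prod p ` (C' \<times> D')}"
  have Gc: "?G \<subseteq> carrier R" using sub by blast
  have U: "ideal (Idl ?G) R" by (rule genideal_ideal[OF Gc])
  have Uadd: "x \<oplus> y \<in> Idl ?G" if "x \<in> Idl ?G" "y \<in> Idl ?G" for x y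
    by (rule additive_subgroup.a_closed[OF ideal.axioms(1)[OF U] that])
  have gen: "p (c \<otimes>\<^bsub>A\<^esub> c') (d \<otimes>\<^bsub>B\<^esub> d') \<in> ?G" if "c \<in> C" "c' \<in> C'" "d \<in> D" "d' \<in> D'" for c c' d d'
    using that car p_mult[of c d c' d'] by (intro CollectI exI[of _ "p c d"] exI[of _ "p c' d'"]) auto
  have 1: "p i (d \<otimes>\<^bsub>B\<^esub> d') \<in> Idl ?G" if "i \<in> C \<cdot>\<^bsub>A\<^esub> C'" "d \<in> D" "d' \<in> D'" for i d d'
    using that(1)
  proof induction
    case (prod c c')
    show ?case using gen[OF prod that(2,3)] genideal_self[OF Gc] by blast
  next
    case (sum s1 s2)
    then show ?case
      using pc(1) that(2,3) car Uadd p_add_left[of s1 s2 "d \<otimes>\<^bsub>B\<^esub> d'"] by (auto simp: subset_iff)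
  qed
  have 2: "p i j \<in> Idl ?G" if i: "i \<in> C \<cdot>\<^bsub>A\<^esub> C'" and j: "j \<in> D \<cdot>\<^bsub>B\<^esub> D'" for i j
    using j
  proof induction
    case (prod d d')
    then show ?case using 1[OF i] by simp
  next
    case (sum s1 s2)
    then show ?case using pc i Uadd p_add_right[of i s1 s2] by (auto simp: subset_iff)
  qed
  have "Idl ?G = Idl (case_prod p ` ((C \<cdot>\<^bsub>A\<^esub> C') \<times> (D \<cdot>\<^bsub>B\<^esub> D')))"
  proof
    have "?G \<subseteq> case_prod p ` ((C \<cdot>\<^bsub>A\<^esub> C') \<times> (D \<cdot>\<^bsub>B\<^esub> D'))"
    proof
      fix x assume "x \<in> ?G"
      then obtain c d c' d' where m: "c \<in> C" "d \<in> D" "c' \<in> C'" "d' \<in> D'" and x: "x = p c d \<otimes> p c' d'"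
        by auto
      then have "x = p (c \<otimes>\<^bsub>A\<^esub> c') (d \<otimes>\<^bsub>B\<^esub> d')" using car by (simp add: p_mult)
      then show "x \<in> case_prod p ` ((C \<cdot>\<^bsub>A\<^esub> C') \<times> (D \<cdot>\<^bsub>B\<^esub> D'))"
        using m by (auto intro!: image_eqI[of _ _ "(c \<otimes>\<^bsub>A\<^esub> c', d \<otimes>\<^bsub>B\<^esub> d')"] ideal_prod.prod)
    qed
    then show "Idl ?G \<subseteq> Idl (case_prod p ` ((C \<cdot>\<^bsub>A\<^esub> C') \<times> (D \<cdot>\<^bsub>B\<^esub> D')))"
      by (rule genideal_mono[OF _ sub(3)])
    show "Idl (case_prod p ` ((C \<cdot>\<^bsub>A\<^esub> C') \<times> (D \<cdot>\<^bsub>B\<^esub> D'))) \<subseteq> Idl ?G"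
      using 2 by (intro genideal_minimal U) auto
  qed
  then show ?thesis using genideal_prod[OF sub(1,2)] by simp
qed

text \<open>
  For \<open>n = 0\<close> the right-hand side is the unit ideal, because \<open>1 \<otimes> 1\<close> is the unit of \<open>R\<close>.
\<close>

lemma pure_ideal_power:
  assumes C: "ideal C A" and D: "ideal D B"
  shows "ideal_power R (Idl (case_prod p ` (C \<times> D))) n
    = Idl (case_prod p ` (ideal_power A C n \<times> ideal_power B D n))"
proof (induction n)
  case 0
  have sub: "case_prod p ` (carrier A \<times> carrier B) \<subseteq> carrier R" by auto
  have "\<one> \<in> case_prod p ` (carrier A \<times> carrier B)"
    using p_one by (intro image_eqI[of _ _ "(\<one>\<^bsub>A\<^esub>, \<one>\<^bsub>B\<^esub>)"]) auto
  then have "Idl (case_prod p ` (carrier A \<times> carrier B)) = carrier R"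
    using genideal_self[OF sub] by (intro ideal.one_imp_carrier[OF genideal_ideal[OF sub]]) blast
  then show ?case by (simp add: ideal_power_simps A.ideal_power_simps B.ideal_power_simps)
next
  case (Suc n)
  show ?case
    unfolding ideal_power_simps(2) A.ideal_power_simps(2) B.ideal_power_simps(2) Suc
    by (rule pure_ideal_prod[OF A.ideal_power_is_ideal[OF C] C B.ideal_power_is_ideal[OF D] D])
qed

text \<open>
  The exponents \<open>0\<close> and \<open>u\<close> are included so that the largest ideal in the chain of each factor is the whole ring.
\<close>

lemma finite_complementary_support:
  assumes noeth: "noetherian_ring R" and u: "0 \<le> u"
    and C: "ideal_filtration A u C" and D: "ideal_filtration B u D"
  obtains F where "finite F" "F \<subseteq> {0..u}" "0 \<in> F" "u \<in> F"
    "Idl (case_prod p ` complementary_pairs u {0..u} C D) \<subseteq> Idl (case_prod p ` complementary_pairs u F C D)"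
proof -
  let ?G = "case_prod p ` complementary_pairs u {0..u} C D"
  have Gc: "?G \<subseteq> carrier R"
    by (rule pure_subset_carrier[OF complementary_pairs_closed(1)[OF order_refl C D]])
  obtain G' where G': "G' \<subseteq> ?G" "finite G'" "Idl ?G = Idl G'"
    using noetherian_genideal_finite_subset[OF noeth Gc] by blast
  have "\<forall>g\<in>G'. \<exists>w\<in>{0..u}. g \<in> case_prod p ` complementary_pairs u {w} C D"
    using G'(1) by (fastforce simp: complementary_pairs_def)
  then obtain w where w: "\<And>g. g \<in> G' \<Longrightarrow> w g \<in> {0..u} \<and> g \<in> case_prod p ` complementary_pairs u {w g} C D"
    by metis
  define F where "F = insert 0 (insert u (w ` G'))"
  have F: "finite F" "F \<subseteq> {0..u}" "0 \<in> F" "u \<in> F" using w G'(2) u by (auto simp: F_def)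
  have "G' \<subseteq> case_prod p ` complementary_pairs u F C D"
  proof
    fix g assume g: "g \<in> G'"
    have "complementary_pairs u {w g} C D \<subseteq> complementary_pairs u F C D"
      using g by (auto simp: complementary_pairs_def F_def)
    then show "g \<in> case_prod p ` complementary_pairs u F C D" using w[OF g] by blast
  qed
  then have "Idl ?G \<subseteq> Idl (case_prod p ` complementary_pairs u F C D)"
    unfolding G'(3) by (rule genideal_mono[OF _ pure_subset_carrier[OF complementary_pairs_closed(1)[OF F(2) C D]]])
  then show thesis using that F by blast
qed

text \<open>
  For the inclusion from left to right, the power \<open>m\<close> of \<open>KL\<close> that multiplies \<open>z\<close> into the sum is fixed, and
  \<open>divide_both\<close> distributes it over the two factors.  For the other inclusion, the factors of a generator,
  which may need different powers of \<open>K\<close> and \<open>L\<close>, are compared at the larger exponent.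
\<close>

theorem saturation_complementary_sum:
  assumes noeth: "noetherian_ring R" and u: "0 \<le> u"
    and C: "ideal_filtration A u C" and D: "ideal_filtration B u D"
    and K: "ideal K A" and L: "ideal L B"
  shows "saturation R (Idl (case_prod p ` complementary_pairs u {0..u} C D)) (Idl (case_prod p ` (K \<times> L)))
    = Idl (case_prod p ` complementary_pairs u {0..u} (\<lambda>w. saturation A (C w) K) (\<lambda>w. saturation B (D w) L))"
    (is "saturation R ?Q ?KL = Idl (case_prod p ` ?P)")
proof
  note Kn = A.ideal_power_is_ideal[OF K] and Ln = B.ideal_power_is_ideal[OF L]
  have Kc: "ideal_power A K m \<subseteq> carrier A" for m using ideal.Icarr[OF Kn] by blast
  have Lc: "ideal_power B L m \<subseteq> carrier B" for m using ideal.Icarr[OF Ln] by blast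
  have KLc: "case_prod p ` (ideal_power A K m \<times> ideal_power B L m) \<subseteq> carrier R" for m
    using Kc Lc by (intro pure_subset_carrier) blast
  have KL: "ideal ?KL R"
    using ideal.Icarr[OF K] ideal.Icarr[OF L] by (intro genideal_ideal pure_subset_carrier) auto
  have Pc: "case_prod p ` ?P \<subseteq> carrier R"
    by (intro pure_subset_carrier) (auto simp: complementary_pairs_def saturation_def colon_ideal_def)
  have Qc: "case_prod p ` complementary_pairs u {0..u} C D \<subseteq> carrier R"
    by (rule pure_subset_carrier[OF complementary_pairs_closed(1)[OF order_refl C D]])
  note Q = genideal_ideal[OF Qc]
  obtain F where F: "finite F" "F \<subseteq> {0..u}" "0 \<in> F" "u \<in> F"
    and QF: "?Q \<subseteq> Idl (case_prod p ` complementary_pairs u F C D)"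
    by (rule finite_complementary_support[OF noeth u C D])
  show "saturation R ?Q ?KL \<subseteq> Idl (case_prod p ` ?P)"
  proof
    fix z assume "z \<in> saturation R ?Q ?KL"
    then obtain m where m: "1 \<le> m" and z: "z \<in> carrier R"
      and div: "\<And>g. g \<in> ideal_power R ?KL m \<Longrightarrow> z \<otimes> g \<in> ?Q"
      by (auto simp: saturation_def colon_ideal_def)
    have "z \<in> Idl (case_prod p ` complementary_pairs u F
        (\<lambda>w. colon_ideal A (C w) (ideal_power A K m)) (\<lambda>w. colon_ideal B (D w) (ideal_power B L m)))"
    proof (rule divide_both[OF F C D Kc Lc z])
      fix x y assume "x \<in> ideal_power A K m" "y \<in> ideal_power B L m"
      then have "p x y \<in> case_prod p ` (ideal_power A K m \<times> ideal_power B L m)" by auto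
      then have "p x y \<in> ideal_power R ?KL m"
        unfolding pure_ideal_power[OF K L] using genideal_self[OF KLc] by blast
      then show "z \<otimes> p x y \<in> Idl (case_prod p ` complementary_pairs u F C D)"
        using div QF by blast
    qed
    moreover have "complementary_pairs u F
        (\<lambda>w. colon_ideal A (C w) (ideal_power A K m)) (\<lambda>w. colon_ideal B (D w) (ideal_power B L m)) \<subseteq> ?P"
      using F(2) m unfolding complementary_pairs_def saturation_def by fastforce
    ultimately show "z \<in> Idl (case_prod p ` ?P)"
      using genideal_mono[OF image_mono Pc] by blast
  qed
  show "Idl (case_prod p ` ?P) \<subseteq> saturation R ?Q ?KL"
  proof (rule genideal_minimal[OF saturation_is_ideal[OF Q KL]])
    show "case_prod p ` ?P \<subseteq> saturation R ?Q ?KL"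
    proof
      fix g assume "g \<in> case_prod p ` ?P"
      then obtain a b w where w: "w \<in> {0..u}" and a: "a \<in> saturation A (C w) K"
        and b: "b \<in> saturation B (D (u - w)) L" and g: "g = p a b"
        by (auto simp: complementary_pairs_def)
      obtain m where m: "1 \<le> m" "a \<in> colon_ideal A (C w) (ideal_power A K m)"
        using a by (auto simp: saturation_def)
      obtain n where n: "1 \<le> n" "b \<in> colon_ideal B (D (u - w)) (ideal_power B L n)"
        using b by (auto simp: saturation_def)
      have ac: "a \<in> carrier A" and bc: "b \<in> carrier B" using m(2) n(2) by (auto simp: colon_ideal_def)
      define l where "l = max m n"
      have al: "a \<otimes>\<^bsub>A\<^esub> x \<in> C w" if "x \<in> ideal_power A K l" for x
        using m(2) A.ideal_power_antimono[OF K, of m l] that by (auto simp: colon_ideal_def l_def)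
      have bl: "b \<otimes>\<^bsub>B\<^esub> y \<in> D (u - w)" if "y \<in> ideal_power B L l" for y
        using n(2) B.ideal_power_antimono[OF L, of n l] that by (auto simp: colon_ideal_def l_def)
      have pab: "{p a b} \<subseteq> carrier R" using ac bc by simp
      have "Idl (case_prod p ` (ideal_power A K l \<times> ideal_power B L l)) \<subseteq> colon_ideal R ?Q {p a b}"
      proof (rule genideal_minimal[OF colon_ideal_is_ideal[OF Q pab]])
        show "case_prod p ` (ideal_power A K l \<times> ideal_power B L l) \<subseteq> colon_ideal R ?Q {p a b}"
        proof
          fix v assume "v \<in> case_prod p ` (ideal_power A K l \<times> ideal_power B L l)"
          then obtain x y where x: "x \<in> ideal_power A K l" and y: "y \<in> ideal_power B L l" and v: "v = p x y"
            by auto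
          have xc: "x \<in> carrier A" "y \<in> carrier B" using x y Kc Lc by blast+
          have "v \<otimes> p a b = p (a \<otimes>\<^bsub>A\<^esub> x) (b \<otimes>\<^bsub>B\<^esub> y)"
            unfolding v using xc ac bc by (simp add: p_mult A.m_comm B.m_comm)
          moreover have "(a \<otimes>\<^bsub>A\<^esub> x, b \<otimes>\<^bsub>B\<^esub> y) \<in> complementary_pairs u {0..u} C D"
            using al[OF x] bl[OF y] w by (auto simp: complementary_pairs_def)
          ultimately have "v \<otimes> p a b \<in> ?Q" using genideal_self[OF Qc] by force
          then show "v \<in> colon_ideal R ?Q {p a b}" using xc by (simp add: colon_ideal_def v)
        qed
      qed
      then have "p a b \<otimes> v \<in> ?Q" if "v \<in> ideal_power R ?KL l" for v
        using that ac bc unfolding pure_ideal_power[OF K L] by (auto simp: colon_ideal_def m_comm[of "p a b"])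
      then have "p a b \<in> colon_ideal R ?Q (ideal_power R ?KL l)"
        using ac bc by (simp add: colon_ideal_def)
      then show "g \<in> saturation R ?Q ?KL"
        unfolding g saturation_def using m(1) by (intro UN_I[of l]) (auto simp: l_def)
    qed
  qed
qed

end

section \<open>Saturated powers of a sum of extended ideals\<close>

lemma (in cring) rational_power_filtration:
  assumes "noetherian_ring R" "ideal I R"
  shows "ideal_filtration R u (rational_power R I)"
  using rational_power_0 rational_power_is_ideal[OF assms] rational_power_antimono[OF assms]
  by (simp add: ideal_filtration_def)

lemma (in cring) saturated_power_eq: "saturated_power R I J w = saturation R (rational_power R I w) J"
  by (simp add: saturated_power_def saturation_def)

lemma (in algebra_tensor_product) sum_extended_products:
  assumes C: "\<And>w. C w \<subseteq> carrier A" and D: "\<And>w. D w \<subseteq> carrier B"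
  shows "Idl (\<Union>w\<in>{0..u}. (Idl ((\<lambda>a. p a \<one>\<^bsub>B\<^esub>) ` C w)) \<cdot> (Idl ((\<lambda>b. p \<one>\<^bsub>A\<^esub> b) ` D (u - w))))
    = Idl (case_prod p ` complementary_pairs u {0..u} C D)"
proof -
  have "(\<Union>w\<in>{0..u}. case_prod p ` (C w \<times> D (u - w))) = case_prod p ` complementary_pairs u {0..u} C D"
    by (auto simp: complementary_pairs_def)
  moreover have "case_prod p ` (C w \<times> D (u - w)) \<subseteq> carrier R" for w
    using C D by (intro pure_subset_carrier) blast
  ultimately show ?thesis
    using genideal_UN_genideal[of "{0..u}" "\<lambda>w. case_prod p ` (C w \<times> D (u - w))"]
    by (simp add: extended_ideals_prod C D)
qed

theorem theorem3p11:
  fixes k :: "('k, 'l) ring_scheme"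
    and A :: "('k, 'a, 'm) module_scheme"
    and B :: "('k, 'b, 'n) module_scheme"
    and I K :: "'a set" and J L :: "'b set" and u :: rat
  defines "R \<equiv> tensor k A B"
    and "eA \<equiv> extend_left k A B"
    and "eB \<equiv> extend_right k A B"
  assumes "field k"
    and "algebra k A" and "noetherian_ring A"
    and "algebra k B" and "noetherian_ring B"
    and "noetherian_ring R"
    and "ideal I A" and "ideal K A"
    and "ideal J B" and "ideal L B"
    and "0 < u"
    and "rational_power R (eA I <+>\<^bsub>R\<^esub> eB J) u
           = Idl\<^bsub>R\<^esub> (\<Union>w\<in>{0..u}. eA (rational_power A I w) \<cdot>\<^bsub>R\<^esub> eB (rational_power B J (u - w)))"
  shows "saturated_power R (eA I <+>\<^bsub>R\<^esub> eB J) (eA K \<cdot>\<^bsub>R\<^esub> eB L) u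
           = Idl\<^bsub>R\<^esub> (\<Union>w\<in>{0..u}. eA (saturated_power A I K w) \<cdot>\<^bsub>R\<^esub> eB (saturated_power B J L (u - w)))"
proof -
  interpret T: algebra_tensor_product k A B R "pure_tensor k A B"
    unfolding R_def by (rule algebra_tensor_product_tensor) fact+
  let ?p = "pure_tensor k A B"
  have eA: "eA N = Idl\<^bsub>R\<^esub> ((\<lambda>a. ?p a \<one>\<^bsub>B\<^esub>) ` N)" for N
    by (simp add: eA_def extend_left_def R_def)
  have eB: "eB N = Idl\<^bsub>R\<^esub> ((\<lambda>b. ?p \<one>\<^bsub>A\<^esub> b) ` N)" for N
    by (simp add: eB_def extend_right_def R_def)
  have rat: "rational_power A I w \<subseteq> carrier A" "rational_power B J w \<subseteq> carrier B" for w
    by (auto simp: rational_power_def split: prod.splits)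
  have sat: "saturated_power A I K w \<subseteq> carrier A" "saturated_power B J L w \<subseteq> carrier B" for w
    by (auto simp: saturated_power_def colon_ideal_def)
  have "K \<subseteq> carrier A" "L \<subseteq> carrier B"
    using ideal.Icarr[OF \<open>ideal K A\<close>] ideal.Icarr[OF \<open>ideal L B\<close>] by blast+
  then have KL: "eA K \<cdot>\<^bsub>R\<^esub> eB L = Idl\<^bsub>R\<^esub> (case_prod ?p ` (K \<times> L))"
    unfolding eA eB by (rule T.extended_ideals_prod)
  have "saturated_power R (eA I <+>\<^bsub>R\<^esub> eB J) (eA K \<cdot>\<^bsub>R\<^esub> eB L) u
      = saturation R (rational_power R (eA I <+>\<^bsub>R\<^esub> eB J) u) (eA K \<cdot>\<^bsub>R\<^esub> eB L)"
    by (rule T.R.saturated_power_eq)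
  also have "rational_power R (eA I <+>\<^bsub>R\<^esub> eB J) u
      = Idl\<^bsub>R\<^esub> (case_prod ?p ` complementary_pairs u {0..u} (rational_power A I) (rational_power B J))"
    unfolding assms(15) unfolding eA eB by (rule T.sum_extended_products[OF rat])
  also have "saturation R \<dots> (eA K \<cdot>\<^bsub>R\<^esub> eB L)
      = Idl\<^bsub>R\<^esub> (case_prod ?p ` complementary_pairs u {0..u} (saturated_power A I K) (saturated_power B J L))"
    unfolding KL T.A.saturated_power_eq T.B.saturated_power_eq
    using \<open>0 < u\<close> assms
    by (intro T.saturation_complementary_sum T.A.rational_power_filtration T.B.rational_power_filtration) simp_all
  also have "\<dots> = Idl\<^bsub>R\<^esub> (\<Union>w\<in>{0..u}. eA (saturated_power A I K w) \<cdot>\<^bsub>R\<^esub> eB (saturated_power B J L (u - w)))"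
    unfolding eA eB by (rule T.sum_extended_products[OF sat, symmetric])
  finally show ?thesis .
qed

end
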